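(* Let $M\subseteq N$ be transitive models of $\mathrm{ZFC}$. Let $\mathcal U\in M$ be such that, in $M$, $\mathcal U$ is a non-principal ultrafilter on $\omega$, and let $\mathcal V\in N$ be such that, in $N$, $\mathcal V$ is a non-principal ultrafilter on $\omega$ with $\mathcal U\subseteq\mathcal V$. Then: (b) Let $F\subseteq M$ be finite and let $\dot x\in M$ be an $\mathbb L_{\mathcal U}$-name for a member of $F$. For each $s\in\omega^{<\omega}$ let $z_s\in F$ be such that $T\nVdash_{\mathbb L_{\mathcal U},M}\dot x\neq z_s$ for every $T\in\mathbb L_{\mathcal U}$ with $\mathrm{stem}(T)=s$. Then, for each $s\in\omega^{<\omega}$, $T\nVdash_{\mathbb L_{\mathcal V},N}\dot x\neq z_s$ for every $T\in\mathbb L_{\mathcal V}$ with $\mathrm{stem}(T)=s$. (c) For every $c\in 2^\omega\cap N$ which is $\pitchfork$-unbounded over $M$, the property $(\star,\mathbb L_{\mathcal U},\mathbb L_{\mathcal V},M,N,\pitchfork,c)$ holds; that is, for every $\mathbb L_{\mathcal U}$-name $\dot h\in M$ for a real in $2^\omega$, $\Vdash_{\mathbb L_{\mathcal V},N}c\not\pitchfork\dot h$.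
   Context: Laver forcing with a filter: for a filter $\mathcal F$ on $\omega$ containing all cofinite subsets of $\omega$, $\mathbb L_{\mathcal F}$ is the poset of all infinitely-branching subtrees $T$ of $\omega^{<\omega}$ with a stem such that $\{i<\omega : \sigma^\frown\langle i\rangle\in T\}\in\mathcal F$ for every $\sigma\in T$ with $\sigma\supseteq\mathrm{stem}(T)$, where $\mathrm{stem}(T)$ is the unique branching node of $T$ of minimal level. The order is $\subseteq$. Here $\mathbb L_{\mathcal U}$ is computed in $M$ and $\mathbb L_{\mathcal V}$ is computed in $N$. $\Vdash_{\mathbb P,M}$ denotes the forcing relation of $\mathbb P$ over the model $M$. For posets $\mathbb P\in M$ and $\mathbb Q\in N$, $\mathbb P\preceq_M\mathbb Q$ means $\mathbb P\subseteq\mathbb Q$ and every maximal antichain of $\mathbb P$ lying in $M$ is a maximal antichain of $\mathbb Q$; then $G\cap\mathbb P$ is $\mathbb P$-generic over $M$ whenever $G$ is $\mathbb Q$-generic over $N$. It is known (Shelah) that $\mathbb L_{\mathcal U}\preceq_M\mathbb L_{\mathcal V}$ whenever $M\subseteq N$ are transitive models of $\mathrm{ZFC}$, $\mathcal U$ is a non-principal ultrafilter on $\omega$ in $M$, and $\mathcal V\supseteq\mathcal U$ is a non-principal ultrafilter on $\omega$ in $N$, so an $\mathbb L_{\mathcal U}$-name in $M$ is also treated as an $\mathbb L_{\mathcal V}$-name in $N$ (evaluated by $G\cap\mathbb L_{\mathcal U}$). $\langle I_n\rangle_{n<\omega}$ is the partition of $\omega$ into consecutive finite intervals ($\max I_n<\min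 I_{n+1}$) with $|I_n|=2^{n+1}$. For $f,g\in2^\omega$, $f\pitchfork g$ means $f\upharpoonright I_k\neq g\upharpoonright I_k$ for all but finitely many $k$. A real $c\in2^\omega$ is $\pitchfork$-unbounded over $M$ if $c\not\pitchfork g$ for every $g\in M\cap2^\omega$. For posets $\mathbb P\in M$ and $\mathbb Q\in N$ with $\mathbb P\preceq_M\mathbb Q$ (that is, $\mathbb P\subseteq\mathbb Q$ and every maximal antichain of $\mathbb P$ lying in $M$ is a maximal antichain of $\mathbb Q$), $(\star,\mathbb P,\mathbb Q,M,N,\pitchfork,c)$ means that for every $\mathbb P$-name $\dot h\in M$ for a real in $2^\omega$, $\Vdash_{\mathbb Q,N}c\not\pitchfork\dot h$. *)

theory Defs
  imports Main "HOL-Library.FuncSet" "HOL-Library.Sublist"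
begin

section \<open>The ambient universe of sets\<close>

text \<open>
  A type of this class carries a well-founded extensional membership relation (\<open>x \<in> elts y\<close>
  reads ``x is an element of y'') for which every finite collection is a set. The models below are
  transitive subclasses of such a type. The ambient universe itself is not required to satisfy ZFC;
  in particular it may be the larger of the two models.
\<close>

class set_universe =
  fixes elts :: "'a \<Rightarrow> 'a set"
  assumes elts_inject: "elts x = elts y \<Longrightarrow> x = y"
    and elts_wf: "wf {(x, y). x \<in> elts y}"
    and ex_finite_set: "finite A \<Longrightarrow> \<exists>x. elts x = A"

text \<open>The set with extension \<open>A\<close>; meaningful only if \<open>A\<close> is the extension of a set. This is the
  case for all finite \<open>A\<close>, and otherwise has to be read off from the context.\<close>

definition vset :: "'v::set_universe set \<Rightarrow> 'v" where
  "vset A = (THE x. elts x = A)"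

definition vpair :: "'v::set_universe \<Rightarrow> 'v \<Rightarrow> 'v" where
  "vpair x y = vset {vset {x}, vset {x, y}}"

primrec vnat :: "nat \<Rightarrow> 'v::set_universe" where
  "vnat 0 = vset {}"
| "vnat (Suc n) = vset (insert (vnat n) (elts (vnat n)))"

definition vomega :: "'v::set_universe" where
  "vomega = vset (range vnat)"

text \<open>A finite sequence of naturals, as a function from its length to \<open>\<omega>\<close>.\<close>

definition vseq :: "nat list \<Rightarrow> 'v::set_universe" where
  "vseq \<sigma> = vset {vpair (vnat i) (vnat (\<sigma> ! i)) | i. i < length \<sigma>}"

text \<open>The (graph of the) function \<open>\<omega> \<rightarrow> 2\<close> given by an element of \<open>2\<^sup>\<omega>\<close>.\<close>

definition real_graph :: "(nat \<Rightarrow> bool) \<Rightarrow> 'v::set_universe set" where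
  "real_graph f = range (\<lambda>n. vpair (vnat n) (vnat (if f n then 1 else 0)))"

definition reals_of :: "'v::set_universe set \<Rightarrow> (nat \<Rightarrow> bool) set" where
  "reals_of M = {f. \<exists>x\<in>M. elts x = real_graph f}"


section \<open>First-order formulas and transitive models of ZFC\<close>

datatype fm =
    Mem nat nat
  | Eq nat nat
  | Neg fm
  | Conj fm fm
  | All nat fm

primrec fv :: "fm \<Rightarrow> nat set" where
  "fv (Mem x y) = {x, y}"
| "fv (Eq x y) = {x, y}"
| "fv (Neg \<phi>) = fv \<phi>"
| "fv (Conj \<phi> \<psi>) = fv \<phi> \<union> fv \<psi>"
| "fv (All x \<phi>) = fv \<phi> - {x}"

definition Disj :: "fm \<Rightarrow> fm \<Rightarrow> fm" where
  "Disj \<phi> \<psi> = Neg (Conj (Neg \<phi>) (Neg \<psi>))"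

definition Imp :: "fm \<Rightarrow> fm \<Rightarrow> fm" where
  "Imp \<phi> \<psi> = Neg (Conj \<phi> (Neg \<psi>))"

definition Iff :: "fm \<Rightarrow> fm \<Rightarrow> fm" where
  "Iff \<phi> \<psi> = Conj (Imp \<phi> \<psi>) (Imp \<psi> \<phi>)"

definition Ex :: "nat \<Rightarrow> fm \<Rightarrow> fm" where
  "Ex x \<phi> = Neg (All x (Neg \<phi>))"

definition AllIn :: "nat \<Rightarrow> nat \<Rightarrow> fm \<Rightarrow> fm" where
  "AllIn x y \<phi> = All x (Imp (Mem x y) \<phi>)"

definition ExIn :: "nat \<Rightarrow> nat \<Rightarrow> fm \<Rightarrow> fm" where
  "ExIn x y \<phi> = Ex x (Conj (Mem x y) \<phi>)"

primrec sat :: "'v::set_universe set \<Rightarrow> (nat \<Rightarrow> 'v) \<Rightarrow> fm \<Rightarrow> bool" where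
  "sat M e (Mem x y) \<longleftrightarrow> e x \<in> elts (e y)"
| "sat M e (Eq x y) \<longleftrightarrow> e x = e y"
| "sat M e (Neg \<phi>) \<longleftrightarrow> \<not> sat M e \<phi>"
| "sat M e (Conj \<phi> \<psi>) \<longleftrightarrow> sat M e \<phi> \<and> sat M e \<psi>"
| "sat M e (All x \<phi>) \<longleftrightarrow> (\<forall>a\<in>M. sat M (e(x := a)) \<phi>)"

definition Extensionality_ax :: fm where
  "Extensionality_ax = All 0 (All 1 (Imp (All 2 (Iff (Mem 2 0) (Mem 2 1))) (Eq 0 1)))"

definition Foundation_ax :: fm where
  "Foundation_ax =
     All 0 (Imp (Ex 1 (Mem 1 0)) (ExIn 1 0 (Neg (ExIn 2 1 (Mem 2 0)))))"

definition Pairing_ax :: fm where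
  "Pairing_ax = All 0 (All 1 (Ex 2 (All 3 (Iff (Mem 3 2) (Disj (Eq 3 0) (Eq 3 1))))))"

definition Union_ax :: fm where
  "Union_ax = All 0 (Ex 1 (All 2 (Iff (Mem 2 1) (ExIn 3 0 (Mem 2 3)))))"

definition Power_ax :: fm where
  "Power_ax = All 0 (Ex 1 (All 2 (Iff (Mem 2 1) (AllIn 3 2 (Mem 3 0)))))"

definition Infinity_ax :: fm where
  "Infinity_ax =
     Ex 0 (Conj (ExIn 1 0 (All 2 (Neg (Mem 2 1))))
                (AllIn 1 0 (ExIn 2 0 (All 3 (Iff (Mem 3 2) (Disj (Mem 3 1) (Eq 3 1)))))))"

text \<open>Every family of pairwise disjoint nonempty sets has a transversal.\<close>

definition Choice_ax :: fm where
  "Choice_ax =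
     All 0 (Imp
       (Conj (AllIn 1 0 (Ex 2 (Mem 2 1)))
             (AllIn 1 0 (AllIn 2 0 (Imp (ExIn 3 1 (Mem 3 2)) (Eq 1 2)))))
       (Ex 4 (AllIn 1 0 (Ex 2 (All 3 (Iff (Conj (Mem 3 1) (Mem 3 4)) (Eq 3 2)))))))"

text \<open>In the two schemes the free variables of \<open>\<phi>\<close> other than the displayed ones are parameters.
  Separation: \<open>{v0 \<in> v1. \<phi>}\<close> is a set. Replacement: if \<open>\<phi>\<close> defines a function \<open>v0 \<mapsto> v1\<close> on \<open>v2\<close>,
  then its range is a set.\<close>

definition Separation_ax :: "fm \<Rightarrow> fm" where
  "Separation_ax \<phi> = All 1 (Ex 2 (All 0 (Iff (Mem 0 2) (Conj (Mem 0 1) \<phi>))))"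

definition Replacement_ax :: "fm \<Rightarrow> fm" where
  "Replacement_ax \<phi> =
     All 2 (Imp (AllIn 0 2 (Ex 3 (All 1 (Iff \<phi> (Eq 1 3)))))
                (Ex 3 (All 1 (Iff (Mem 1 3) (ExIn 0 2 \<phi>)))))"

definition ZFC :: "fm set" where
  "ZFC = {Extensionality_ax, Foundation_ax, Pairing_ax, Union_ax, Power_ax, Infinity_ax, Choice_ax}
     \<union> {Separation_ax \<phi> | \<phi>. 2 \<notin> fv \<phi>} \<union> {Replacement_ax \<phi> | \<phi>. 3 \<notin> fv \<phi>}"

definition transitive_model_ZFC :: "'v::set_universe set \<Rightarrow> bool" where
  "transitive_model_ZFC M \<longleftrightarrow>
     M \<noteq> {} \<and> (\<forall>x\<in>M. elts x \<subseteq> M) \<and> (\<forall>\<phi>\<in>ZFC. \<forall>e. range e \<subseteq> M \<longrightarrow> sat M e \<phi>)"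


section \<open>Names and the forcing relation over a transitive model\<close>

record 'v poset =
  conds :: "'v set"
  below :: "'v \<Rightarrow> 'v \<Rightarrow> bool"
  top_cond :: 'v

inductive_set names :: "'v::set_universe set \<Rightarrow> 'v poset \<Rightarrow> 'v set"
  for M :: "'v set" and P :: "'v poset" where
  "x \<in> M \<Longrightarrow> \<forall>e\<in>elts x. \<exists>\<sigma> p. \<sigma> \<in> names M P \<and> p \<in> conds P \<and> e = vpair \<sigma> p \<Longrightarrow> x \<in> names M P"

function check_name :: "'v::set_universe poset \<Rightarrow> 'v \<Rightarrow> 'v" where
  "check_name P x = vset ((\<lambda>y. vpair (check_name P y) (top_cond P)) ` elts x)"
  by auto
termination
  by (relation "inv_image {(x, y). x \<in> elts y} snd") (auto simp: elts_wf)

text \<open>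
  Models need not be countable, so forcing is the usual relation defined inside the model, not
  the semantic one via generic filters. For membership and equality of names the recursion on
  names is rendered as a least fixed point, which by well-foundedness is the only one. These
  clauses only involve elements of \<open>P\<close> and of the transitive closures of the names, so they need
  not be relativized; the model matters only for the quantifier clause of \<open>forces\<close>.
\<close>

inductive forces_mem :: "'v::set_universe poset \<Rightarrow> 'v \<Rightarrow> 'v \<Rightarrow> 'v \<Rightarrow> bool"
  and forces_eq :: "'v poset \<Rightarrow> 'v \<Rightarrow> 'v \<Rightarrow> 'v \<Rightarrow> bool"
  for P :: "'v poset" where
  mem: "\<forall>q\<in>conds P. below P q p \<longrightarrow>
          (\<exists>r\<in>conds P. below P r q \<and>
             (\<exists>c s. vpair c s \<in> elts b \<and> below P r s \<and> forces_eq P r a c))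
        \<Longrightarrow> forces_mem P p a b"
| eq: "\<forall>c s. vpair c s \<in> elts a \<longrightarrow>
          (\<forall>q\<in>conds P. below P q p \<and> below P q s \<longrightarrow> forces_mem P q c b)
        \<Longrightarrow> \<forall>c s. vpair c s \<in> elts b \<longrightarrow>
          (\<forall>q\<in>conds P. below P q p \<and> below P q s \<longrightarrow> forces_mem P q c a)
        \<Longrightarrow> forces_eq P p a b"

primrec forces :: "'v::set_universe set \<Rightarrow> 'v poset \<Rightarrow> 'v \<Rightarrow> fm \<Rightarrow> (nat \<Rightarrow> 'v) \<Rightarrow> bool" where
  "forces M P p (Mem x y) e \<longleftrightarrow> forces_mem P p (e x) (e y)"
| "forces M P p (Eq x y) e \<longleftrightarrow> forces_eq P p (e x) (e y)"
| "forces M P p (Neg \<phi>) e \<longleftrightarrow> (\<forall>q\<in>conds P. below P q p \<longrightarrow> \<not> forces M P q \<phi> e)"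
| "forces M P p (Conj \<phi> \<psi>) e \<longleftrightarrow> forces M P p \<phi> e \<and> forces M P p \<psi> e"
| "forces M P p (All x \<phi>) e \<longleftrightarrow> (\<forall>a\<in>names M P. forces M P p \<phi> (e(x := a)))"

definition forced :: "'v::set_universe set \<Rightarrow> 'v poset \<Rightarrow> fm \<Rightarrow> (nat \<Rightarrow> 'v) \<Rightarrow> bool" where
  "forced M P \<phi> e \<longleftrightarrow> (\<forall>p\<in>conds P. forces M P p \<phi> e)"


section \<open>Ultrafilters in a model and Laver forcing\<close>

definition subsets_of_omega :: "'v::set_universe set \<Rightarrow> nat set set" where
  "subsets_of_omega M = {X. \<exists>A\<in>M. elts A = vnat ` X}"

definition family :: "'v::set_universe \<Rightarrow> nat set set" where
  "family U = {X. \<exists>A\<in>elts U. elts A = vnat ` X}"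

definition nonprincipal_ultrafilter_in :: "'v::set_universe set \<Rightarrow> 'v \<Rightarrow> bool" where
  "nonprincipal_ultrafilter_in M U \<longleftrightarrow>
     (\<forall>A\<in>elts U. elts A \<subseteq> range vnat) \<and>
     UNIV \<in> family U \<and> {} \<notin> family U \<and>
     (\<forall>X\<in>family U. \<forall>Y\<in>family U. X \<inter> Y \<in> family U) \<and>
     (\<forall>X\<in>family U. \<forall>Y\<in>subsets_of_omega M. X \<subseteq> Y \<longrightarrow> Y \<in> family U) \<and>
     (\<forall>X\<in>subsets_of_omega M. X \<in> family U \<or> - X \<in> family U) \<and>
     (\<nexists>n. family U = {X \<in> subsets_of_omega M. n \<in> X})"

definition branching :: "nat list set \<Rightarrow> nat list \<Rightarrow> bool" where
  "branching T \<sigma> \<longleftrightarrow> \<sigma> \<in> T \<and> (\<exists>i j. i \<noteq> j \<and> \<sigma> @ [i] \<in> T \<and> \<sigma> @ [j] \<in> T)"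

definition is_stem :: "nat list set \<Rightarrow> nat list \<Rightarrow> bool" where
  "is_stem T s \<longleftrightarrow> branching T s \<and> (\<forall>t. branching T t \<and> t \<noteq> s \<longrightarrow> length s < length t)"

definition laver_tree :: "nat set set \<Rightarrow> nat list set \<Rightarrow> bool" where
  "laver_tree \<F> T \<longleftrightarrow>
     (\<forall>\<sigma>\<in>T. \<forall>\<tau>. prefix \<tau> \<sigma> \<longrightarrow> \<tau> \<in> T) \<and>
     (\<exists>s. is_stem T s \<and>
        (\<forall>\<sigma>\<in>T. prefix s \<sigma> \<longrightarrow> infinite {i. \<sigma> @ [i] \<in> T} \<and> {i. \<sigma> @ [i] \<in> T} \<in> \<F>))"

definition stem :: "'v::set_universe \<Rightarrow> nat list" where
  "stem x = (THE s. is_stem {\<sigma>. vseq \<sigma> \<in> elts x} s)"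

text \<open>\<open>laver M U\<close> is the Laver forcing with \<open>U\<close> as computed in \<open>M\<close>; its largest element is the full
  tree of all finite sequences.\<close>

definition laver :: "'v::set_universe set \<Rightarrow> 'v \<Rightarrow> 'v poset" where
  "laver M U =
     \<lparr>conds = {x \<in> M. \<exists>T. elts x = vseq ` T \<and> laver_tree (family U) T},
      below = (\<lambda>x y. elts x \<subseteq> elts y),
      top_cond = vset (range vseq)\<rparr>"


section \<open>The relation on reals\<close>

text \<open>The consecutive intervals of length \<open>2\<^bsup>n+1\<^esup>\<close>, starting with \<open>{0, 1}\<close>; see the lemmas below.\<close>

definition interval :: "nat \<Rightarrow> nat set" where
  "interval n = {2 ^ (n + 1) - 2 ..< 2 ^ (n + 2) - 2}"

lemma card_interval: "card (interval n) = 2 ^ (n + 1)"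
proof -
  have "2 ^ (n + 2) = 2 * (2 ^ (n + 1) :: nat)" by simp
  moreover have "(2::nat) \<le> 2 ^ (n + 1)" by simp
  ultimately show ?thesis by (simp only: interval_def card_atLeastLessThan)
qed

lemma interval_consecutive: "i \<in> interval n \<Longrightarrow> j \<in> interval (Suc n) \<Longrightarrow> i < j"
  by (simp add: interval_def)

lemma interval_cover: "(\<Union>n. interval n) = UNIV"
proof -
  have "k \<in> (\<Union>n. interval n)" if "k < 2 ^ (m + 1) - 2" for k m
    using that
  proof (induction m)
    case 0
    then show ?case by simp
  next
    case (Suc m)
    show ?case
    proof (cases "k < 2 ^ (m + 1) - 2")
      case True
      then show ?thesis using Suc.IH by blast
    next
      case False
      with Suc.prems have "k \<in> interval m" by (simp add: interval_def)
      then show ?thesis by blast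
    qed
  qed
  moreover have "k < 2 ^ (k + 2 + 1) - 2" for k :: nat
    using less_exp[of k] by (simp add: numeral_eq_Suc)
  ultimately show ?thesis by blast
qed

definition pitchfork :: "(nat \<Rightarrow> bool) \<Rightarrow> (nat \<Rightarrow> bool) \<Rightarrow> bool" (infix "\<pitchfork>" 50) where
  "f \<pitchfork> g \<longleftrightarrow> (\<forall>\<^sub>\<infinity>k. restrict f (interval k) \<noteq> restrict g (interval k))"

definition pitchfork_unbounded_over :: "'v::set_universe set \<Rightarrow> (nat \<Rightarrow> bool) \<Rightarrow> bool" where
  "pitchfork_unbounded_over M c \<longleftrightarrow> (\<forall>g\<in>reals_of M. \<not> c \<pitchfork> g)"

definition vintervals :: "'v::set_universe" where
  "vintervals = vset (range (\<lambda>n. vpair (vnat n) (vset (vnat ` interval n))))"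

text \<open>
  The same notions as formulas of the forcing language; bound variables are chosen beyond the free
  ones. \<open>pair_fm z x y\<close> says \<open>z = (x, y)\<close>; \<open>fun_fm f a b\<close> says that \<open>f\<close> is a function from \<open>a\<close> to
  \<open>b\<close>; \<open>agree_fm f g j\<close> says that \<open>f\<close> and \<open>g\<close> have the same restriction to \<open>j\<close>;
  \<open>pitchfork_fm f g i w\<close> says that, with \<open>w = \<omega>\<close> and \<open>i\<close> the sequence of intervals, there is
  \<open>m \<in> w\<close> such that \<open>f\<close> and \<open>g\<close> do not agree on \<open>i(k)\<close> for any \<open>k \<in> w\<close> with \<open>m \<le> k\<close>, that is,
  \<open>m \<in> k\<close> or \<open>m = k\<close>.
\<close>

definition pair_fm :: "nat \<Rightarrow> nat \<Rightarrow> nat \<Rightarrow> fm" where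
  "pair_fm z x y =
     (let u = x + y + z + 1; v = u + 1 in
        All u (Iff (Mem u z)
          (Disj (All v (Iff (Mem v u) (Eq v x)))
                (All v (Iff (Mem v u) (Disj (Eq v x) (Eq v y)))))))"

definition fun_fm :: "nat \<Rightarrow> nat \<Rightarrow> nat \<Rightarrow> fm" where
  "fun_fm f a b =
     (let p = f + a + b + 1; x = p + 1; y = p + 2; y' = p + 3 in
        Conj (AllIn p f (ExIn x a (ExIn y b (pair_fm p x y))))
             (AllIn x a (Ex y (All y' (Iff (ExIn p f (pair_fm p x y')) (Eq y' y))))))"

definition agree_fm :: "nat \<Rightarrow> nat \<Rightarrow> nat \<Rightarrow> fm" where
  "agree_fm f g j =
     (let p = f + g + j + 1; x = p + 1; y = p + 2 in
        AllIn x j (All y (All p (Imp (pair_fm p x y) (Iff (Mem p f) (Mem p g))))))"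

definition pitchfork_fm :: "nat \<Rightarrow> nat \<Rightarrow> nat \<Rightarrow> nat \<Rightarrow> fm" where
  "pitchfork_fm f g i w =
     (let m = f + g + i + w + 1; k = m + 1; j = m + 2; p = m + 3 in
        ExIn m w (AllIn k w (Imp (Disj (Mem m k) (Eq m k))
          (Ex j (Conj (ExIn p i (pair_fm p k j)) (Neg (agree_fm f g j)))))))"

definition name_for_real :: "'v::set_universe set \<Rightarrow> 'v poset \<Rightarrow> 'v \<Rightarrow> bool" where
  "name_for_real M P h \<longleftrightarrow> h \<in> names M P \<and>
     forced M P (fun_fm 0 1 2) (nth [h, check_name P vomega, check_name P (vnat 2)])"

definition name_for_member :: "'v::set_universe set \<Rightarrow> 'v poset \<Rightarrow> 'v set \<Rightarrow> 'v \<Rightarrow> bool" where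
  "name_for_member M P F x \<longleftrightarrow> x \<in> names M P \<and>
     forced M P (Mem 0 1) (nth [x, check_name P (vset F)])"

definition forces_neq :: "'v::set_universe set \<Rightarrow> 'v poset \<Rightarrow> 'v \<Rightarrow> 'v \<Rightarrow> 'v \<Rightarrow> bool" where
  "forces_neq M P p x z \<longleftrightarrow> forces M P p (Neg (Eq 0 1)) (nth [x, check_name P z])"

text \<open>When \<open>P\<close> is a subset of \<open>Q\<close>, a \<open>P\<close>-name in \<open>M\<close> is literally a \<open>Q\<close>-name in \<open>N\<close>, and its value by a
  filter \<open>G\<close> on \<open>Q\<close> is its value by \<open>G \<inter> P\<close>.\<close>

definition star ::
  "'v::set_universe poset \<Rightarrow> 'v poset \<Rightarrow> 'v set \<Rightarrow> 'v set \<Rightarrow> (nat \<Rightarrow> bool) \<Rightarrow> bool" where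
  "star P Q M N c \<longleftrightarrow> (\<forall>h. name_for_real M P h \<longrightarrow>
     forced N Q (Neg (pitchfork_fm 0 1 2 3))
       (nth [check_name Q (vset (real_graph c)), h,
             check_name Q vintervals, check_name Q vomega]))"

end

theory Submission
  imports Defs "HOL-Library.Infinite_Set"
begin

text \<open>
  Let \<open>D\<close> be a set of conditions of \<open>L\<^sub>U\<close> in \<open>M\<close>. In \<open>M\<close>, the finite sequences carry a rank: rank
  \<open>0\<close> for the stems of members of \<open>D\<close>, and rank at most \<open>\<alpha>\<close> for \<open>\<sigma>\<close> if \<open>U\<close>-almost all
  \<open>\<sigma>\<^sup>\<frown>i\<close> have rank less than \<open>\<alpha>\<close>. If \<open>s\<close> has no rank then the unranked sequences extending \<open>s\<close>
  contain a condition with stem \<open>s\<close> that has no extension in \<open>D\<close>. If \<open>s\<close> has a rank then, the ordinals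
  of \<open>M\<close> being well-founded and \<open>U \<subseteq> V\<close>, induction on the rank shows that every condition of \<open>L\<^sub>V\<close>
  with stem \<open>s\<close> has a common extension with a member of \<open>D\<close>. Hence, if every condition of \<open>L\<^sub>U\<close> with stem
  \<open>s\<close> has an extension in \<open>D\<close>, every condition of \<open>L\<^sub>V\<close> with stem \<open>s\<close> has one below a member of \<open>D\<close>.
  This yields maximality of antichains, absoluteness of forced equality between names, and (b).

  For (c), fix \<open>s\<close>. For each interval some block of bits cannot be excluded as the restriction of
  \<open>h\<close> by any condition with stem \<open>s\<close>, because finitely many such conditions have a common extension
  with stem \<open>s\<close>. A choice of such blocks in \<open>M\<close> is a real of \<open>M\<close>; it agrees with \<open>c\<close> on arbitrarily
  late intervals, and there the first argument produces extensions in \<open>L\<^sub>V\<close> forcing \<open>h\<close> to agree with \<open>c\<close>.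
\<close>

section \<open>Sets, numbers and sequences\<close>

text \<open>The models may be uncountable, so no generic filters are available and every step is an
  argument about the forcing relation itself. Two obstacles shape the development. The rank argument
  is carried out in \<open>M\<close> and applies only to sets \<open>D\<close> that belong to
  \<open>M\<close>, whereas forced equality and membership are given by an inductive definition
  outside \<open>M\<close>. They must therefore be shown definable over \<open>M\<close>, through
  fixed points formed there, before a set of conditions that mentions them can be used. Moreover,
  the ambient universe is only known to contain finite collections, so \<open>vset A\<close> is
  meaningless for infinite \<open>A\<close> until a model is shown to contain a set with that
  extension. Even \<open>vomega\<close>, the full tree and the check names have to be built in this
  way. In (c), the name of \<open>c\<close> and the names over which the quantifiers range belong to
  \<open>N\<close> and may be unknown to \<open>M\<close>. Absoluteness is available for names in
  \<open>M\<close> only, so a forced disagreement between \<open>c\<close> and \<open>h\<close> is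
  first reduced to a pair of actual numbers.\<close>

lemma vset_eqI: "elts x = A \<Longrightarrow> vset A = x"
  unfolding vset_def by (rule the_equality) (auto intro: elts_inject)

lemma vset_elts [simp]: "vset (elts x) = x"
  by (rule vset_eqI) simp

lemma elts_vset_finite [simp]: "finite A \<Longrightarrow> elts (vset A) = A"
  using ex_finite_set[of A] vset_eqI by metis

lemma elts_eq_iff: "elts x = elts y \<longleftrightarrow> x = y"
  using elts_inject by blast

lemma elts_induct: "(\<And>x. (\<And>y. y \<in> elts x \<Longrightarrow> P y) \<Longrightarrow> P x) \<Longrightarrow> P (x :: 'v::set_universe)"
  using wf_induct_rule[OF elts_wf, of P x] by auto

lemma elts_irrefl [simp]: "x \<notin> elts x"
  by (induction x rule: elts_induct) blast

lemma vset_finite_eq_iff: "finite A \<Longrightarrow> finite B \<Longrightarrow> vset A = vset B \<longleftrightarrow> A = B"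
  by (metis elts_vset_finite)

lemma vpair_inject [simp]: "vpair a b = vpair c d \<longleftrightarrow> a = c \<and> b = d"
  by (auto simp: vpair_def vset_finite_eq_iff doubleton_eq_iff)

lemma elts_vpair: "elts (vpair a b) = {vset {a}, vset {a, b}}"
  by (simp add: vpair_def)

lemma vnat_elts [simp]: "elts (vnat n) = vnat ` {..<n}"
proof (induction n)
  case (Suc n)
  then show ?case by (simp add: lessThan_Suc)
qed simp

lemma vnat_less_neq: "m < n \<Longrightarrow> vnat m \<noteq> vnat n"
proof
  assume "m < n" "vnat m = vnat n"
  moreover have "vnat m \<in> elts (vnat n)" using \<open>m < n\<close> by simp
  ultimately show False by (metis elts_irrefl)
qed

lemma inj_vnat: "inj vnat"
  by (rule injI) (metis vnat_less_neq linorder_neqE_nat)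

lemma vnat_inject [simp]: "vnat m = vnat n \<longleftrightarrow> m = n"
  using inj_vnat by (auto dest: injD)

lemma vseq_elts [simp]: "elts (vseq \<sigma>) = {vpair (vnat i) (vnat (\<sigma> ! i)) | i. i < length \<sigma>}"
  by (simp add: vseq_def)

text \<open>Sequences are coded by their graphs, so the prefix order becomes inclusion; this is how
  it is expressed over a model, and it gives injectivity of the coding.\<close>

lemma vseq_subset_iff: "elts (vseq \<sigma>) \<subseteq> elts (vseq \<tau>) \<longleftrightarrow> prefix \<sigma> \<tau>"
proof
  assume sub: "elts (vseq \<sigma>) \<subseteq> elts (vseq \<tau>)"
  have *: "i < length \<tau> \<and> \<sigma> ! i = \<tau> ! i" if "i < length \<sigma>" for i
    using subsetD[OF sub, of "vpair (vnat i) (vnat (\<sigma> ! i))"] that by auto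
  then have le: "length \<sigma> \<le> length \<tau>"
    by (meson leI less_irrefl)
  have "\<sigma> = take (length \<sigma>) \<tau>"
    using * le by (intro nth_equalityI) auto
  then show "prefix \<sigma> \<tau>" by (metis take_is_prefix)
qed (auto simp: prefix_def nth_append)

lemma vseq_inject [simp]: "vseq \<sigma> = vseq \<tau> \<longleftrightarrow> \<sigma> = \<tau>"
  by (metis vseq_subset_iff order_refl prefix_order.antisym)

lemma inj_vseq: "inj vseq"
  by (auto intro: injI)

text \<open>Decoding is total, with default 0 here and the empty sequence in \<open>dseq\<close>, so
  that a HOL quantifier over numbers or sequences can be read as a bounded quantifier over
  \<open>vomega\<close> or \<open>vseqs\<close> whose variable is decoded.\<close>

definition dnat :: "'v::set_universe \<Rightarrow> nat" where
  "dnat x = (if x \<in> range vnat then inv vnat x else 0)"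

definition dseq :: "'v::set_universe \<Rightarrow> nat list" where
  "dseq x = (if x \<in> range vseq then inv vseq x else [])"

lemma dnat_vnat [simp]: "dnat (vnat n) = n"
  by (simp add: dnat_def inj_vnat)

lemma dseq_vseq [simp]: "dseq (vseq s) = s"
  by (simp add: dseq_def inj_vseq)


section \<open>Definability over a transitive model\<close>

primrec ren :: "(nat \<Rightarrow> nat) \<Rightarrow> fm \<Rightarrow> fm" where
  "ren f (Mem x y) = Mem (f x) (f y)"
| "ren f (Eq x y) = Eq (f x) (f y)"
| "ren f (Neg \<phi>) = Neg (ren f \<phi>)"
| "ren f (Conj \<phi> \<psi>) = Conj (ren f \<phi>) (ren f \<psi>)"
| "ren f (All x \<phi>) = All (f x) (ren f \<phi>)"

text \<open>Bound variables are renamed along with the free ones, so injectivity of \<open>f\<close>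
  alone rules out capture.\<close>

lemma sat_ren: "inj f \<Longrightarrow> sat M e (ren f \<phi>) \<longleftrightarrow> sat M (e \<circ> f) \<phi>"
proof (induction \<phi> arbitrary: e)
  case (All x \<phi>)
  have "(e(f x := a)) \<circ> f = (e \<circ> f)(x := a)" for a
    using All.prems by (auto simp: fun_eq_iff inj_eq)
  with All show ?case by (simp del: o_apply fun_upd_apply)
qed auto

lemma fv_ren: "inj f \<Longrightarrow> fv (ren f \<phi>) = f ` fv \<phi>"
  by (induction \<phi>) (auto simp: inj_eq)

lemma sat_simps [simp]:
  "sat M e (Disj \<phi> \<psi>) \<longleftrightarrow> sat M e \<phi> \<or> sat M e \<psi>"
  "sat M e (Imp \<phi> \<psi>) \<longleftrightarrow> (sat M e \<phi> \<longrightarrow> sat M e \<psi>)"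
  "sat M e (Iff \<phi> \<psi>) \<longleftrightarrow> (sat M e \<phi> \<longleftrightarrow> sat M e \<psi>)"
  "sat M e (Ex x \<phi>) \<longleftrightarrow> (\<exists>a\<in>M. sat M (e(x := a)) \<phi>)"
  by (auto simp: Disj_def Imp_def Iff_def Ex_def)

lemma sat_AllIn [simp]:
  "x \<noteq> y \<Longrightarrow> sat M e (AllIn x y \<phi>) \<longleftrightarrow> (\<forall>a\<in>M. a \<in> elts (e y) \<longrightarrow> sat M (e(x := a)) \<phi>)"
  by (simp add: AllIn_def)

lemma sat_ExIn [simp]:
  "x \<noteq> y \<Longrightarrow> sat M e (ExIn x y \<phi>) \<longleftrightarrow> (\<exists>a\<in>M. a \<in> elts (e y) \<and> sat M (e(x := a)) \<phi>)"
  by (simp add: ExIn_def)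

text \<open>Even variables carry the assignment and odd ones the parameters. Both supplies are
  infinite, so parameters can be merged and variables added without a clash.\<close>

definition mix :: "(nat \<Rightarrow> 'v) \<Rightarrow> (nat \<Rightarrow> 'v) \<Rightarrow> nat \<Rightarrow> 'v" where
  "mix e p n = (if even n then e (n div 2) else p (n div 2))"

lemma range_mix: "range e \<subseteq> M \<Longrightarrow> range p \<subseteq> M \<Longrightarrow> range (mix e p) \<subseteq> M"
  by (auto simp: mix_def)

lemma range_case_nat: "x \<in> M \<Longrightarrow> range e \<subseteq> M \<Longrightarrow> range (case_nat x e) \<subseteq> M"
  by (force split: nat.splits simp: image_subset_iff)

text \<open>Predicates are definable with parameters from \<open>M\<close>. Under a quantifier the bound variable
  becomes variable \<open>0\<close> and the others are shifted.\<close>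

definition definable :: "'v::set_universe set \<Rightarrow> ((nat \<Rightarrow> 'v) \<Rightarrow> bool) \<Rightarrow> bool" where
  "definable M Q \<longleftrightarrow>
     (\<exists>\<phi> p. range p \<subseteq> M \<and> (\<forall>e. range e \<subseteq> M \<longrightarrow> Q e = sat M (mix e p) \<phi>))"

text \<open>A term is handled through its graph, with the value in variable \<open>0\<close> and the
  arguments shifted. Its values must lie in \<open>M\<close> so that they can be quantified
  over.\<close>

definition dterm :: "'v::set_universe set \<Rightarrow> ((nat \<Rightarrow> 'v) \<Rightarrow> 'v) \<Rightarrow> bool" where
  "dterm M t \<longleftrightarrow> (\<forall>e. range e \<subseteq> M \<longrightarrow> t e \<in> M) \<and> definable M (\<lambda>e. e 0 = t (\<lambda>n. e (Suc n)))"

text \<open>The rules collected here follow the structure of a HOL predicate, so that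
  \<open>intro dfn\<close> shows that some first-order formula defines it.\<close>

named_theorems dfn

locale zfc_model =
  fixes M :: "'v::set_universe set"
  assumes model: "transitive_model_ZFC M"
begin

lemma elts_in [intro]: "x \<in> M \<Longrightarrow> y \<in> elts x \<Longrightarrow> y \<in> M"
  using model by (auto simp: transitive_model_ZFC_def)

lemma elts_sub: "x \<in> M \<Longrightarrow> elts x \<subseteq> M"
  by blast

lemma ex_elem: "\<exists>x. x \<in> M"
  using model by (auto simp: transitive_model_ZFC_def)

lemma axiom: "\<phi> \<in> ZFC \<Longrightarrow> range e \<subseteq> M \<Longrightarrow> sat M e \<phi>"
  using model by (auto simp: transitive_model_ZFC_def)

section \<open>Closure of definable predicates under logical operations\<close>

lemma definable_cong:
  "definable M Q \<Longrightarrow> (\<And>e. range e \<subseteq> M \<Longrightarrow> Q e = Q' e) \<Longrightarrow> definable M Q'"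
  unfolding definable_def by simp

lemma definable_not [dfn]: "definable M Q \<Longrightarrow> definable M (\<lambda>e. \<not> Q e)"
  unfolding definable_def by (metis sat.simps(3))

lemma definable_conj [dfn]:
  assumes "definable M Q" "definable M R"
  shows "definable M (\<lambda>e. Q e \<and> R e)"
proof -
  obtain \<phi> p where 1: "range p \<subseteq> M" "\<And>e. range e \<subseteq> M \<Longrightarrow> Q e = sat M (mix e p) \<phi>"
    using assms(1) unfolding definable_def by auto
  obtain \<psi> q where 2: "range q \<subseteq> M" "\<And>e. range e \<subseteq> M \<Longrightarrow> R e = sat M (mix e q) \<psi>"
    using assms(2) unfolding definable_def by auto
  \<comment> \<open>The parameters of both formulas are interleaved in \<open>mix p q\<close>:
    parameter \<open>k\<close> of the first sits at variable \<open>4k + 1\<close>, that of the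
    second at \<open>4k + 3\<close>.\<close>
  define f g where "f n = (if even n then n else 2 * n - 1)" and "g n = (if even n then n else 2 * n + 1)" for n :: nat
  have f: "inj f"
  proof (rule injI)
    fix x y assume "f x = f y"
    then show "x = y" unfolding f_def by (cases "even x"; cases "even y"; simp; presburger)
  qed
  have g: "inj g"
  proof (rule injI)
    fix x y assume "g x = g y"
    then show "x = y" unfolding g_def by (cases "even x"; cases "even y"; simp; presburger)
  qed
  have eq: "mix e (mix p q) (f n) = mix e p n \<and> mix e (mix p q) (g n) = mix e q n" for e and n :: nat
  proof (cases "even n")
    case False
    then obtain k where k: "n = 2 * k + 1" by (rule oddE)
    have "f n = 2 * (2 * k) + 1" "g n = 2 * (2 * k + 1) + 1" by (auto simp: f_def g_def k)
    then show ?thesis unfolding mix_def k by simp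
  qed (simp add: f_def g_def mix_def)
  have "mix e (mix p q) \<circ> f = mix e p" "mix e (mix p q) \<circ> g = mix e q" for e :: "nat \<Rightarrow> 'v"
    using eq by (auto simp: fun_eq_iff)
  then have "(Q e \<and> R e) = sat M (mix e (mix p q)) (Conj (ren f \<phi>) (ren g \<psi>))" if "range e \<subseteq> M" for e
    using that by (simp add: sat_ren f g 1 2)
  moreover have "range (mix p q) \<subseteq> M" using 1 2 by (simp add: range_mix)
  ultimately show ?thesis unfolding definable_def by blast
qed

lemma definable_disj [dfn]: "definable M Q \<Longrightarrow> definable M R \<Longrightarrow> definable M (\<lambda>e. Q e \<or> R e)"
  using definable_not[OF definable_conj[OF definable_not definable_not], of Q R] by simp

lemma definable_imp [dfn]: "definable M Q \<Longrightarrow> definable M R \<Longrightarrow> definable M (\<lambda>e. Q e \<longrightarrow> R e)"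
  by (rule definable_cong[OF definable_disj[OF definable_not, of Q R]]) auto

lemma definable_iff [dfn]: "definable M Q \<Longrightarrow> definable M R \<Longrightarrow> definable M (\<lambda>e. Q e \<longleftrightarrow> R e)"
  by (rule definable_cong[OF definable_conj[OF definable_imp definable_imp, of Q R R Q]]) auto

lemma definable_all [dfn]:
  assumes "definable M (\<lambda>e. Q (e 0) (\<lambda>n. e (Suc n)))"
  shows "definable M (\<lambda>e. \<forall>x\<in>M. Q x e)"
proof -
  obtain \<phi> p where 1: "range p \<subseteq> M"
    "\<And>e. range e \<subseteq> M \<Longrightarrow> Q (e 0) (\<lambda>n. e (Suc n)) = sat M (mix e p) \<phi>"
    using assms(1) unfolding definable_def by auto
  \<comment> \<open>The quantified variable moves from slot 0 to slot 1, the variables of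
    \<open>e\<close> move down to fill the even slots, and the parameters move up. The shift
    \<open>k - 1\<close> below puts a dummy parameter at the slot that is now bound.\<close>
  define f where "f n = (if n = 0 then 1 else if even n then n - 2 else n + 2)" for n :: nat
  have f: "inj f"
  proof (rule injI)
    fix x y assume "f x = f y"
    then show "x = y" unfolding f_def
      by (cases "even x"; cases "even y"; cases "x = 0"; cases "y = 0"; simp; presburger)
  qed
  have eq: "(mix e (\<lambda>k. p (k - 1)))(1 := x) \<circ> f = mix (case_nat x e) p" for e and x :: 'v
  proof
    fix n
    consider "n = 0" | k where "n = 2 * k + 1" | k where "n = 2 * Suc k"
      by (metis Suc_eq_plus1 evenE oddE not0_implies_Suc mult_0_right)
    then show "((mix e (\<lambda>k. p (k - 1)))(1 := x) \<circ> f) n = mix (case_nat x e) p n"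
      by cases (auto simp: mix_def f_def)
  qed
  have "(\<forall>x\<in>M. Q x e) = sat M (mix e (\<lambda>k. p (k - 1))) (All 1 (ren f \<phi>))" if e: "range e \<subseteq> M" for e
  proof -
    have "Q x e = sat M (mix (case_nat x e) p) \<phi>" if "x \<in> M" for x
      using 1(2)[OF range_case_nat[OF that e]] by simp
    then show ?thesis using eq by (simp add: sat_ren f)
  qed
  moreover have "range (\<lambda>k. p (k - 1)) \<subseteq> M" using 1 by auto
  ultimately show ?thesis unfolding definable_def by blast
qed

lemma definable_ex [dfn]:
  "definable M (\<lambda>e. Q (e 0) (\<lambda>n. e (Suc n))) \<Longrightarrow> definable M (\<lambda>e. \<exists>x\<in>M. Q x e)"
  using definable_not[OF definable_all, of "\<lambda>x e. \<not> Q x e"] definable_not by simp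

lemma definable_rename:
  assumes "definable M Q" "inj f"
  shows "definable M (\<lambda>e. Q (\<lambda>n. e (f n)))"
proof -
  obtain \<phi> p where 1: "range p \<subseteq> M" "\<And>e. range e \<subseteq> M \<Longrightarrow> Q e = sat M (mix e p) \<phi>"
    using assms(1) unfolding definable_def by auto
  define g where "g n = (if even n then 2 * f (n div 2) else n)" for n
  have g: "inj g"
  proof (rule injI)
    fix x y assume xy: "g x = g y"
    then have "even x \<longleftrightarrow> even y" unfolding g_def by (metis dvd_triv_left)
    with xy show "x = y" using injD[OF assms(2)] unfolding g_def
      by (cases "even x") (auto elim!: evenE)
  qed
  have "mix e p \<circ> g = mix (\<lambda>n. e (f n)) p" for e
    by (auto simp: fun_eq_iff mix_def g_def)
  moreover have "range (\<lambda>n. e (f n)) \<subseteq> M" if "range e \<subseteq> M" for e :: "nat \<Rightarrow> 'v"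
    using that by auto
  ultimately have "Q (\<lambda>n. e (f n)) = sat M (mix e p) (ren g \<phi>)" if "range e \<subseteq> M" for e
    using that 1(2)[of "\<lambda>n. e (f n)"] by (simp add: sat_ren g)
  with 1 show ?thesis unfolding definable_def by blast
qed

lemma definable_atom:
  "definable M (\<lambda>e. e i \<in> elts (e j))" "definable M (\<lambda>e. e i = e j)"
proof -
  obtain a where "a \<in> M" using ex_elem by blast
  moreover have "(e i \<in> elts (e j)) = sat M (mix e (\<lambda>_. a)) (Mem (2 * i) (2 * j))"
    "(e i = e j) = sat M (mix e (\<lambda>_. a)) (Eq (2 * i) (2 * j))" for e
    by (auto simp: mix_def)
  moreover have "range (\<lambda>_::nat. a) \<subseteq> M" using \<open>a \<in> M\<close> by auto
  ultimately show "definable M (\<lambda>e. e i \<in> elts (e j))" "definable M (\<lambda>e. e i = e j)"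
    unfolding definable_def by blast+
qed

lemma definable_const [dfn]: "definable M (\<lambda>e. Q)"
proof (cases Q)
  case True
  then show ?thesis using definable_atom(2)[of 0 0] by simp
next
  case False
  then show ?thesis using definable_not[OF definable_atom(2)[of 0 0]] by simp
qed

section \<open>Definable terms and their substitution\<close>

lemma dtermI:
  "(\<And>e. range e \<subseteq> M \<Longrightarrow> t e \<in> M) \<Longrightarrow> definable M (\<lambda>e. e 0 = t (\<lambda>n. e (Suc n))) \<Longrightarrow> dterm M t"
  by (simp add: dterm_def)

lemma dterm_in: "dterm M t \<Longrightarrow> range e \<subseteq> M \<Longrightarrow> t e \<in> M"
  by (simp add: dterm_def)

lemma dterm_var [dfn]: "dterm M (\<lambda>e. e i)"
  by (rule dtermI) (use definable_atom(2)[of 0 "Suc i"] in auto)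

lemma dterm_const [dfn]: "c \<in> M \<Longrightarrow> dterm M (\<lambda>e. c)"
proof (rule dtermI)
  assume "c \<in> M"
  moreover have "(e 0 = c) = sat M (mix e (\<lambda>_. c)) (Eq 0 1)" for e
    by (auto simp: mix_def)
  moreover have "range (\<lambda>_::nat. c) \<subseteq> M" using \<open>c \<in> M\<close> by auto
  ultimately show "definable M (\<lambda>e. e 0 = c)" unfolding definable_def by blast
qed

lemma dterm_shift: "dterm M t \<Longrightarrow> dterm M (\<lambda>e. t (\<lambda>n. e (Suc n)))"
proof (rule dtermI)
  assume t: "dterm M t"
  show "t (\<lambda>n. e (Suc n)) \<in> M" if "range e \<subseteq> M" for e
    using dterm_in[OF t, of "\<lambda>n. e (Suc n)"] that by blast
  have "definable M (\<lambda>e. e 0 = t (\<lambda>n. e (Suc n)))" using t by (simp add: dterm_def)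
  from definable_rename[OF this, of "\<lambda>n. if n = 0 then 0 else Suc n"]
  show "definable M (\<lambda>e. e 0 = t (\<lambda>n. e (Suc (Suc n))))" by (auto simp: inj_def)
qed

text \<open>Substitution is an existential quantifier over the value of \<open>t\<close>, which
  exists in \<open>M\<close>.\<close>

lemma definable_comp:
  assumes "definable M (\<lambda>e. R (e 0) (\<lambda>n. e (Suc n)))" "dterm M t"
  shows "definable M (\<lambda>e. R (t e) e)"
proof -
  have "definable M (\<lambda>e. \<exists>x\<in>M. x = t e \<and> R x e)"
    using assms by (intro definable_ex definable_conj) (auto simp: dterm_def)
  then show ?thesis by (rule definable_cong) (use assms(2) dterm_in in auto)
qed

lemma definable_comp1:
  assumes "\<And>i. definable M (\<lambda>e. R (e i))" "dterm M t"
  shows "definable M (\<lambda>e. R (t e))"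
  by (rule definable_comp[where R = "\<lambda>x e. R x"]) (use assms in auto)

text \<open>The premise ranges over all variable positions because substituting one argument shifts
  the variables of the other.\<close>

lemma definable_comp2:
  assumes "\<And>i j. definable M (\<lambda>e. R (e i) (e j))" "dterm M t" "dterm M u"
  shows "definable M (\<lambda>e. R (t e) (u e))"
proof -
  have "definable M (\<lambda>e. R (e 0) (u (\<lambda>n. e (Suc n))))"
    by (rule definable_comp[where R = "\<lambda>x e. R (e 0) x"]) (use assms dterm_shift in auto)
  then show ?thesis by (rule definable_comp[where R = "\<lambda>x e. R x (u e)"]) (use assms in auto)
qed

lemma definable_comp3:
  assumes "\<And>i j k. definable M (\<lambda>e. R (e i) (e j) (e k))" "dterm M t" "dterm M u" "dterm M v"
  shows "definable M (\<lambda>e. R (t e) (u e) (v e))"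
proof -
  have "definable M (\<lambda>e. R (e i) (e j) (v e))" if "dterm M v" for i j and v :: "(nat \<Rightarrow> 'v) \<Rightarrow> 'v"
    by (rule definable_comp[where R = "\<lambda>x e. R (e i) (e j) x"]) (use assms that in auto)
  then have 1: "definable M (\<lambda>e. R (e 1) (e 0) (v (\<lambda>n. e (Suc (Suc n)))))"
    using dterm_shift[OF dterm_shift[OF assms(4)]] by simp
  have "definable M (\<lambda>e. R (e 0) (u (\<lambda>n. e (Suc n))) (v (\<lambda>n. e (Suc n))))"
    by (rule definable_comp[where R = "\<lambda>x e. R (e 0) x (v (\<lambda>n. e (Suc n)))"])
      (use 1 assms dterm_shift in auto)
  then show ?thesis
    by (rule definable_comp[where R = "\<lambda>x e. R x (u e) (v e)"]) (use assms in auto)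
qed

lemma definable_mem [dfn]: "dterm M t \<Longrightarrow> dterm M u \<Longrightarrow> definable M (\<lambda>e. t e \<in> elts (u e))"
  by (rule definable_comp2[where R = "\<lambda>x y. x \<in> elts y"]) (auto intro: definable_atom)

lemma definable_eq [dfn]: "dterm M t \<Longrightarrow> dterm M u \<Longrightarrow> definable M (\<lambda>e. t e = u e)"
  by (rule definable_comp2[where R = "\<lambda>x y. x = y"]) (auto intro: definable_atom)

lemma definable_ball_elts [dfn]:
  assumes "dterm M t" "definable M (\<lambda>e. Q (e 0) (\<lambda>n. e (Suc n)))"
  shows "definable M (\<lambda>e. \<forall>x\<in>elts (t e). Q x e)"
proof -
  have "definable M (\<lambda>e. \<forall>x\<in>M. x \<in> elts (t e) \<longrightarrow> Q x e)"
    using assms by (intro dfn dterm_shift)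
  then show ?thesis by (rule definable_cong) (use dterm_in[OF assms(1)] in blast)
qed

lemma definable_bex_elts [dfn]:
  assumes "dterm M t" "definable M (\<lambda>e. Q (e 0) (\<lambda>n. e (Suc n)))"
  shows "definable M (\<lambda>e. \<exists>x\<in>elts (t e). Q x e)"
  using definable_not[OF definable_ball_elts[OF assms(1), of "\<lambda>x e. \<not> Q x e"]] assms(2) definable_not
  by simp

lemma dterm_comp1:
  assumes "\<And>x. x \<in> M \<Longrightarrow> g x \<in> M" "\<And>i j. definable M (\<lambda>e. e i = g (e j))" "dterm M t"
  shows "dterm M (\<lambda>e. g (t e))"
proof (rule dtermI)
  show "definable M (\<lambda>e. e 0 = g (t (\<lambda>n. e (Suc n))))"
    by (rule definable_comp2[where R = "\<lambda>x y. x = g y"]) (use assms dterm_shift dterm_var in auto)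
qed (use assms dterm_in in auto)

lemma dterm_comp2:
  assumes "\<And>x y. x \<in> M \<Longrightarrow> y \<in> M \<Longrightarrow> g x y \<in> M"
    "\<And>i j k. definable M (\<lambda>e. e i = g (e j) (e k))" "dterm M t" "dterm M u"
  shows "dterm M (\<lambda>e. g (t e) (u e))"
proof (rule dtermI)
  show "definable M (\<lambda>e. e 0 = g (t (\<lambda>n. e (Suc n))) (u (\<lambda>n. e (Suc n))))"
    by (rule definable_comp3[where R = "\<lambda>x y z. x = g y z"]) (use assms dterm_shift dterm_var in auto)
qed (use assms dterm_in in auto)

end

section \<open>Closure properties of transitive models\<close>

text \<open>The recursion runs in the ambient universe, where the collection of earlier values need
  not be a set. Only inside a transitive model, by \<open>vrec_in\<close>, is the second argument of
  \<open>G\<close> known to be that set.\<close>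

function vrec :: "('v::set_universe \<Rightarrow> 'v \<Rightarrow> 'v) \<Rightarrow> 'v \<Rightarrow> 'v" where
  "vrec G x = G x (vset (vrec G ` elts x))"
  by auto
termination
  by (relation "inv_image {(x, y). x \<in> elts y} snd") (auto simp: elts_wf)

declare vrec.simps [simp del] check_name.simps [simp del]

context zfc_model
begin

text \<open>Collections are kept as HOL sets; \<open>isset\<close> records that \<open>M\<close>
  contains a set with this extension, and only then does \<open>vset\<close> return the intended
  element.\<close>

definition isset :: "'v set \<Rightarrow> bool" where
  "isset A \<longleftrightarrow> A \<in> elts ` M"

lemma issetI: "x \<in> M \<Longrightarrow> elts x = A \<Longrightarrow> isset A"
  by (auto simp: isset_def)

lemma isset_elts [simp, intro]: "x \<in> M \<Longrightarrow> isset (elts x)"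
  by (auto simp: isset_def)

lemma isset_vset: "isset A \<Longrightarrow> vset A \<in> M" "isset A \<Longrightarrow> elts (vset A) = A"
  by (auto simp: isset_def)

lemma isset_sub: "isset A \<Longrightarrow> A \<subseteq> M"
  by (auto simp: isset_def)

text \<open>Equality with a comprehension is tested on elements of \<open>M\<close>, which suffices
  because both sides have all their elements in \<open>M\<close>.\<close>

lemma dterm_vset:
  assumes "\<And>e. range e \<subseteq> M \<Longrightarrow> isset (A e)" "definable M (\<lambda>e. e 0 \<in> A (\<lambda>n. e (Suc n)))"
  shows "dterm M (\<lambda>e. vset (A e))"
proof (rule dtermI)
  show "vset (A e) \<in> M" if "range e \<subseteq> M" for e using isset_vset assms(1)[OF that] by blast
  have "definable M (\<lambda>e. e 0 \<in> A (\<lambda>n. e (Suc (Suc n))))"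
    using definable_rename[OF assms(2), of "\<lambda>n. if n = 0 then 0 else Suc n"] by (auto simp: inj_def)
  then have "definable M (\<lambda>e. \<forall>x\<in>M. x \<in> elts (e 0) \<longleftrightarrow> x \<in> A (\<lambda>n. e (Suc n)))"
    by (intro dfn)
  then show "definable M (\<lambda>e. e 0 = vset (A (\<lambda>n. e (Suc n))))"
  proof (rule definable_cong)
    fix e :: "nat \<Rightarrow> 'v" assume e: "range e \<subseteq> M"
    then have A: "isset (A (\<lambda>n. e (Suc n)))" by (intro assms(1)) auto
    have "e 0 \<in> M" using e by auto
    show "(\<forall>x\<in>M. (x \<in> elts (e 0)) = (x \<in> A (\<lambda>n. e (Suc n)))) = (e 0 = vset (A (\<lambda>n. e (Suc n))))"
      unfolding elts_eq_iff[symmetric, of "e 0"] isset_vset(2)[OF A]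
      using elts_sub[OF \<open>e 0 \<in> M\<close>] isset_sub[OF A] by blast
  qed
qed

section \<open>Separation and Replacement for definable predicates\<close>

lemma separation_env:
  assumes "definable M (\<lambda>e. Q (e 0) (\<lambda>n. e (Suc n)))" and e: "range e \<subseteq> M" and A: "isset A"
  shows "isset {x \<in> A. Q x e}"
proof -
  obtain a where a: "a \<in> M" "elts a = A" using A by (auto simp: isset_def)
  obtain \<phi> p where p: "range p \<subseteq> M"
    "\<And>e. range e \<subseteq> M \<Longrightarrow> Q (e 0) (\<lambda>n. e (Suc n)) = sat M (mix e p) \<phi>"
    using assms(1) unfolding definable_def by auto
  \<comment> \<open>Variables other than 0 move to 3 and above, which leaves 1 and 2 to the given
    set and to the subset that the axiom asserts to exist.\<close>
  define f where "f n = (if n = 0 then 0 else n + 2)" for n :: nat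
  have f: "inj f" unfolding f_def inj_def by auto
  define E where "E n = (if n < 3 then a else mix (case_nat a e) p (n - 2))" for n
  have "range E \<subseteq> M"
    using range_mix[OF range_case_nat[OF a(1) e] p(1)] a by (auto simp: E_def)
  moreover have "2 \<notin> fv (ren f \<phi>)" by (auto simp: fv_ren f f_def)
  ultimately have "sat M E (Separation_ax (ren f \<phi>))"
    by (intro axiom) (auto simp: ZFC_def)
  then obtain b where b: "b \<in> M"
    "\<forall>x\<in>M. x \<in> elts b \<longleftrightarrow> x \<in> elts a \<and> sat M (E(1 := a, 2 := b, 0 := x)) (ren f \<phi>)"
    using a(1) by (auto simp: Separation_ax_def simp del: One_nat_def)
  have "E(1 := a, 2 := b, 0 := x) \<circ> f = mix (case_nat x e) p" for x
  proof
    show "(E(1 := a, 2 := b, 0 := x) \<circ> f) n = mix (case_nat x e) p n" for n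
      by (cases n) (auto simp: f_def E_def mix_def split: nat.split)
  qed
  moreover have "Q x e = sat M (mix (case_nat x e) p) \<phi>" if "x \<in> M" for x
    using p(2)[OF range_case_nat[OF that e]] by simp
  ultimately have "\<forall>x\<in>M. x \<in> elts b \<longleftrightarrow> x \<in> elts a \<and> Q x e"
    using b(2) by (simp add: sat_ren f del: fun_upd_apply)
  then have "elts b = {x \<in> A. Q x e}"
    using elts_sub[OF b(1)] elts_sub[OF a(1)] a(2) by blast
  with b(1) show ?thesis by (rule issetI)
qed

lemma separation:
  assumes "isset A" "definable M (\<lambda>e. Q (e 0))"
  shows "isset {x \<in> A. Q x}"
proof -
  obtain a where "a \<in> M" using ex_elem by blast
  then show ?thesis using separation_env[of "\<lambda>x e. Q x" "\<lambda>_. a" A] assms by auto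
qed

lemma separation_subset:
  "isset A \<Longrightarrow> B \<subseteq> A \<Longrightarrow> definable M (\<lambda>e. e 0 \<in> B) \<Longrightarrow> isset B"
  using separation[of A "\<lambda>x. x \<in> B"] by (simp add: Collect_conj_eq Int_absorb1 inf.absorb2)

lemma replacement_env:
  assumes "definable M (\<lambda>e. R (e 0) (e 1) (\<lambda>n. e (Suc (Suc n))))" and e: "range e \<subseteq> M"
    and A: "isset A" and fn: "\<And>x. x \<in> A \<Longrightarrow> \<exists>y\<in>M. \<forall>y'\<in>M. R x y' e \<longleftrightarrow> y' = y"
  shows "isset {y \<in> M. \<exists>x\<in>A. R x y e}"
proof -
  obtain a where a: "a \<in> M" "elts a = A" using A by (auto simp: isset_def)
  obtain \<phi> p where p: "range p \<subseteq> M"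
    "\<And>e. range e \<subseteq> M \<Longrightarrow> R (e 0) (e 1) (\<lambda>n. e (Suc (Suc n))) = sat M (mix e p) \<phi>"
    using assms(1) unfolding definable_def by auto
  \<comment> \<open>In \<open>mix\<close> the arguments \<open>x\<close> and \<open>y\<close> of
    \<open>R\<close> occupy variables 0 and 2, while the axiom expects them at 0 and 1. All others
    go beyond 4, so that 2 and 3 remain free for the domain and the range.\<close>
  define f where "f n = (if n = 0 then 0 else if n = 2 then 1 else n + 4)" for n :: nat
  have f: "inj f" unfolding f_def inj_def by auto
  define E where "E n = (if n < 5 then a else mix (case_nat a (case_nat a e)) p (n - 4))" for n
  have "range E \<subseteq> M"
    using range_mix[OF range_case_nat[OF a(1) range_case_nat[OF a(1) e]] p(1)] a by (auto simp: E_def)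
  moreover have "3 \<notin> fv (ren f \<phi>)" by (auto simp: fv_ren f f_def)
  ultimately have sat: "sat M E (Replacement_ax (ren f \<phi>))"
    by (intro axiom) (auto simp: ZFC_def)
  have eq: "(E(2 := a, 0 := x, 3 := z, 1 := y)) \<circ> f = mix (case_nat x (case_nat y e)) p"
     "(E(2 := a, 3 := z, 1 := y, 0 := x)) \<circ> f = mix (case_nat x (case_nat y e)) p" for x y z
  proof -
    have "n = 0 \<or> n = 2 \<or> n = 1 \<or> n > 2" for n :: nat by arith
    then show "(E(2 := a, 0 := x, 3 := z, 1 := y)) \<circ> f = mix (case_nat x (case_nat y e)) p"
     "(E(2 := a, 3 := z, 1 := y, 0 := x)) \<circ> f = mix (case_nat x (case_nat y e)) p"
      by (auto simp: fun_eq_iff f_def E_def mix_def split: nat.split)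
  qed
  have R: "sat M (mix (case_nat x (case_nat y e)) p) \<phi> = R x y e" if "x \<in> M" "y \<in> M" for x y
    using p(2)[OF range_case_nat[OF that(1) range_case_nat[OF that(2) e]]] by simp
  have sub: "elts a \<subseteq> M" by (rule elts_sub[OF a(1)])
  have "(\<forall>x\<in>M. x \<in> elts a \<longrightarrow> (\<exists>z\<in>M. \<forall>y\<in>M. R x y e = (y = z))) \<longrightarrow>
     (\<exists>b\<in>M. \<forall>y\<in>M. y \<in> elts b \<longleftrightarrow> (\<exists>x\<in>M. x \<in> elts a \<and> R x y e))"
    using bspec[OF sat[unfolded Replacement_ax_def sat.simps] a(1)]
    by (simp add: sat_ren f eq R cong: conj_cong bex_cong ball_cong del: fun_upd_apply One_nat_def)
      (simp add: eq R cong: conj_cong bex_cong ball_cong)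
  then obtain b where "b \<in> M" "\<forall>y\<in>M. y \<in> elts b \<longleftrightarrow> (\<exists>x\<in>M. x \<in> elts a \<and> R x y e)"
    using fn a by blast
  then have "elts b = {y \<in> M. \<exists>x\<in>A. R x y e}"
    using elts_sub[OF \<open>b \<in> M\<close>] sub a by blast
  with \<open>b \<in> M\<close> show ?thesis by (rule issetI)
qed

lemma replacement_image_env:
  assumes "dterm M (\<lambda>e. g (e 0) (\<lambda>n. e (Suc n)))" "range e \<subseteq> M" "isset A"
  shows "isset ((\<lambda>x. g x e) ` A)"
proof -
  have g: "g x e \<in> M" if "x \<in> M" for x
    using dterm_in[OF assms(1) range_case_nat[OF that assms(2)]] by simp
  have "definable M (\<lambda>e. e 0 = g (e 1) (\<lambda>n. e (Suc (Suc n))))"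
    using assms(1) by (simp add: dterm_def)
  from definable_rename[OF this, of "\<lambda>n. if n = 0 then 1 else if n = 1 then 0 else n"]
  have "definable M (\<lambda>e. e 1 = g (e 0) (\<lambda>n. e (Suc (Suc n))))" by (auto simp: inj_def)
  then have "isset {y \<in> M. \<exists>x\<in>A. y = g x e}"
  proof (intro replacement_env assms(2,3))
    show "\<exists>y\<in>M. \<forall>y'\<in>M. (y' = g x e) = (y' = y)" if "x \<in> A" for x
      using g isset_sub[OF assms(3)] that by (intro bexI[of _ "g x e"]) auto
  qed simp
  also have "{y \<in> M. \<exists>x\<in>A. y = g x e} = (\<lambda>x. g x e) ` A"
    using isset_sub[OF assms(3)] g by auto
  finally show ?thesis .
qed

lemma replacement_image:
  assumes "dterm M (\<lambda>e. g (e 0))" "isset A"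
  shows "isset (g ` A)"
proof -
  obtain a where "a \<in> M" using ex_elem by blast
  then show ?thesis using replacement_image_env[of "\<lambda>x e. g x" "\<lambda>_. a" A] assms by auto
qed

section \<open>Elementary set constructions in a model\<close>

lemma isset_pair: "x \<in> M \<Longrightarrow> y \<in> M \<Longrightarrow> isset {x, y}"
proof -
  assume xy: "x \<in> M" "y \<in> M"
  have "sat M (\<lambda>_. x) Pairing_ax" using xy by (intro axiom) (auto simp: ZFC_def)
  then have "\<forall>a\<in>M. \<forall>b\<in>M. \<exists>c\<in>M. \<forall>d\<in>M. d \<in> elts c \<longleftrightarrow> d = a \<or> d = b"
    by (simp add: Pairing_ax_def)
  from bspec[OF bspec[OF this xy(1)] xy(2)]
  obtain c where "c \<in> M" "\<forall>d\<in>M. d \<in> elts c \<longleftrightarrow> d = x \<or> d = y" by blast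
  with xy have "elts c = {x, y}" by blast
  with \<open>c \<in> M\<close> show ?thesis by (rule issetI)
qed

lemma isset_Union: "isset A \<Longrightarrow> isset (\<Union>(elts ` A))"
proof -
  assume "isset A"
  then obtain a where a: "a \<in> M" "elts a = A" by (auto simp: isset_def)
  have "sat M (\<lambda>_. a) Union_ax" using a by (intro axiom) (auto simp: ZFC_def)
  then obtain b where "b \<in> M" "\<forall>x\<in>M. x \<in> elts b \<longleftrightarrow> (\<exists>y\<in>M. y \<in> elts a \<and> x \<in> elts y)"
    using a by (auto simp: Union_ax_def)
  then have "elts b = \<Union>(elts ` A)" using a(2)[symmetric] elts_in \<open>a \<in> M\<close> by blast
  with \<open>b \<in> M\<close> show ?thesis by (rule issetI)
qed

lemma isset_Pow: "isset A \<Longrightarrow> isset {x \<in> M. elts x \<subseteq> A}"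
proof -
  assume "isset A"
  then obtain a where a: "a \<in> M" "elts a = A" by (auto simp: isset_def)
  have "sat M (\<lambda>_. a) Power_ax" using a by (intro axiom) (auto simp: ZFC_def)
  then obtain b where "b \<in> M" "\<forall>x\<in>M. x \<in> elts b \<longleftrightarrow> (\<forall>y\<in>M. y \<in> elts x \<longrightarrow> y \<in> elts a)"
    using a by (auto simp: Power_ax_def)
  then have "elts b = {x \<in> M. elts x \<subseteq> A}" using a(2)[symmetric] elts_in by blast
  with \<open>b \<in> M\<close> show ?thesis by (rule issetI)
qed

lemma choice:
  assumes "isset A" "\<And>x. x \<in> A \<Longrightarrow> elts x \<noteq> {}"
    and "\<And>x y. x \<in> A \<Longrightarrow> y \<in> A \<Longrightarrow> x \<noteq> y \<Longrightarrow> elts x \<inter> elts y = {}"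
  obtains C where "C \<in> M" "\<And>x. x \<in> A \<Longrightarrow> \<exists>y. elts x \<inter> elts C = {y}"
proof -
  from assms(1) obtain a where a: "a \<in> M" "elts a = A" by (auto simp: isset_def)
  have sat: "sat M (\<lambda>_. a) Choice_ax" using a by (intro axiom) (auto simp: ZFC_def)
  have "(\<forall>x\<in>M. x \<in> elts a \<longrightarrow> (\<exists>y\<in>M. y \<in> elts x)) \<and>
        (\<forall>x\<in>M. x \<in> elts a \<longrightarrow> (\<forall>y\<in>M. y \<in> elts a \<longrightarrow> (\<exists>z\<in>M. z \<in> elts x \<and> z \<in> elts y) \<longrightarrow> x = y)) \<longrightarrow>
     (\<exists>C\<in>M. \<forall>x\<in>M. x \<in> elts a \<longrightarrow> (\<exists>y\<in>M. \<forall>z\<in>M. z \<in> elts x \<and> z \<in> elts C \<longleftrightarrow> z = y))"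
    using bspec[OF sat[unfolded Choice_ax_def sat.simps] a(1)] by simp
  moreover have "\<exists>y\<in>M. y \<in> elts x" if "x \<in> elts a" for x
    using assms(2)[of x] that a elts_in by blast
  moreover have "x = y" if "x \<in> elts a" "y \<in> elts a" "\<exists>z\<in>M. z \<in> elts x \<and> z \<in> elts y" for x y
    using assms(3)[of x y] that a by blast
  ultimately obtain C where C: "C \<in> M"
    "\<And>x. x \<in> M \<Longrightarrow> x \<in> elts a \<Longrightarrow> \<exists>y\<in>M. \<forall>z\<in>M. z \<in> elts x \<and> z \<in> elts C \<longleftrightarrow> z = y"
    by (smt (verit))
  have "\<exists>y. elts x \<inter> elts C = {y}" if x: "x \<in> A" for x
  proof -
    have "x \<in> M" using a x by blast
    then obtain y where "\<forall>z\<in>M. z \<in> elts x \<and> z \<in> elts C \<longleftrightarrow> z = y" "y \<in> M"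
      using C(2) a x by blast
    then have "elts x \<inter> elts C = {y}" using elts_sub[OF \<open>x \<in> M\<close>] by blast
    then show ?thesis ..
  qed
  with C(1) show ?thesis by (rule that)
qed

lemma isset_Un: "isset A \<Longrightarrow> isset B \<Longrightarrow> isset (A \<union> B)"
proof -
  assume "isset A" "isset B"
  then have "isset {vset A, vset B}" by (intro isset_pair isset_vset)
  from isset_Union[OF this] show ?thesis using \<open>isset A\<close> \<open>isset B\<close> by (simp add: isset_vset)
qed

lemma isset_insert: "x \<in> M \<Longrightarrow> isset A \<Longrightarrow> isset (insert x A)"
  using isset_Un[OF isset_pair[of x x]] by simp

lemma isset_empty: "isset {}"
proof -
  obtain a where "a \<in> M" using ex_elem by blast
  then have "isset {x \<in> elts a. False}" by (intro separation dfn) auto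
  then show ?thesis by simp
qed

lemma isset_finite: "finite A \<Longrightarrow> A \<subseteq> M \<Longrightarrow> isset A"
  by (induction rule: finite_induct) (auto intro: isset_empty isset_insert)

lemma vset_finite_in: "finite A \<Longrightarrow> A \<subseteq> M \<Longrightarrow> vset A \<in> M"
  by (simp add: isset_finite isset_vset)

lemma isset_Int: "isset A \<Longrightarrow> isset B \<Longrightarrow> isset (A \<inter> B)"
proof -
  assume "isset A" "isset B"
  then obtain b where "b \<in> M" "elts b = B" by (auto simp: isset_def)
  with \<open>isset A\<close> have "isset {x \<in> A. x \<in> elts b}" by (intro separation dfn)
  with \<open>elts b = B\<close> show ?thesis by (simp add: Collect_conj_eq)
qed

lemma definable_isset: "isset A \<Longrightarrow> dterm M t \<Longrightarrow> definable M (\<lambda>e. t e \<in> A)"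
  by (auto simp: isset_def intro!: dfn)

lemma vpair_in [simp]: "vpair x y \<in> M \<longleftrightarrow> x \<in> M \<and> y \<in> M"
proof
  assume "vpair x y \<in> M"
  from elts_sub[OF this] have "vset {x, y} \<in> M" by (simp add: vpair_def)
  from elts_sub[OF this] show "x \<in> M \<and> y \<in> M" by simp
qed (simp add: vpair_def vset_finite_in)

lemma dterm_doubleton [dfn]: "dterm M t \<Longrightarrow> dterm M u \<Longrightarrow> dterm M (\<lambda>e. vset {t e, u e})"
  by (rule dterm_vset, intro isset_pair dterm_in, assumption+)
    (unfold insert_iff empty_iff, intro dfn dterm_shift)

lemma dterm_vpair [dfn]: "dterm M t \<Longrightarrow> dterm M u \<Longrightarrow> dterm M (\<lambda>e. vpair (t e) (u e))"
  using dterm_doubleton[OF dterm_doubleton[of t t] dterm_doubleton[of t u]] by (simp add: vpair_def)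

lemma dterm_insert [dfn]:
  "dterm M t \<Longrightarrow> dterm M u \<Longrightarrow> dterm M (\<lambda>e. vset (insert (t e) (elts (u e))))"
  by (rule dterm_vset, intro isset_insert isset_elts dterm_in, assumption+)
    (unfold insert_iff, intro dfn dterm_shift)

lemma dterm_Union [dfn]: "dterm M t \<Longrightarrow> dterm M (\<lambda>e. vset (\<Union>(elts ` elts (t e))))"
  by (rule dterm_vset, intro isset_Union isset_elts dterm_in, assumption+)
    (unfold UN_iff, intro dfn dterm_shift)

lemma dterm_diff [dfn]:
  assumes "dterm M t" "dterm M u"
  shows "dterm M (\<lambda>e. vset (elts (t e) - elts (u e)))"
proof (rule dterm_vset)
  show "definable M (\<lambda>e. e 0 \<in> elts (t (\<lambda>n. e (Suc n))) - elts (u (\<lambda>n. e (Suc n))))"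
    unfolding Diff_iff using assms by (intro dfn dterm_shift)
  fix e :: "nat \<Rightarrow> 'v" assume "range e \<subseteq> M"
  then have in_M: "t e \<in> M" "u e \<in> M" using assms dterm_in by auto
  then have "isset {x \<in> elts (t e). x \<notin> elts (u e)}"
    by (intro separation dfn) auto
  then show "isset (elts (t e) - elts (u e))" by (simp add: set_diff_eq)
qed

lemma dterm_image:
  assumes "dterm M (\<lambda>e. g (e 0))" "dterm M t"
  shows "dterm M (\<lambda>e. vset (g ` elts (t e)))"
proof (rule dterm_vset)
  show "isset (g ` elts (t e))" if "range e \<subseteq> M" for e
    using dterm_in[OF assms(2) that] assms(1) by (intro replacement_image isset_elts)
  have "definable M (\<lambda>e. e (Suc 0) = g (e 0))"
    using definable_rename[OF conjunct2[OF assms(1)[unfolded dterm_def]],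
      of "\<lambda>n. if n = 0 then 1 else if n = 1 then 0 else n"] by (auto simp: inj_def)
  then show "definable M (\<lambda>e. e 0 \<in> g ` elts (t (\<lambda>n. e (Suc n))))"
    unfolding image_iff by (intro dfn dterm_shift assms)
qed

text \<open>Kuratowski pairs are sets of subsets of the union of \<open>A\<close> and
  \<open>B\<close>, so the product is separated from a double power set.\<close>

lemma isset_times:
  assumes "isset A" "isset B"
  shows "isset (case_prod vpair ` (A \<times> B))"
proof (rule separation_subset)
  let ?C = "{x \<in> M. elts x \<subseteq> {y \<in> M. elts y \<subseteq> A \<union> B}}"
  show "isset ?C" by (intro isset_Pow isset_Un assms)
  show "case_prod vpair ` (A \<times> B) \<subseteq> ?C"
    using isset_sub[OF assms(1)] isset_sub[OF assms(2)] by (auto simp: vpair_def vset_finite_in subset_iff)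
  obtain a b where "a \<in> M" "elts a = A" "b \<in> M" "elts b = B" using assms by (auto simp: isset_def)
  moreover have "definable M (\<lambda>e. \<exists>x\<in>elts a. \<exists>y\<in>elts b. e 0 = vpair x y)" if "a \<in> M" "b \<in> M" for a b
    using that by (intro dfn)
  ultimately show "definable M (\<lambda>e. e 0 \<in> case_prod vpair ` (A \<times> B))"
    by (auto simp: image_iff intro: definable_cong)
qed

text \<open>In the intersection of the inductive subsets in \<open>M\<close> of an inductive set, an \<open>\<in>\<close>-minimal element
  that is not a natural number could be removed.\<close>

lemma isset_omega: "isset (range vnat)"
proof -
  obtain a where "a \<in> M" using ex_elem by blast
  define S :: "'v \<Rightarrow> 'v" where "S x = vset (insert x (elts x))" for x
  have S: "S x \<in> M" "elts (S x) = insert x (elts x)" if "x \<in> M" for x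
    unfolding S_def using isset_vset isset_insert[OF that isset_elts[OF that]] by auto
  have [dfn]: "dterm M (\<lambda>e. S (t e))" if "dterm M t" for t
    unfolding S_def by (intro dfn that)
  have n0: "vnat 0 \<in> M" by (simp add: vset_finite_in)
  define ind where "ind w \<longleftrightarrow> vnat 0 \<in> elts w \<and> (\<forall>x\<in>elts w. S x \<in> elts w)" for w
  have "sat M (\<lambda>_. a) Infinity_ax" using \<open>a \<in> M\<close> by (intro axiom) (auto simp: ZFC_def)
  then obtain w where w: "w \<in> M" "\<exists>x\<in>M. x \<in> elts w \<and> (\<forall>y\<in>M. y \<notin> elts x)"
    "\<forall>x\<in>M. x \<in> elts w \<longrightarrow> (\<exists>y\<in>M. y \<in> elts w \<and> (\<forall>z\<in>M. z \<in> elts y \<longleftrightarrow> z \<in> elts x \<or> z = x))"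
    by (auto simp: Infinity_ax_def)
  have "ind w"
    unfolding ind_def
  proof (intro conjI ballI)
    obtain x where "x \<in> M" "x \<in> elts w" "\<forall>y\<in>M. y \<notin> elts x" using w by blast
    then have "elts x = elts (vnat 0)" using elts_sub[of x] by auto
    then show "vnat 0 \<in> elts w" using \<open>x \<in> elts w\<close> elts_inject by blast
  next
    fix x assume "x \<in> elts w"
    then have "x \<in> M" using w(1) by blast
    obtain y where "y \<in> M" "y \<in> elts w" "\<forall>z\<in>M. z \<in> elts y \<longleftrightarrow> z \<in> elts x \<or> z = x"
      using w \<open>x \<in> elts w\<close> \<open>x \<in> M\<close> by blast
    then have "elts y = elts (S x)"
      unfolding S(2)[OF \<open>x \<in> M\<close>] using elts_sub[of x] elts_sub[of y] \<open>x \<in> M\<close> by blast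
    then show "S x \<in> elts w" using \<open>y \<in> elts w\<close> elts_inject by blast
  qed
  define W where "W = {x \<in> elts w. \<forall>v\<in>M. ind v \<longrightarrow> x \<in> elts v}"
  have "isset W" unfolding W_def ind_def using n0 w(1) by (intro separation dfn) auto
  have "vnat n \<in> elts v" if "ind v" for v n
    using that
  proof (induction n)
    case (Suc n)
    then show ?case by (auto simp: ind_def S_def)
  qed (simp add: ind_def)
  then have 1: "range vnat \<subseteq> W" using \<open>ind w\<close> by (auto simp: W_def)
  have 2: "x \<in> range vnat" if "x \<in> W" for x
    using that
  proof (induction x rule: elts_induct)
    case (1 x)
    show ?case
    proof (rule ccontr)
      assume x: "x \<notin> range vnat"
      have "x \<in> M" using 1 w by (auto simp: W_def)
      have "isset {y \<in> W. y \<noteq> x}" using \<open>isset W\<close> \<open>x \<in> M\<close> by (intro separation dfn)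
      then obtain v where v: "v \<in> M" "elts v = {y \<in> W. y \<noteq> x}" by (auto simp: isset_def)
      have "ind v"
        unfolding ind_def v
      proof (intro conjI ballI CollectI)
        show "vnat 0 \<in> W" "vnat 0 \<noteq> x" using \<open>range vnat \<subseteq> W\<close> x by (auto simp del: vnat.simps)
        fix y assume y: "y \<in> {y \<in> W. y \<noteq> x}"
        then have yM: "y \<in> M" using w by (auto simp: W_def)
        show "S y \<in> W" using y \<open>ind w\<close> by (auto simp: W_def ind_def)
        show "S y \<noteq> x"
        proof
          assume "S y = x"
          then have "y \<in> elts x" using S(2)[OF yM] by auto
          with 1 y obtain n where "y = vnat n" by auto
          then have "x = vnat (Suc n)" using \<open>S y = x\<close> unfolding S_def by (simp only: vnat.simps)
          with x show False by blast
        qed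
      qed
      with 1 v show False by (auto simp: W_def)
    qed
  qed
  from 1 2 have "range vnat = W" by auto
  with \<open>isset W\<close> show ?thesis by simp
qed

section \<open>Natural numbers and finite sequences inside a model\<close>

lemma vomega_in [simp, intro]: "vomega \<in> M"
  by (simp add: vomega_def isset_omega isset_vset)

lemma elts_vomega: "elts (vomega :: 'v) = range vnat"
  unfolding vomega_def by (rule isset_vset(2)[OF isset_omega])

lemma vnat_in [simp, intro]: "vnat n \<in> M"
  using elts_sub[OF vomega_in] by (auto simp: elts_vomega)

lemma vseq_in [simp, intro]: "vseq \<sigma> \<in> M"
proof -
  have "finite {vpair (vnat i) (vnat (\<sigma> ! i)) |i. i < length \<sigma>}" by simp
  then show ?thesis unfolding vseq_def by (rule vset_finite_in) auto
qed

lemma definable_all_nat [dfn]: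
  "definable M (\<lambda>e. Q (dnat (e 0)) (\<lambda>n. e (Suc n))) \<Longrightarrow> definable M (\<lambda>e. \<forall>n::nat. Q n e)"
  by (rule definable_cong[OF definable_ball_elts[OF dterm_const[OF vomega_in], of "\<lambda>x. Q (dnat x)"]])
    (auto simp: elts_vomega)

lemma definable_ex_nat [dfn]:
  "definable M (\<lambda>e. Q (dnat (e 0)) (\<lambda>n. e (Suc n))) \<Longrightarrow> definable M (\<lambda>e. \<exists>n::nat. Q n e)"
  by (rule definable_cong[OF definable_bex_elts[OF dterm_const[OF vomega_in], of "\<lambda>x. Q (dnat x)"]])
    (auto simp: elts_vomega)

lemma dterm_dnat [dfn]: "dterm M t \<Longrightarrow> dterm M (\<lambda>e. vnat (dnat (t e)))"
proof (rule dterm_comp1[where g = "\<lambda>x. vnat (dnat x)"])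
  show "definable M (\<lambda>e. e i = vnat (dnat (e j)))" for i j
  proof (rule definable_cong)
    show "definable M (\<lambda>e. (e j \<in> elts vomega \<and> e i = e j) \<or> (e j \<notin> elts vomega \<and> e i = vnat 0))"
      by (intro dfn vomega_in vnat_in)
  qed (auto simp: elts_vomega dnat_def f_inv_into_f)
qed auto

lemma isset_seqs: "isset (range vseq)"
proof -
  define P where "P = {x \<in> M. elts x \<subseteq> case_prod vpair ` (range vnat \<times> range vnat)}"
  have "isset P" unfolding P_def by (intro isset_Pow isset_times isset_omega)
  \<comment> \<open>The codes of finite sequences are exactly the functions from a natural number to
    omega; written with quantifiers bounded by \<open>vomega\<close> and its elements, this is a
    definable condition on sets of pairs.\<close>
  define fn where "fn x \<longleftrightarrow> (\<exists>n\<in>elts vomega. (\<forall>p\<in>elts x. \<exists>i\<in>elts n. \<exists>j\<in>elts vomega. p = vpair i j) \<and>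
    (\<forall>i\<in>elts n. \<exists>j\<in>elts vomega. \<forall>k\<in>elts vomega. vpair i k \<in> elts x \<longleftrightarrow> k = j))" for x :: 'v
  have "isset {x \<in> P. fn x}" unfolding fn_def
    by (intro separation \<open>isset P\<close> dfn vomega_in)
  moreover have "{x \<in> P. fn x} = range vseq"
  proof (intro equalityI subsetI)
    fix x assume "x \<in> {x \<in> P. fn x}"
    then obtain n where A: "\<forall>p\<in>elts x. \<exists>i\<in>elts (vnat n). \<exists>j\<in>range vnat. p = vpair i j"
      "\<forall>i\<in>elts (vnat n). \<exists>j\<in>range vnat. \<forall>k\<in>range vnat. vpair i k \<in> elts x \<longleftrightarrow> k = j"
      unfolding fn_def elts_vomega by blast
    have n1: "\<exists>i<n. \<exists>j. p = vpair (vnat i) (vnat j)" if "p \<in> elts x" for p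
      using bspec[OF A(1) that] by auto
    have "\<exists>j. \<forall>k. vpair (vnat i) (vnat k) \<in> elts x \<longleftrightarrow> k = j" if i: "i < n" for i
    proof -
      have "vnat i \<in> elts (vnat n)" using i by simp
      from bspec[OF A(2) this] obtain j where
        j: "\<forall>k\<in>range vnat. vpair (vnat i) k \<in> elts x \<longleftrightarrow> k = vnat j" by blast
      have "vpair (vnat i) (vnat k) \<in> elts x \<longleftrightarrow> k = j" for k
        using bspec[OF j rangeI[of vnat k]] by simp
      then show ?thesis by blast
    qed
    then obtain f where f: "\<And>i k. i < n \<Longrightarrow> vpair (vnat i) (vnat k) \<in> elts x \<longleftrightarrow> k = f i" by metis
    have "elts x = {vpair (vnat i) (vnat (f i)) | i. i < n}"
    proof (intro equalityI subsetI)
      fix p :: 'v assume p: "p \<in> elts x"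
      from n1[OF p] obtain i j where "i < n" "p = vpair (vnat i) (vnat j)" by blast
      then show "p \<in> {vpair (vnat i) (vnat (f i)) | i. i < n}" using f[of i j] p by auto
    next
      fix p :: 'v assume "p \<in> {vpair (vnat i) (vnat (f i)) | i. i < n}"
      then obtain i where "i < n" "p = vpair (vnat i) (vnat (f i))" by blast
      then show "p \<in> elts x" using f[of i "f i"] by simp
    qed
    also have "\<dots> = elts (vseq (map f [0..<n]))"
      unfolding vseq_elts
      by (intro Collect_cong ex_cong1) (rule iffI; elim conjE; intro conjI; simp)
    finally have "elts x = elts (vseq (map f [0..<n]))" .
    then show "x \<in> range vseq" using elts_inject by blast
  next
    fix x :: 'v assume "x \<in> range vseq"
    then obtain \<sigma> where x: "x = vseq \<sigma>" by auto
    have "fn x" unfolding fn_def x elts_vomega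
    proof (intro bexI[of _ "vnat (length \<sigma>)"] conjI; (intro ballI)?)
      show "\<exists>i\<in>elts (vnat (length \<sigma>)). \<exists>j\<in>range vnat. p = vpair i j" if "p \<in> elts (vseq \<sigma>)" for p :: 'v
        using that by auto
      show "\<exists>j\<in>range vnat. \<forall>k\<in>range vnat. (vpair i k \<in> elts (vseq \<sigma>)) = (k = j)"
        if i: "i \<in> elts (vnat (length \<sigma>))" for i :: 'v
      proof -
        obtain i' where "i = vnat i'" "i' < length \<sigma>" using i by auto
        then show ?thesis by (intro bexI[of _ "vnat (\<sigma> ! i')"]) auto
      qed
    qed simp
    moreover have "x \<in> P" using x by (auto simp: P_def image_iff)
    ultimately show "x \<in> {x \<in> P. fn x}" by simp
  qed
  ultimately show ?thesis by simp
qed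

definition vseqs :: 'v where
  "vseqs = vset (range vseq)"

lemma vseqs_in [simp, intro]: "vseqs \<in> M" and elts_vseqs: "elts vseqs = range vseq"
  unfolding vseqs_def by (rule isset_vset[OF isset_seqs])+

lemma definable_all_seq [dfn]:
  "definable M (\<lambda>e. Q (dseq (e 0)) (\<lambda>n. e (Suc n))) \<Longrightarrow> definable M (\<lambda>e. \<forall>s::nat list. Q s e)"
  by (rule definable_cong[OF definable_ball_elts[OF dterm_const[OF vseqs_in], of "\<lambda>x. Q (dseq x)"]])
    (auto simp: elts_vseqs)

lemma definable_ex_seq [dfn]:
  "definable M (\<lambda>e. Q (dseq (e 0)) (\<lambda>n. e (Suc n))) \<Longrightarrow> definable M (\<lambda>e. \<exists>s::nat list. Q s e)"
  by (rule definable_cong[OF definable_bex_elts[OF dterm_const[OF vseqs_in], of "\<lambda>x. Q (dseq x)"]])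
    (auto simp: elts_vseqs)

lemma dterm_dseq [dfn]: "dterm M t \<Longrightarrow> dterm M (\<lambda>e. vseq (dseq (t e)))"
proof (rule dterm_comp1[where g = "\<lambda>x. vseq (dseq x)"])
  show "definable M (\<lambda>e. e i = vseq (dseq (e j)))" for i j
  proof (rule definable_cong)
    show "definable M (\<lambda>e. (e j \<in> elts vseqs \<and> e i = e j) \<or> (e j \<notin> elts vseqs \<and> e i = vseq []))"
      by (intro dfn vseqs_in vseq_in)
  qed (auto simp: elts_vseqs dseq_def f_inv_into_f)
qed auto

lemma definable_prefix [dfn]:
  "dterm M (\<lambda>e. vseq (s e)) \<Longrightarrow> dterm M (\<lambda>e. vseq (t e)) \<Longrightarrow> definable M (\<lambda>e. prefix (s e) (t e))"
  unfolding vseq_subset_iff[where 'a = 'v, symmetric] subset_eq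
  by (intro dfn dterm_shift[of "\<lambda>e. vseq (t e)"])

lemma definable_seq_eq [dfn]:
  "dterm M (\<lambda>e. vseq (s e)) \<Longrightarrow> dterm M (\<lambda>e. vseq (t e)) \<Longrightarrow> definable M (\<lambda>e. s e = t e)"
  using definable_eq[of "\<lambda>e. vseq (s e)" "\<lambda>e. vseq (t e)"] by simp

lemma definable_nat_eq [dfn]:
  "dterm M (\<lambda>e. vnat (s e)) \<Longrightarrow> dterm M (\<lambda>e. vnat (t e)) \<Longrightarrow> definable M (\<lambda>e. s e = t e)"
  using definable_eq[of "\<lambda>e. vnat (s e)" "\<lambda>e. vnat (t e)"] by simp

lemma vseq_snoc:
  "elts (vseq (\<sigma> @ [i])) = insert (vpair (vnat (length \<sigma>)) (vnat i)) (elts (vseq \<sigma>))"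
proof -
  have im: "elts (vseq s) = (\<lambda>j. vpair (vnat j) (vnat (s ! j))) ` {..<length s}" for s
    by auto
  have eq: "(\<lambda>j. vpair (vnat j) (vnat ((\<sigma> @ [i]) ! j))) ` {..<length \<sigma>} = (\<lambda>j. vpair (vnat j) (vnat (\<sigma> ! j))) ` {..<length \<sigma>}"
    by (rule image_cong) (simp_all add: nth_append)
  show ?thesis unfolding im length_append_singleton lessThan_Suc image_insert eq by simp
qed

text \<open>This avoids expressing the length of \<open>\<sigma>\<close> in the model: if adding one
  new pair to the graph of \<open>\<sigma>\<close> gives the graph of a finite sequence again, then
  the position of that pair must be the length.\<close>

lemma eq_vseq_snoc_iff:
  fixes x :: 'v
  shows "x = vseq (\<sigma> @ [i]) \<longleftrightarrow> x \<in> range vseq \<and>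
    (\<exists>n. vpair (vnat n) (vnat i) \<notin> elts (vseq \<sigma> :: 'v) \<and> x = vset (insert (vpair (vnat n) (vnat i)) (elts (vseq \<sigma>))))"
  (is "_ \<longleftrightarrow> ?R")
proof
  assume x: "x = vseq (\<sigma> @ [i])"
  moreover have "vpair (vnat (length \<sigma>)) (vnat i) \<notin> elts (vseq \<sigma> :: 'v)" by auto
  moreover have "x = vset (insert (vpair (vnat (length \<sigma>)) (vnat i)) (elts (vseq \<sigma>)))"
    unfolding x vseq_snoc[symmetric] by (rule vset_elts[symmetric])
  ultimately show ?R by blast
next
  assume ?R
  then obtain \<tau> n where x: "x = vseq \<tau>" and n: "vpair (vnat n) (vnat i) \<notin> elts (vseq \<sigma> :: 'v)"
    "x = vset (insert (vpair (vnat n) (vnat i)) (elts (vseq \<sigma>)))"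
    by blast
  have fin: "finite (elts (vseq \<sigma> :: 'v))" by simp
  then have el: "elts (vseq \<tau> :: 'v) = insert (vpair (vnat n) (vnat i)) (elts (vseq \<sigma>))"
    using x n(2) by (metis elts_vset_finite finite_insert)
  have "prefix \<sigma> \<tau>" unfolding vseq_subset_iff[where 'a = 'v, symmetric] el by (rule subset_insertI)
  then obtain \<rho> where \<tau>: "\<tau> = \<sigma> @ \<rho>" by (auto simp: prefix_def)
  have card: "card (elts (vseq s :: 'v)) = length s" for s
  proof -
    have "elts (vseq s :: 'v) = (\<lambda>i. vpair (vnat i) (vnat (s ! i))) ` {..<length s}" by auto
    then show ?thesis by (simp add: card_image inj_on_def)
  qed
  have "card (elts (vseq \<tau> :: 'v)) = Suc (length \<sigma>)"
    unfolding el card_insert_disjoint[OF fin n(1)] card ..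
  then have "length \<tau> = Suc (length \<sigma>)" using card[of \<tau>] by simp
  then obtain j where \<rho>: "\<rho> = [j]" using \<tau> by (auto simp: length_Suc_conv)
  have "vpair (vnat n) (vnat i) \<in> elts (vseq (\<sigma> @ [j]) :: 'v)" using el \<tau> \<rho> by blast
  then have "j = i" using n(1) unfolding vseq_snoc by auto
  then show "x = vseq (\<sigma> @ [i])" using x \<tau> \<rho> by simp
qed

lemma dterm_snoc [dfn]:
  assumes "dterm M (\<lambda>e. vseq (s e))" "dterm M (\<lambda>e. vnat (n e))"
  shows "dterm M (\<lambda>e. vseq (s e @ [n e]))"
proof -
  have "dterm M (\<lambda>e. vseq (dseq (vseq (s e) :: 'v) @ [dnat (vnat (n e) :: 'v)]))"
  proof (rule dterm_comp2[where g = "\<lambda>x y. vseq (dseq x @ [dnat y])"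
      and t = "\<lambda>e. vseq (s e)" and u = "\<lambda>e. vnat (n e)"])
    show "definable M (\<lambda>e. e i = vseq (dseq (e j) @ [dnat (e k)]))" for i j k
      unfolding eq_vseq_snoc_iff elts_vseqs[symmetric]
      by (intro dfn vseqs_in)
  qed (use assms in auto)
  then show ?thesis by simp
qed

text \<open>Membership in the ultrafilter becomes a quantifier over the elements of
  \<open>U\<close>. Since these are subsets of omega, equality with \<open>{i. Q i e}\<close> can be
  tested on natural numbers alone.\<close>

lemma definable_family [dfn]:
  assumes "U \<in> M" "\<forall>A\<in>elts U. elts A \<subseteq> range vnat" "definable M (\<lambda>e. Q (dnat (e 0)) (\<lambda>n. e (Suc n)))"
  shows "definable M (\<lambda>e. {i. Q i e} \<in> family U)"
proof (rule definable_cong)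
  from definable_rename[OF assms(3), of "\<lambda>n. if n = 0 then 0 else Suc n"]
  have "definable M (\<lambda>e. Q (dnat (e 0)) (\<lambda>n. e (Suc (Suc n))))" by (auto simp: inj_def)
  then show "definable M (\<lambda>e. \<exists>A\<in>elts U. \<forall>i. vnat i \<in> elts A \<longleftrightarrow> Q i e)"
    by (intro dfn assms(1))
  have "(\<forall>i. vnat i \<in> elts A \<longleftrightarrow> Q i e) \<longleftrightarrow> elts A = vnat ` {i. Q i e}" if "A \<in> elts U" for A e
  proof -
    have "elts A = vnat ` {i. vnat i \<in> elts A}" using assms(2) that by blast
    then have "elts A = vnat ` {i. Q i e} \<longleftrightarrow> {i. vnat i \<in> elts A} = {i. Q i e}"
      by (metis inj_image_eq_iff inj_vnat)
    then show ?thesis by (simp add: set_eq_iff)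
  qed
  then show "(\<exists>A\<in>elts U. \<forall>i. vnat i \<in> elts A \<longleftrightarrow> Q i e) = ({i. Q i e} \<in> family U)" for e
    by (auto simp: family_def)
qed

lemma subset_of_omega: "definable M (\<lambda>e. Q (dnat (e 0))) \<Longrightarrow> {i. Q i} \<in> subsets_of_omega M"
proof -
  assume "definable M (\<lambda>e. Q (dnat (e 0)))"
  then have "isset {x \<in> range vnat. Q (dnat x)}" by (intro separation isset_omega)
  moreover have "{x \<in> range vnat. Q (dnat x)} = (vnat ` {i. Q i} :: 'v set)" by auto
  ultimately show ?thesis by (auto simp: subsets_of_omega_def isset_def)
qed

lemma isset_seq_set: "definable M (\<lambda>e. Q (dseq (e 0))) \<Longrightarrow> isset (vseq ` {s. Q s})"
proof -
  assume "definable M (\<lambda>e. Q (dseq (e 0)))"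
  then have "isset {x \<in> range vseq. Q (dseq x)}" by (intro separation isset_seqs)
  moreover have "{x \<in> range vseq. Q (dseq x)} = ( vseq ` {s. Q s} :: 'v set)" by auto
  ultimately show ?thesis by simp
qed

end

declare vnat.simps [simp del]

section \<open>Recursion on membership in transitive models\<close>

context zfc_model
begin

text \<open>The attempts at computing \<open>F\<close> in \<open>M\<close> are exactly the restrictions of \<open>F\<close> in \<open>M\<close> whose domain
  is transitive. The smallest attempt with \<open>y\<close> in its domain is unique, which makes Replacement
  applicable to the attempts for the elements of a set.\<close>

lemma recursion:
  assumes G: "\<And>x s. x \<in> M \<Longrightarrow> s \<in> M \<Longrightarrow> G x s \<in> M"
    and Gd: "\<And>i j k. definable M (\<lambda>e. e i = G (e j) (e k))"
    and F: "\<And>x s. x \<in> M \<Longrightarrow> s \<in> M \<Longrightarrow> elts s = F ` elts x \<Longrightarrow> F x = G x s"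
  shows "\<And>x. x \<in> M \<Longrightarrow> F x \<in> M" "\<And>x. x \<in> M \<Longrightarrow> isset (F ` elts x)"
    and "\<And>x. x \<in> M \<Longrightarrow> \<exists>t\<in>M. x \<in> elts t \<and> (\<forall>y\<in>elts t. elts y \<subseteq> elts t)"
    and "\<And>t. dterm M t \<Longrightarrow> dterm M (\<lambda>e. F (t e))"
proof -
  define att where "att f \<longleftrightarrow> (\<forall>p\<in>elts f. \<exists>x\<in>M. \<exists>s\<in>M. p = vpair x (G x s) \<and>
    (\<forall>w\<in>M. w \<in> elts s \<longleftrightarrow> (\<exists>y\<in>elts x. vpair y w \<in> elts f)) \<and>
    (\<forall>y\<in>elts x. \<exists>w\<in>M. vpair y w \<in> elts f))" for f
  have G_dfn: "dterm M (\<lambda>e. G (t e) (u e))" if "dterm M t" "dterm M u" for t u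
    by (rule dterm_comp2[where g = G, OF G Gd that])
  have att_dfn: "definable M (\<lambda>e. att (e i))" for i
    unfolding att_def by (intro dfn G_dfn)
  \<comment> \<open>Unlike \<open>att\<close>, this description mentions \<open>F\<close>, which is
    not yet known to be definable, so it cannot occur in Separation or Replacement. For
    \<open>f\<close> in \<open>M\<close> the two agree, by \<open>att_C\<close> and
    \<open>C_att\<close>.\<close>
  define C where "C f \<longleftrightarrow> (\<forall>p\<in>elts f. \<exists>x\<in>M. p = vpair x (F x) \<and> (\<forall>y\<in>elts x. vpair y (F y) \<in> elts f))" for f
  have CD: "w = F x \<and> (\<forall>y\<in>elts x. vpair y (F y) \<in> elts f)" if "C f" "vpair x w \<in> elts f" for f x w
    using bspec[OF that(1)[unfolded C_def] that(2)] by auto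
  have att_val: "v = F x \<and> (\<forall>y\<in>elts x. vpair y (F y) \<in> elts f)"
    if f: "f \<in> M" "att f" "vpair x v \<in> elts f" for f x v
    using f(3)
  proof (induction x arbitrary: v rule: elts_induct)
    case (1 x)
    obtain x' s where "vpair x v = vpair x' (G x' s)" "x' \<in> M" and s': "s \<in> M"
      "\<forall>w\<in>M. w \<in> elts s \<longleftrightarrow> (\<exists>y\<in>elts x'. vpair y w \<in> elts f)"
      "\<forall>y\<in>elts x'. \<exists>w\<in>M. vpair y w \<in> elts f"
      using bspec[OF f(2)[unfolded att_def] 1(2)] by blast
    then have s: "x \<in> M" "s \<in> M" "v = G x s"
      "\<And>w. w \<in> M \<Longrightarrow> w \<in> elts s \<longleftrightarrow> (\<exists>y\<in>elts x. vpair y w \<in> elts f)"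
      "\<And>y. y \<in> elts x \<Longrightarrow> \<exists>w\<in>M. vpair y w \<in> elts f"
      by (simp_all only: vpair_inject)
    have y: "vpair y (F y) \<in> elts f \<and> F y \<in> M" if "y \<in> elts x" for y
      using s(5)[OF that] 1(1)[OF that] by blast
    have "elts s = F ` elts x"
    proof (intro equalityI subsetI)
      fix w assume w: "w \<in> elts s"
      then have "w \<in> M" using s(2) by blast
      then show "w \<in> F ` elts x" using s(4) w 1(1) by blast
    qed (use s(4) y in blast)
    then have "F x = G x s" using F s by blast
    then show ?case using s(3) y by simp
  qed
  have att_C: "C f" if f: "f \<in> M" "att f" for f
    unfolding C_def
  proof
    fix p assume p: "p \<in> elts f"
    then obtain x v where xv: "p = vpair x v" "x \<in> M" using f(2) unfolding att_def by blast
    with att_val[OF f, of x v] p show "\<exists>x\<in>M. p = vpair x (F x) \<and> (\<forall>y\<in>elts x. vpair y (F y) \<in> elts f)"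
      by blast
  qed
  have isset_F: "isset (F ` elts x)"
    if x: "x \<in> M" "f \<in> M" "\<And>y. y \<in> elts x \<Longrightarrow> vpair y (F y) \<in> elts f"
      and fn: "\<And>y w. vpair y w \<in> elts f \<Longrightarrow> w = F y" for x f
  proof -
    have FM: "F y \<in> M" if "y \<in> elts x" for y using elts_in[OF x(2) x(3)[OF that]] by simp
    have "isset {w \<in> M. \<exists>y\<in>elts x. vpair y w \<in> elts f}"
    proof (rule replacement_env[where R = "\<lambda>y w e. vpair y w \<in> elts f" and e = "\<lambda>_. x"])
      show "\<exists>w\<in>M. \<forall>w'\<in>M. vpair y w' \<in> elts f \<longleftrightarrow> w' = w" if "y \<in> elts x" for y
        using x(3)[OF that] fn FM[OF that] by blast
    qed (use x in \<open>auto intro!: dfn\<close>)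
    also have "{w \<in> M. \<exists>y\<in>elts x. vpair y w \<in> elts f} = F ` elts x"
      using x(3) fn FM by blast
    finally show ?thesis .
  qed
  have C_att: "att f" if f: "f \<in> M" "C f" for f
    unfolding att_def
  proof
    fix p assume "p \<in> elts f"
    then obtain x where x: "x \<in> M" "p = vpair x (F x)" "\<And>y. y \<in> elts x \<Longrightarrow> vpair y (F y) \<in> elts f"
      using f(2) unfolding C_def by blast
    have "isset (F ` elts x)" using isset_F[OF x(1) f(1) x(3)] CD[OF f(2)] by blast
    then obtain s where s: "s \<in> M" "elts s = F ` elts x" by (auto simp: isset_def)
    have "F y \<in> M" if "y \<in> elts x" for y using elts_in[OF f(1) x(3)[OF that]] by simp
    then have "\<forall>y\<in>elts x. \<exists>w\<in>M. vpair y w \<in> elts f" using x(3) by blast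
    moreover have "\<forall>w\<in>M. w \<in> elts s \<longleftrightarrow> (\<exists>y\<in>elts x. vpair y w \<in> elts f)"
    proof (intro ballI iffI)
      show "\<exists>y\<in>elts x. vpair y w \<in> elts f" if "w \<in> elts s" for w
        using that x(3) unfolding s(2) by blast
      fix w assume "\<exists>y\<in>elts x. vpair y w \<in> elts f"
      then obtain y where y: "y \<in> elts x" "vpair y w \<in> elts f" by blast
      then have "w = F y" using CD[OF f(2)] by blast
      then show "w \<in> elts s" using y(1) unfolding s(2) by blast
    qed
    moreover have "p = vpair x (G x s)" using x(2) F[OF x(1) s] by simp
    ultimately have "p = vpair x (G x s) \<and> (\<forall>w\<in>M. w \<in> elts s \<longleftrightarrow> (\<exists>y\<in>elts x. vpair y w \<in> elts f)) \<and>
      (\<forall>y\<in>elts x. \<exists>w\<in>M. vpair y w \<in> elts f)" by blast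
    with x(1) s(1) show "\<exists>x\<in>M. \<exists>s\<in>M. p = vpair x (G x s) \<and>
      (\<forall>w\<in>M. w \<in> elts s \<longleftrightarrow> (\<exists>y\<in>elts x. vpair y w \<in> elts f)) \<and>
      (\<forall>y\<in>elts x. \<exists>w\<in>M. vpair y w \<in> elts f)"
      by blast
  qed
  define B where "B y p \<longleftrightarrow> (\<forall>g\<in>M. att g \<longrightarrow> (\<exists>w\<in>M. vpair y w \<in> elts g) \<longrightarrow> p \<in> elts g)" for y p
  define Q where "Q y f \<longleftrightarrow> (\<forall>p\<in>M. p \<in> elts f \<longleftrightarrow> B y p)" for y f
  have QD: "p \<in> elts f \<longleftrightarrow> B y p" if "Q y f" "p \<in> M" for y f p
    using that unfolding Q_def by blast
  have main: "isset (F ` elts x) \<and> (\<exists>f\<in>M. att f \<and> vpair x (F x) \<in> elts f)" if "x \<in> M" for x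
    using that
  proof (induction x rule: elts_induct)
    case (1 x)
    have ex: "\<exists>f\<in>M. att f \<and> vpair y (F y) \<in> elts f" if "y \<in> elts x" for y
      using 1(1)[OF that] 1(2) that by blast
    have ex1: "\<exists>f\<in>M. \<forall>f'\<in>M. Q y f' \<longleftrightarrow> f' = f" if y: "y \<in> elts x" for y
    proof -
      obtain g0 where g0: "g0 \<in> M" "att g0" "vpair y (F y) \<in> elts g0" using ex[OF y] by blast
      have yM: "y \<in> M" using y 1(2) by blast
      have FM: "F y \<in> M" using elts_in[OF g0(1,3)] by simp
      have "isset {p \<in> elts g0. B y p}"
        unfolding B_def by (intro separation dfn att_dfn isset_elts g0 yM)
      then obtain f where f: "f \<in> M"
        "elts f = {p \<in> elts g0. B y p}"
        by (auto simp: isset_def)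
      have "p \<in> elts g0" if "B y p" for p using that g0 FM unfolding B_def by blast
      then have "Q y f" unfolding Q_def f(2) by blast
      moreover have "f' = f" if "f' \<in> M" "Q y f'" for f'
      proof -
        have "elts f' = elts f"
          using QD[OF \<open>Q y f\<close>] QD[OF that(2)] elts_sub[OF f(1)] elts_sub[OF that(1)] by auto
        then show ?thesis by (rule elts_inject)
      qed
      ultimately show ?thesis using f(1) by blast
    qed
    have "isset {f \<in> M. \<exists>y\<in>elts x. Q y f}"
    proof (rule replacement_env[where R = "\<lambda>y f e. Q y f" and e = "\<lambda>_. x"])
      show "definable M (\<lambda>e. Q (e 0) (e 1))" unfolding Q_def B_def by (intro dfn att_dfn)
    qed (use ex1 1(2) in auto)
    from isset_Union[OF this] obtain h where h: "h \<in> M" "elts h = \<Union>(elts ` {f \<in> M. \<exists>y\<in>elts x. Q y f})"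
      by (auto simp: isset_def)
    have "C h"
      unfolding C_def
    proof
      fix p assume "p \<in> elts h"
      then obtain f y where f: "f \<in> M" "y \<in> elts x" "Q y f" "p \<in> elts f" using h(2) by blast
      then have pM: "p \<in> M" by blast
      obtain g0 where g0: "g0 \<in> M" "att g0" "vpair y (F y) \<in> elts g0" using ex[OF f(2)] by blast
      have FM: "F y \<in> M" using elts_in[OF g0(1,3)] by simp
      have pg: "p \<in> elts g" if "g \<in> M" "att g" "\<exists>w\<in>M. vpair y w \<in> elts g" for g
        using QD[OF f(3) pM] f(4) that unfolding B_def by blast
      then obtain x' where x': "x' \<in> M" "p = vpair x' (F x')"
        using att_C[OF g0(1,2)] g0 FM unfolding C_def by blast
      have "vpair y' (F y') \<in> elts h" if y': "y' \<in> elts x'" for y'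
      proof -
        have *: "vpair y' (F y') \<in> elts g" if "g \<in> M" "att g" "\<exists>w\<in>M. vpair y w \<in> elts g" for g
          using att_val[OF that(1,2)] pg[OF that] x'(2) y' by blast
        then have "vpair y' (F y') \<in> M" using g0 FM by blast
        from QD[OF f(3) this] * have "vpair y' (F y') \<in> elts f" unfolding B_def by blast
        then show ?thesis using h(2) f by blast
      qed
      with x' show "\<exists>x\<in>M. p = vpair x (F x) \<and> (\<forall>y\<in>elts x. vpair y (F y) \<in> elts h)" by blast
    qed
    have yh: "vpair y (F y) \<in> elts h" if y: "y \<in> elts x" for y
    proof -
      obtain f where f: "f \<in> M" "Q y f" using ex1[OF y] by blast
      obtain g0 where g0: "g0 \<in> M" "att g0" "vpair y (F y) \<in> elts g0" using ex[OF y] by blast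
      then have "vpair y (F y) \<in> M" by blast
      moreover have "vpair y (F y) \<in> elts g" if "g \<in> M" "att g" "\<exists>w\<in>M. vpair y w \<in> elts g" for g
        using that att_val[OF that(1,2)] by blast
      ultimately have "vpair y (F y) \<in> elts f" using QD[OF f(2)] unfolding B_def by blast
      then show ?thesis using h(2) f y by blast
    qed
    have iF: "isset (F ` elts x)" using isset_F[OF 1(2) h(1) yh] CD[OF \<open>C h\<close>] by blast
    then obtain s where "s \<in> M" "elts s = F ` elts x" by (auto simp: isset_def)
    then have FxM: "F x \<in> M" using F[OF 1(2)] G[OF 1(2)] by metis
    then have "isset (insert (vpair x (F x)) (elts h))" using 1(2) h(1) by (intro isset_insert isset_elts) auto
    then obtain f where f: "f \<in> M" "elts f = insert (vpair x (F x)) (elts h)" by (auto simp: isset_def)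
    have "C f" using \<open>C h\<close> yh 1(2) unfolding C_def f(2) by blast
    then have "att f" by (rule C_att[OF f(1)])
    then show ?case using iF f by blast
  qed
  show "isset (F ` elts x)" if "x \<in> M" for x using main[OF that] by blast
  show FM: "F x \<in> M" if x: "x \<in> M" for x
  proof -
    obtain f where "f \<in> M" "vpair x (F x) \<in> elts f" using main[OF x] by blast
    from elts_in[OF this] show ?thesis by simp
  qed
  show "\<exists>t\<in>M. x \<in> elts t \<and> (\<forall>y\<in>elts t. elts y \<subseteq> elts t)" if x: "x \<in> M" for x
  proof -
    obtain f where f: "f \<in> M" "att f" "vpair x (F x) \<in> elts f" using main[OF x] by blast
    \<comment> \<open>Kuratowski pairs put the arguments of \<open>f\<close> into this double union,
      from which its domain is separated; the domain of an attempt is transitive.\<close>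
    define U where "U = \<Union>(elts ` \<Union>(elts ` elts f))"
    have "isset {y \<in> U. \<exists>w\<in>M. vpair y w \<in> elts f}"
      unfolding U_def by (intro separation isset_Union isset_elts dfn f)
    then obtain t where t: "t \<in> M" "elts t = {y \<in> U. \<exists>w\<in>M. vpair y w \<in> elts f}" by (auto simp: isset_def)
    have U: "y \<in> U" if "vpair y w \<in> elts f" for y w
    proof -
      have "vset {y} \<in> elts (vpair y w)" "y \<in> elts (vset {y})" by (simp_all add: elts_vpair)
      with that show ?thesis unfolding U_def by blast
    qed
    have "elts y \<subseteq> elts t" if yt: "y \<in> elts t" for y
    proof
      fix z assume z: "z \<in> elts y"
      obtain w where w: "vpair y w \<in> elts f" using yt unfolding t(2) by blast
      have zf: "vpair z (F z) \<in> elts f" using conjunct2[OF att_val[OF f(1,2) w]] z by blast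
      then have "F z \<in> M" using elts_in[OF f(1) zf] by simp
      then show "z \<in> elts t" using zf U unfolding t(2) by blast
    qed
    moreover have "x \<in> elts t" using f(3) U FM[OF x] unfolding t(2) by blast
    ultimately show ?thesis using t(1) by blast
  qed
  show "dterm M (\<lambda>e. F (t e))" if "dterm M t" for t
  proof (rule dterm_comp1[OF FM _ that])
    show "definable M (\<lambda>e. e i = F (e j))" for i j
    proof (rule definable_cong)
      show "definable M (\<lambda>e. \<exists>f\<in>M. att f \<and> vpair (e j) (e i) \<in> elts f)"
        by (intro dfn att_dfn)
      show "(\<exists>f\<in>M. att f \<and> vpair (e j) (e i) \<in> elts f) = (e i = F (e j))" if "range e \<subseteq> M" for e
      proof -
        have "e j \<in> M" using that by auto
        then show ?thesis using main[of "e j"] att_val by metis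
      qed
    qed
  qed
qed

text \<open>Recursion is applied to the identity function: the domain of an attempt defined at
  \<open>x\<close> is such a set.\<close>

lemma ex_transitive_superset:
  assumes "x \<in> M"
  obtains t where "t \<in> M" "x \<in> elts t" "\<And>y. y \<in> elts t \<Longrightarrow> elts y \<subseteq> elts t"
  using recursion(3)[of "\<lambda>x s. x" "\<lambda>x. x"] assms by (metis definable_atom(2))

section \<open>Recursively defined functions of a model\<close>

lemma vrec_in:
  assumes G: "\<And>x s. x \<in> M \<Longrightarrow> s \<in> M \<Longrightarrow> G x s \<in> M"
    and Gd: "\<And>i j k. definable M (\<lambda>e. e i = G (e j) (e k))"
  shows "x \<in> M \<Longrightarrow> vrec G x \<in> M" "x \<in> M \<Longrightarrow> isset (vrec G ` elts x)"
    and "dterm M t \<Longrightarrow> dterm M (\<lambda>e. vrec G (t e))"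
proof -
  have "vrec G x = G x s" if "elts s = vrec G ` elts x" for x s
    unfolding vrec.simps[of G x] that[symmetric] by simp
  note * = recursion[where G = G and F = "vrec G", OF G Gd this]
  show "x \<in> M \<Longrightarrow> vrec G x \<in> M" "x \<in> M \<Longrightarrow> isset (vrec G ` elts x)"
    "dterm M t \<Longrightarrow> dterm M (\<lambda>e. vrec G (t e))"
    by (rule *(1) *(2) *(4); assumption)+
qed

text \<open>The definition of \<open>check_name\<close> applies \<open>vset\<close> to an image that
  need not be a set of the ambient universe. Carrying out the recursion in \<open>M\<close> shows
  that it is one, and also makes \<open>check_name\<close> available in definable
  predicates.\<close>

lemma check_name_in:
  assumes "top_cond P \<in> M"
  shows "x \<in> M \<Longrightarrow> check_name P x \<in> M"
    and "x \<in> M \<Longrightarrow> elts (check_name P x) = (\<lambda>y. vpair (check_name P y) (top_cond P)) ` elts x"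
    and "dterm M t \<Longrightarrow> dterm M (\<lambda>e. check_name P (t e))"
proof -
  define G where "G x s = vset ((\<lambda>v. vpair v (top_cond P)) ` elts s)" for x s :: 'v
  have g: "dterm M (\<lambda>e. vset ((\<lambda>v. vpair v (top_cond P)) ` elts (e k)))" for k
    by (intro dterm_image dfn assms)
  have G: "G x s \<in> M" if "s \<in> M" for x s
    using dterm_in[OF g[of 0], of "\<lambda>_. s"] that by (auto simp: G_def)
  have Gd: "definable M (\<lambda>e. e i = G (e j) (e k))" for i j k
    unfolding G_def by (intro dfn g)
  have F: "check_name P x = G x s" if "elts s = check_name P ` elts x" for x s
    unfolding check_name.simps[of P x] G_def that by (simp add: image_image)
  note * = recursion[where G = G and F = "check_name P", OF G Gd F]
  show "x \<in> M \<Longrightarrow> check_name P x \<in> M" "dterm M t \<Longrightarrow> dterm M (\<lambda>e. check_name P (t e))"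
    by (rule *(1) *(4); assumption)+
  show "elts (check_name P x) = (\<lambda>y. vpair (check_name P y) (top_cond P)) ` elts x" if "x \<in> M"
  proof -
    have "isset ((\<lambda>v. vpair v (top_cond P)) ` (check_name P ` elts x))"
      by (intro replacement_image *(2) that dfn assms)
    from isset_vset(2)[OF this] show ?thesis
      unfolding check_name.simps[of P x] by (simp add: image_image)
  qed
qed

text \<open>The values at a natural number are \<open>2n + 2\<close> and \<open>2\<^bsup>n+1\<^esup> - 2\<close>, respectively: the supremum of
  the values at smaller numbers is the value at the predecessor.\<close>

definition succ2 :: "'v \<Rightarrow> 'v" where
  "succ2 x = vset (insert (vset (insert x (elts x))) (elts (vset (insert x (elts x)))))"

definition dbl :: "'v \<Rightarrow> 'v" where
  "dbl = vrec (\<lambda>x s. succ2 (vset (\<Union>(elts ` elts s))))"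

definition intv :: "'v \<Rightarrow> 'v" where
  "intv = vrec (\<lambda>x s. vset (\<Union>(elts ` elts (vset (dbl ` elts s)))))"

lemma succ2_vnat: "succ2 (vnat n) = vnat (Suc (Suc n))"
  by (simp only: succ2_def vnat.simps(2))

lemma vset_vnat_lessThan: "vset (vnat ` {..<n}) = vnat n"
  by (rule vset_eqI) simp

lemma dterm_dbl: "dterm M t \<Longrightarrow> dterm M (\<lambda>e. dbl (t e))"
  unfolding dbl_def
proof (rule vrec_in(3)[where G = "\<lambda>x s. succ2 (vset (\<Union>(elts ` elts s)))"])
  have *: "dterm M (\<lambda>e. succ2 (vset (\<Union>(elts ` elts (e k)))))" for k
    unfolding succ2_def by (intro dfn)
  show "succ2 (vset (\<Union>(elts ` elts s))) \<in> M" if "s \<in> M" for s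
    using dterm_in[OF *[of 0], of "\<lambda>_. s"] that by auto
  show "definable M (\<lambda>e. e i = succ2 (vset (\<Union>(elts ` elts (e k)))))" for i k
    by (intro dfn *)
qed

lemma dterm_intv: "dterm M t \<Longrightarrow> dterm M (\<lambda>e. intv (t e))"
  unfolding intv_def
proof (rule vrec_in(3)[where G = "\<lambda>x s. vset (\<Union>(elts ` elts (vset (dbl ` elts s))))"])
  have *: "dterm M (\<lambda>e. vset (\<Union>(elts ` elts (vset (dbl ` elts (e k))))))" for k
    by (intro dfn dterm_image dterm_dbl)
  show "vset (\<Union>(elts ` elts (vset (dbl ` elts s)))) \<in> M" if "s \<in> M" for s
    using dterm_in[OF *[of 0], of "\<lambda>_. s"] that by auto
  show "definable M (\<lambda>e. e i = vset (\<Union>(elts ` elts (vset (dbl ` elts (e k))))))" for i k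
    by (intro dfn *)
qed

lemma dbl_vnat: "dbl (vnat n) = vnat (2 * n + 2)"
proof (induction n rule: less_induct)
  case (less n)
  have "dbl ` elts (vnat n) = (\<lambda>m. vnat (2 * m + 2)) ` {..<n}"
    using less by (auto simp: image_image)
  then have eq: "elts (vset (dbl ` elts (vnat n))) = (\<lambda>m. vnat (2 * m + 2)) ` {..<n}" by simp
  have "(\<Union>m<n. {..<2 * m + 2}) = {..<2 * n}"
  proof (intro equalityI subsetI)
    fix k assume "k \<in> {..<2 * n}"
    then have "k div 2 < n" "k < 2 * (k div 2) + 2" by auto
    then show "k \<in> (\<Union>m<n. {..<2 * m + 2})" by blast
  qed auto
  then have "\<Union>(elts ` elts (vset (dbl ` elts (vnat n)))) = vnat ` {..<2 * n}"
    unfolding eq by (simp add: image_image flip: image_UN)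
  then show ?case
    unfolding dbl_def vrec.simps[of _ "vnat n"]
    by (simp add: dbl_def[symmetric] vset_vnat_lessThan succ2_vnat del: vnat_elts)
qed

lemma power2_diff: "2 * (2 ^ (n + 1) - 2) + 2 = (2 ^ (n + 2) - 2 :: nat)"
proof -
  have "2 * (p - 2) + 2 = 2 * p - 2" if "2 \<le> p" for p :: nat using that by arith
  from this[of "2 ^ (n + 1)"] show ?thesis by simp
qed

lemma intv_vnat: "intv (vnat n) = vnat (2 ^ (n + 1) - 2)"
proof (induction n rule: less_induct)
  case (less n)
  define b :: "nat \<Rightarrow> nat" where "b m = 2 ^ (m + 1) - 2" for m
  have b: "2 * b m + 2 = b (Suc m)" for m
    using power2_diff[of m] by (simp add: b_def)
  have bm: "b m \<le> b n" if "m \<le> n" for m n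
    using that by (auto simp: b_def intro!: diff_le_mono power_increasing)
  have "intv ` elts (vnat n) = (\<lambda>m. vnat (b m)) ` {..<n}"
    using less by (auto simp: image_image b_def)
  then have "elts (vset (intv ` elts (vnat n))) = (\<lambda>m. vnat (b m)) ` {..<n}" by simp
  then have "dbl ` elts (vset (intv ` elts (vnat n))) = (\<lambda>m. vnat (b (Suc m))) ` {..<n}"
    by (simp add: image_image dbl_vnat b[simplified])
  then have eq: "elts (vset (dbl ` elts (vset (intv ` elts (vnat n))))) = (\<lambda>m. vnat (b (Suc m))) ` {..<n}" by simp
  have "(\<Union>m<n. {..<b (Suc m)}) = {..<b n}"
  proof (intro equalityI subsetI)
    fix k assume k: "k \<in> {..<b n}"
    then have "n \<noteq> 0" by (cases n) (auto simp: b_def)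
    then obtain m where "n = Suc m" using not0_implies_Suc by blast
    then show "k \<in> (\<Union>m<n. {..<b (Suc m)})" using k by blast
  next
    fix k assume "k \<in> (\<Union>m<n. {..<b (Suc m)})"
    then obtain m where "m < n" "k < b (Suc m)" by auto
    then show "k \<in> {..<b n}" using bm[of "Suc m" n] by simp
  qed
  then have "\<Union>(elts ` elts (vset (dbl ` elts (vset (intv ` elts (vnat n)))))) = vnat ` {..<b n}"
    unfolding eq by (simp add: image_image flip: image_UN)
  then show ?case
    unfolding intv_def vrec.simps[of _ "vnat n"]
    by (simp add: intv_def[symmetric] vset_vnat_lessThan b_def del: vnat_elts)
qed

text \<open>As a set of von Neumann numbers, an interval is the difference of its endpoints, and
  \<open>dbl\<close> takes the left endpoint \<open>2 ^ (n + 1) - 2\<close> to the right one. Hence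
  the sequence of intervals is the image of omega under a definable term.\<close>

lemma elts_vintervals:
  shows "vintervals \<in> M"
    and "elts (vintervals :: 'v) = range (\<lambda>n. vpair (vnat n) (vset (vnat ` interval n)))"
proof -
  define g where "g x = vpair x (vset (elts (dbl (intv x)) - elts (intv x)))" for x
  have "dterm M (\<lambda>e. g (e 0))" unfolding g_def by (intro dfn dterm_dbl dterm_intv)
  then have "isset (g ` range vnat)" by (intro replacement_image isset_omega)
  moreover have "g (vnat n) = vpair (vnat n) (vset (vnat ` interval n))" for n
  proof -
    have "dbl (intv (vnat n)) = vnat (2 ^ (n + 2) - 2)"
      by (simp only: intv_vnat dbl_vnat power2_diff)
    then have "elts (dbl (intv (vnat n))) - elts (intv (vnat n)) = vnat ` {..<2 ^ (n + 2) - 2} - vnat ` {..<2 ^ (n + 1) - 2}"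
      by (simp only: intv_vnat vnat_elts)
    also have "\<dots> = vnat ` ({..<2 ^ (n + 2) - 2} - {..<2 ^ (n + 1) - 2})"
      by (simp only: image_set_diff[OF inj_vnat])
    also have "{..<2 ^ (n + 2) - 2} - {..<2 ^ (n + 1) - 2} = interval n"
      unfolding interval_def by auto
    finally show ?thesis unfolding g_def by simp
  qed
  ultimately have "isset (range (\<lambda>n. vpair (vnat n) (vset (vnat ` interval n) :: 'v)))"
    by (simp add: image_image)
  from isset_vset[OF this] show "vintervals \<in> M"
    "elts (vintervals :: 'v) = range (\<lambda>n. vpair (vnat n) (vset (vnat ` interval n)))"
    by (simp_all add: vintervals_def)
qed

end

section \<open>The forcing relation\<close>

text \<open>With Kuratowski pairs, \<open>c\<close> lies three membership steps below
  \<open>a\<close>, so the induction uses the transitive closure.\<close>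

lemma name_induct:
  assumes "\<And>a. (\<And>c s. vpair c s \<in> elts a \<Longrightarrow> R c) \<Longrightarrow> R a"
  shows "R (a :: 'v::set_universe)"
proof -
  have "wf ({(x, y). x \<in> elts (y::'v)}\<^sup>+)" by (rule wf_trancl[OF elts_wf])
  then show ?thesis
  proof (induction a rule: wf_induct_rule)
    case (less a)
    show ?case
    proof (rule assms)
      fix c s assume "vpair c s \<in> elts a"
      moreover have "vset {c} \<in> elts (vpair c s)" "c \<in> elts (vset {c})" by (simp_all add: elts_vpair)
      ultimately have "(c, a) \<in> {(x, y). x \<in> elts (y::'v)}\<^sup>+"
        by (meson CollectI case_prodI trancl.intros)
      then show "R c" by (rule less)
    qed
  qed
qed

lemma check_name_cong: "top_cond P = top_cond Q \<Longrightarrow> check_name P x = check_name Q x"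
proof (induction x rule: elts_induct)
  case (1 x)
  then have "(\<lambda>y. vpair (check_name P y) (top_cond P)) ` elts x = (\<lambda>y. vpair (check_name Q y) (top_cond Q)) ` elts x"
    by (auto simp: image_iff)
  then show ?case by (simp add: check_name.simps[of _ x])
qed

text \<open>Reflexivity and transitivity are assumed for arbitrary sets, as inclusion satisfies
  them, so that monotonicity needs no side conditions about membership in
  \<open>conds P\<close>.\<close>

locale forcing = zfc_model M for M :: "'v::set_universe set" +
  fixes P :: "'v poset"
  assumes conds_sub: "conds P \<subseteq> M"
    and below_refl [simp]: "\<And>p. below P p p"
    and below_trans [trans]: "\<And>p q r. below P p q \<Longrightarrow> below P q r \<Longrightarrow> below P p r"
    and top_in [simp]: "top_cond P \<in> conds P"
    and below_top [simp]: "\<And>p. p \<in> conds P \<Longrightarrow> below P p (top_cond P)"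
begin

section \<open>Laws of forced membership and equality\<close>

abbreviation dense_below :: "'v \<Rightarrow> ('v \<Rightarrow> bool) \<Rightarrow> bool" where
  "dense_below p R \<equiv> (\<forall>q\<in>conds P. below P q p \<longrightarrow> (\<exists>r\<in>conds P. below P r q \<and> R r))"

lemma dense_belowD:
  assumes "dense_below p R" "p \<in> conds P"
  obtains r where "r \<in> conds P" "below P r p" "R r"
  using assms below_refl by blast

lemma mem_iff: "forces_mem P p a b \<longleftrightarrow>
    dense_below p (\<lambda>r. \<exists>c s. vpair c s \<in> elts b \<and> below P r s \<and> forces_eq P r a c)"
  by (subst forces_mem.simps) blast

lemma eq_iff: "forces_eq P p a b \<longleftrightarrow>
    (\<forall>c s. vpair c s \<in> elts a \<longrightarrow> (\<forall>q\<in>conds P. below P q p \<and> below P q s \<longrightarrow> forces_mem P q c b)) \<and>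
    (\<forall>c s. vpair c s \<in> elts b \<longrightarrow> (\<forall>q\<in>conds P. below P q p \<and> below P q s \<longrightarrow> forces_mem P q c a))"
  by (subst forces_eq.simps) blast

lemma eq_memD: "forces_eq P p a b \<Longrightarrow> vpair c s \<in> elts a \<Longrightarrow> q \<in> conds P \<Longrightarrow> below P q p \<Longrightarrow>
    below P q s \<Longrightarrow> forces_mem P q c b"
  using eq_iff[of p a b] by blast

lemma mem_mono: "forces_mem P p a b \<Longrightarrow> below P q p \<Longrightarrow> forces_mem P q a b"
  unfolding mem_iff using below_trans by blast

lemma eq_mono: "forces_eq P p a b \<Longrightarrow> below P q p \<Longrightarrow> forces_eq P q a b"
  unfolding eq_iff using below_trans by blast

lemma mem_dense: "dense_below p (\<lambda>r. forces_mem P r a b) \<Longrightarrow> forces_mem P p a b"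
  unfolding mem_iff by (meson below_refl below_trans)

lemma eq_sym: "forces_eq P p a b \<Longrightarrow> forces_eq P p b a"
  unfolding eq_iff by blast

lemma eq_dense: "dense_below p (\<lambda>r. forces_eq P r a b) \<Longrightarrow> forces_eq P p a b"
proof -
  have *: "forces_mem P q c b"
    if d: "dense_below p (\<lambda>r. forces_eq P r a b)" and c: "vpair c s \<in> elts a"
      and q: "q \<in> conds P" "below P q p" "below P q s" for a b c s q
  proof (rule mem_dense, intro ballI impI)
    fix q' assume q': "q' \<in> conds P" "below P q' q"
    then have "below P q' p" using q below_trans by blast
    then obtain r where r: "r \<in> conds P" "below P r q'" "forces_eq P r a b"
      using d q'(1) by blast
    have "below P r s" using r(2) q'(2) q(3) below_trans by blast
    then have "forces_mem P r c b"
      by (rule eq_memD[OF r(3) c r(1) below_refl])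
    then show "\<exists>r\<in>conds P. below P r q' \<and> forces_mem P r c b" using r by blast
  qed
  assume d: "dense_below p (\<lambda>r. forces_eq P r a b)"
  then have d': "dense_below p (\<lambda>r. forces_eq P r b a)" using eq_sym by blast
  show ?thesis unfolding eq_iff using *[OF d] *[OF d'] by blast
qed

lemma mem_of_elt: "vpair c s \<in> elts a \<Longrightarrow> below P q s \<Longrightarrow> forces_eq P q d c \<Longrightarrow> forces_mem P q d a"
  unfolding mem_iff using below_trans eq_mono by (meson below_refl)

lemma not_memD:
  assumes "\<not> forces_mem P p a b"
  obtains q where "q \<in> conds P" "below P q p" "\<And>r. r \<in> conds P \<Longrightarrow> below P r q \<Longrightarrow> \<not> forces_mem P r a b"
  using mem_dense[of p a b] assms by blast

lemma eq_refl [simp]: "forces_eq P p a a"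
proof (induction a arbitrary: p rule: name_induct)
  case (1 a)
  then show ?case unfolding eq_iff[of p] using mem_of_elt by blast
qed

text \<open>The induction is on \<open>a\<close> alone. In the second half the chain starts at an
  element of \<open>c\<close> and ends at an element of \<open>a\<close>; symmetry reverses it so
  that the induction hypothesis applies there too.\<close>

lemma eq_trans: "forces_eq P p a b \<Longrightarrow> forces_eq P p b c \<Longrightarrow> forces_eq P p a c"
proof (induction a arbitrary: p b c rule: name_induct)
  case (1 a)
  have step: "\<exists>r\<in>conds P. below P r q \<and> (\<exists>d s f s'. vpair d s \<in> elts v \<and> vpair f s' \<in> elts w \<and> below P r s' \<and>
      forces_eq P r u d \<and> forces_eq P r d f)"
    if that': "forces_mem P q0 u v" "forces_eq P q0 v w" "q \<in> conds P" "below P q q0" for q q0 u v w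
  proof -
    obtain r d s where r: "r \<in> conds P" "below P r q" "vpair d s \<in> elts v" "below P r s" "forces_eq P r u d"
      using that'(1)[unfolded mem_iff, rule_format, OF that'(3,4)] by blast
    have rq0: "below P r q0" using r(2) that(4) below_trans by blast
    have "forces_mem P r d w" by (rule eq_memD[OF that(2) r(3) r(1) rq0 r(4)])
    from this[unfolded mem_iff, rule_format, OF r(1) below_refl]
    obtain r' f s' where r': "r' \<in> conds P" "below P r' r" "vpair f s' \<in> elts w" "below P r' s'" "forces_eq P r' d f"
      by blast
    have "below P r' q" "forces_eq P r' u d" using r' r below_trans eq_mono by blast+
    then show ?thesis using r r' by blast
  qed
  show ?case
    unfolding eq_iff[of p a c]
  proof (intro conjI allI impI ballI)
    fix x s q assume x: "vpair x s \<in> elts a" and q: "q \<in> conds P" "below P q p \<and> below P q s"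
    have m: "forces_mem P q x b" using eq_memD[OF 1(2) x q(1)] q(2) by blast
    have e: "forces_eq P q b c" using eq_mono[OF 1(3)] q(2) by blast
    show "forces_mem P q x c" unfolding mem_iff
    proof (intro ballI impI)
      fix q' assume "q' \<in> conds P" "below P q' q"
      from step[OF m e this] obtain r d s f s' where r: "r \<in> conds P" "below P r q'"
        "vpair f s' \<in> elts c" "below P r s'" "forces_eq P r x d" "forces_eq P r d f" by blast
      then have "forces_eq P r x f" using 1(1)[OF x] by blast
      with r show "\<exists>r\<in>conds P. below P r q' \<and> (\<exists>y s. vpair y s \<in> elts c \<and> below P r s \<and> forces_eq P r x y)" by blast
    qed
  next
    fix x s q assume x: "vpair x s \<in> elts c" and q: "q \<in> conds P" "below P q p \<and> below P q s"
    have m: "forces_mem P q x b" using eq_memD[OF eq_sym[OF 1(3)] x q(1)] q(2) by blast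
    have e: "forces_eq P q b a" using eq_mono[OF eq_sym[OF 1(2)]] q(2) by blast
    show "forces_mem P q x a" unfolding mem_iff
    proof (intro ballI impI)
      fix q' assume "q' \<in> conds P" "below P q' q"
      from step[OF m e this] obtain r d s f s' where r: "r \<in> conds P" "below P r q'"
        "vpair f s' \<in> elts a" "below P r s'" "forces_eq P r x d" "forces_eq P r d f" by blast
      then have "forces_eq P r f x" using 1(1)[OF r(3)] eq_sym by blast
      with r eq_sym show "\<exists>r\<in>conds P. below P r q' \<and> (\<exists>y s. vpair y s \<in> elts a \<and> below P r s \<and> forces_eq P r x y)" by blast
    qed
  qed
qed

lemma mem_eq_left: "forces_eq P p a b \<Longrightarrow> forces_mem P p a c \<Longrightarrow> forces_mem P p b c"
  unfolding mem_iff by (meson below_trans eq_mono eq_sym eq_trans)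

lemma mem_eq_right:
  assumes "forces_eq P p b c" "forces_mem P p a b"
  shows "forces_mem P p a c"
proof (rule mem_dense, intro ballI impI)
  fix q assume q: "q \<in> conds P" "below P q p"
  obtain r d s where r: "r \<in> conds P" "below P r q" "vpair d s \<in> elts b" "below P r s" "forces_eq P r a d"
    using assms(2) q unfolding mem_iff by blast
  have "below P r p" using r q below_trans by blast
  from eq_memD[OF assms(1) r(3,1) this r(4)] have "forces_mem P r a c"
    using mem_eq_left[OF eq_sym[OF r(5)]] by blast
  then show "\<exists>r\<in>conds P. below P r q \<and> forces_mem P r a c" using r by blast
qed

section \<open>Monotonicity, density and derived connectives\<close>

lemma forces_mono: "forces M P p \<phi> e \<Longrightarrow> below P q p \<Longrightarrow> forces M P q \<phi> e"
proof (induction \<phi> arbitrary: e)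
  case (Neg \<phi>)
  then show ?case using below_trans by auto
qed (auto intro: mem_mono eq_mono)

lemma forces_dense: "dense_below p (\<lambda>r. forces M P r \<phi> e) \<Longrightarrow> forces M P p \<phi> e"
proof (induction \<phi> arbitrary: e)
  case (Neg \<phi>)
  show ?case unfolding forces.simps
  proof (intro ballI impI notI)
    fix q assume q: "q \<in> conds P" "below P q p" "forces M P q \<phi> e"
    then obtain r where "r \<in> conds P" "below P r q" "forces M P r (Neg \<phi>) e" using Neg.prems by blast
    then show False using forces_mono[OF q(3)] by auto
  qed
next
  case (Conj \<phi> \<psi>)
  have "dense_below p (\<lambda>r. forces M P r \<phi> e)" "dense_below p (\<lambda>r. forces M P r \<psi> e)"
    using Conj.prems by auto
  then show ?case using Conj.IH by simp
next
  case (All x \<phi>)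
  have "dense_below p (\<lambda>r. forces M P r \<phi> (e(x := a)))" if "a \<in> names M P" for a
    using All.prems that by (simp; blast)
  with All.IH show ?case unfolding forces.simps by blast
qed (auto intro: mem_dense eq_dense)

lemma not_forcesD:
  assumes "\<not> forces M P p \<phi> e"
  obtains q where "q \<in> conds P" "below P q p" "forces M P q (Neg \<phi>) e"
  using forces_dense[of p \<phi> e] assms by auto

lemma forces_Imp: "forces M P p (Imp \<phi> \<psi>) e \<longleftrightarrow>
    (\<forall>q\<in>conds P. below P q p \<longrightarrow> forces M P q \<phi> e \<longrightarrow> forces M P q \<psi> e)"
  unfolding Imp_def forces.simps by (meson below_refl below_trans forces_mono not_forcesD forces.simps(3))

lemma forces_Iff: "forces M P p (Iff \<phi> \<psi>) e \<longleftrightarrow>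
    (\<forall>q\<in>conds P. below P q p \<longrightarrow> (forces M P q \<phi> e \<longleftrightarrow> forces M P q \<psi> e))"
  unfolding Iff_def by (auto simp: forces_Imp)

lemma forces_Disj: "forces M P p (Disj \<phi> \<psi>) e \<longleftrightarrow> dense_below p (\<lambda>r. forces M P r \<phi> e \<or> forces M P r \<psi> e)"
  unfolding Disj_def forces.simps by blast

lemma forces_Ex: "forces M P p (Ex x \<phi>) e \<longleftrightarrow>
    dense_below p (\<lambda>r. \<exists>a\<in>names M P. forces M P r \<phi> (e(x := a)))"
  unfolding Ex_def forces.simps by blast

lemma forces_AllIn: "x \<noteq> y \<Longrightarrow> forces M P p (AllIn x y \<phi>) e \<longleftrightarrow>
    (\<forall>a\<in>names M P. \<forall>q\<in>conds P. below P q p \<longrightarrow> forces_mem P q a (e y) \<longrightarrow> forces M P q \<phi> (e(x := a)))"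
  by (simp add: AllIn_def forces_Imp)

lemma forces_ExIn: "x \<noteq> y \<Longrightarrow> forces M P p (ExIn x y \<phi>) e \<longleftrightarrow>
    dense_below p (\<lambda>r. \<exists>a\<in>names M P. forces_mem P r a (e y) \<and> forces M P r \<phi> (e(x := a)))"
  by (simp add: ExIn_def forces_Ex)

lemmas forces_simps = forces_Imp forces_Iff forces_Disj forces_Ex forces_AllIn forces_ExIn

section \<open>Names for pairs and for elements of the model\<close>

lemma conds_in: "p \<in> conds P \<Longrightarrow> p \<in> M"
  using conds_sub by blast

lemma names_in: "x \<in> names M P \<Longrightarrow> x \<in> M"
  by (erule names.cases) simp

lemma names_elts:
  "x \<in> names M P \<Longrightarrow> e \<in> elts x \<Longrightarrow> \<exists>c s. e = vpair c s \<and> c \<in> names M P \<and> s \<in> conds P"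
  by (erule names.cases) blast

lemma names_vpair:
  "x \<in> names M P \<Longrightarrow> vpair c s \<in> elts x \<Longrightarrow> c \<in> names M P \<and> s \<in> conds P"
  using names_elts by fastforce

text \<open>The right-hand side has the shape that \<open>All\<close> and \<open>Iff\<close> take
  under forcing; \<open>pair_fm\<close> is evaluated by recognizing it.\<close>

lemma eq_ext:
  assumes "a \<in> names M P" "b \<in> names M P"
  shows "forces_eq P p a b \<longleftrightarrow>
    (\<forall>u\<in>names M P. \<forall>q\<in>conds P. below P q p \<longrightarrow> (forces_mem P q u a \<longleftrightarrow> forces_mem P q u b))"
proof
  assume "forces_eq P p a b"
  then show "\<forall>u\<in>names M P. \<forall>q\<in>conds P. below P q p \<longrightarrow> (forces_mem P q u a \<longleftrightarrow> forces_mem P q u b)"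
    using eq_mono eq_sym mem_eq_right by blast
next
  assume R: "\<forall>u\<in>names M P. \<forall>q\<in>conds P. below P q p \<longrightarrow> (forces_mem P q u a \<longleftrightarrow> forces_mem P q u b)"
  then show "forces_eq P p a b"
    unfolding eq_iff using assms mem_of_elt[OF _ _ eq_refl] names_vpair by meson
qed

text \<open>With \<open>opn\<close> below, these are the standard names for the unordered pair and
  the Kuratowski pair of two named objects.\<close>

definition upn :: "'v \<Rightarrow> 'v \<Rightarrow> 'v" where
  "upn x y = vset {vpair x (top_cond P), vpair y (top_cond P)}"

definition opn :: "'v \<Rightarrow> 'v \<Rightarrow> 'v" where
  "opn x y = upn (upn x x) (upn x y)"

lemma upn_name [simp, intro]: "x \<in> names M P \<Longrightarrow> y \<in> names M P \<Longrightarrow> upn x y \<in> names M P"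
proof (rule names.intros)
  assume xy: "x \<in> names M P" "y \<in> names M P"
  show "upn x y \<in> M"
    unfolding upn_def using xy names_in conds_in[OF top_in] by (intro vset_finite_in) auto
  show "\<forall>e\<in>elts (upn x y). \<exists>\<sigma> p. \<sigma> \<in> names M P \<and> p \<in> conds P \<and> e = vpair \<sigma> p"
    using xy by (auto simp: upn_def)
qed

lemma opn_name [simp, intro]: "x \<in> names M P \<Longrightarrow> y \<in> names M P \<Longrightarrow> opn x y \<in> names M P"
  by (simp add: opn_def)

lemma mem_upn: "forces_mem P q u (upn x y) \<longleftrightarrow> dense_below q (\<lambda>r. forces_eq P r u x \<or> forces_eq P r u y)"
proof -
  have "(\<exists>c s. vpair c s \<in> elts (upn x y) \<and> below P r s \<and> forces_eq P r u c) \<longleftrightarrow> forces_eq P r u x \<or> forces_eq P r u y"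
    if "r \<in> conds P" for r
    using below_top[OF that] by (auto simp: upn_def)
  then show ?thesis unfolding mem_iff by blast
qed

lemma mem_singleton: "forces_mem P q u (upn x x) \<longleftrightarrow> forces_eq P q u x"
  unfolding mem_upn using eq_dense eq_mono below_refl by (metis (no_types, lifting))

lemma upn_cong:
  assumes "x \<in> names M P" "y \<in> names M P" "x' \<in> names M P" "y' \<in> names M P"
    "forces_eq P p x x'" "forces_eq P p y y'"
  shows "forces_eq P p (upn x y) (upn x' y')"
proof -
  have "forces_eq P q u x \<longleftrightarrow> forces_eq P q u x'" "forces_eq P q u y \<longleftrightarrow> forces_eq P q u y'"
    if "below P q p" for q u
    using eq_mono[OF assms(5) that] eq_mono[OF assms(6) that] eq_trans eq_sym by blast+
  then show ?thesis
    unfolding eq_ext[OF upn_name[OF assms(1,2)] upn_name[OF assms(3,4)]] mem_upn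
    using below_trans by (smt (verit, best))
qed

lemma opn_cong:
  assumes "x \<in> names M P" "y \<in> names M P" "x' \<in> names M P" "y' \<in> names M P"
    "forces_eq P p x x'" "forces_eq P p y y'"
  shows "forces_eq P p (opn x y) (opn x' y')"
  unfolding opn_def by (intro upn_cong upn_name assms)

text \<open>This is the usual argument on a dense set: some extension decides which member of the
  second pair equals the singleton of \<open>x\<close>, and both members contain
  \<open>x'\<close>.\<close>

lemma opn_fst:
  assumes eq: "forces_eq P p (opn x y) (opn x' y')"
  shows "forces_eq P p x x'"
proof (rule eq_dense, intro ballI impI)
  fix q assume q: "q \<in> conds P" "below P q p"
  have "forces_mem P q (upn x x) (opn x y)" unfolding opn_def mem_upn using eq_refl below_refl by blast
  then have "forces_mem P q (upn x x) (opn x' y')" using mem_eq_right[OF eq_mono[OF eq q(2)]] by blast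
  then obtain r where r: "r \<in> conds P" "below P r q"
    "forces_eq P r (upn x x) (upn x' x') \<or> forces_eq P r (upn x x) (upn x' y')"
    unfolding opn_def mem_upn using q by (auto elim: dense_belowD)
  have "forces_mem P r x' (upn x' y')" for y' unfolding mem_upn using eq_refl below_refl by blast
  then have "forces_mem P r x' (upn x x)" using r(3) mem_eq_right eq_sym by blast
  then have "forces_eq P r x x'" using eq_sym mem_singleton by blast
  then show "\<exists>r\<in>conds P. below P r q \<and> forces_eq P r x x'" using r by blast
qed

text \<open>On a dense set \<open>y'\<close> is \<open>x\<close> or \<open>y\<close>, and
  \<open>y\<close> is \<open>x'\<close> or \<open>y'\<close>. Since \<open>x\<close> and
  \<open>x'\<close> are forced equal, every combination gives equality of \<open>y\<close> and
  \<open>y'\<close>.\<close>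

lemma opn_snd:
  assumes eq: "forces_eq P p (opn x y) (opn x' y')"
  shows "forces_eq P p y y'"
proof -
  have *: "dense_below p (\<lambda>r. forces_eq P r b' a \<or> forces_eq P r b' b)"
    if eq: "forces_eq P p (opn a b) (opn a' b')" for p a b a' b'
  proof (intro ballI impI)
    fix q assume q: "q \<in> conds P" "below P q p"
    have "forces_mem P q (upn a' b') (opn a' b')" unfolding opn_def mem_upn using eq_refl below_refl by blast
    then have "forces_mem P q (upn a' b') (opn a b)" using mem_eq_right[OF eq_sym[OF eq_mono[OF eq q(2)]]] by blast
    then obtain r where r: "r \<in> conds P" "below P r q"
      "forces_eq P r (upn a' b') (upn a a) \<or> forces_eq P r (upn a' b') (upn a b)"
      unfolding opn_def mem_upn using q by (auto elim: dense_belowD)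
    have "forces_mem P r b' (upn a' b')" unfolding mem_upn using eq_refl below_refl by blast
    then have "forces_mem P r b' (upn a a) \<or> forces_mem P r b' (upn a b)" using r(3) mem_eq_right by blast
    then obtain s where "s \<in> conds P" "below P s r" "forces_eq P s b' a \<or> forces_eq P s b' b"
      unfolding mem_upn using r(1) by (auto elim: dense_belowD)
    then show "\<exists>r\<in>conds P. below P r q \<and> (forces_eq P r b' a \<or> forces_eq P r b' b)"
      using r(2) below_trans by blast
  qed
  show ?thesis
  proof (rule eq_dense, intro ballI impI)
    fix q assume q: "q \<in> conds P" "below P q p"
    obtain r where r: "r \<in> conds P" "below P r q" "forces_eq P r y' x \<or> forces_eq P r y' y"
      using *[OF eq] q by blast
    then have rp: "below P r p" using q below_trans by blast
    obtain s where s: "s \<in> conds P" "below P s r" "forces_eq P s y x' \<or> forces_eq P s y y'"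
      using *[OF eq_sym[OF eq]] r(1) rp by blast
    have "forces_eq P s x x'" using opn_fst[OF eq] rp s(2) eq_mono by blast
    moreover have "forces_eq P s y' x \<or> forces_eq P s y' y" using r(3) s(2) eq_mono by blast
    ultimately have "forces_eq P s y y'" using s(3) eq_trans eq_sym by blast
    moreover have "below P s q" using s(2) r(2) below_trans by blast
    ultimately show "\<exists>r\<in>conds P. below P r q \<and> forces_eq P r y y'" using s(1) by blast
  qed
qed

text \<open>The formulas for functions, agreement and \<open>pitchfork_fm\<close> speak of pairs
  only through \<open>pair_fm\<close>, so this reduces their evaluation to unfolding the forcing
  clauses.\<close>

lemma forces_pair_fm:
  assumes "e x \<in> names M P" "e y \<in> names M P" "e z \<in> names M P"
  shows "forces M P p (pair_fm z x y) e \<longleftrightarrow> forces_eq P p (e z) (opn (e x) (e y))"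
proof -
  define u where "u = x + y + z + 1"
  have ne: "u \<noteq> x" "u \<noteq> y" "u \<noteq> z" "Suc u \<noteq> x" "Suc u \<noteq> y" "Suc u \<noteq> z" "Suc u \<noteq> u"
    by (simp_all add: u_def)
  have s: "(\<forall>b\<in>names M P. \<forall>q\<in>conds P. below P q r \<longrightarrow> forces_mem P q b a \<longleftrightarrow> forces_eq P q b (e x)) \<longleftrightarrow>
      forces_eq P r a (upn (e x) (e x))" if "a \<in> names M P" for a r
    by (simp only: eq_ext[OF that upn_name[OF assms(1,1)]] mem_singleton)
  have d: "(\<forall>b\<in>names M P. \<forall>q\<in>conds P. below P q r \<longrightarrow> forces_mem P q b a \<longleftrightarrow>
      dense_below q (\<lambda>r. forces_eq P r b (e x) \<or> forces_eq P r b (e y))) \<longleftrightarrow>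
      forces_eq P r a (upn (e x) (e y))" if "a \<in> names M P" for a r
    by (simp only: eq_ext[OF that upn_name[OF assms(1,2)]] mem_upn)
  have "forces M P p (pair_fm z x y) e \<longleftrightarrow>
    (\<forall>a\<in>names M P. \<forall>q\<in>conds P. below P q p \<longrightarrow> forces_mem P q a (e z) \<longleftrightarrow>
      dense_below q (\<lambda>r. forces_eq P r a (upn (e x) (e x)) \<or> forces_eq P r a (upn (e x) (e y))))"
    unfolding pair_fm_def Let_def u_def[symmetric] using ne
    by (simp add: forces_simps s d cong: ball_cong)
  also have "\<dots> \<longleftrightarrow> forces_eq P p (e z) (opn (e x) (e y))"
    unfolding eq_ext[OF assms(3) opn_name[OF assms(1,2)]] by (simp only: opn_def mem_upn)
  finally show ?thesis .
qed

lemma check_in_M: "x \<in> M \<Longrightarrow> check_name P x \<in> M"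
  by (rule check_name_in(1)) (use conds_in[OF top_in] in auto)

lemma elts_check: "x \<in> M \<Longrightarrow> elts (check_name P x) = (\<lambda>y. vpair (check_name P y) (top_cond P)) ` elts x"
  by (rule check_name_in(2)) (use conds_in[OF top_in] in auto)

lemma check_name_name [simp, intro]: "x \<in> M \<Longrightarrow> check_name P x \<in> names M P"
proof (induction x rule: elts_induct)
  case (1 x)
  show ?case
    by (rule names.intros) (use 1 elts_check check_in_M in auto)
qed

lemma check_vpair:
  assumes "a \<in> M" "b \<in> M"
  shows "check_name P (vpair a b) = opn (check_name P a) (check_name P b)"
proof -
  have up: "check_name P (vset {a, b}) = upn (check_name P a) (check_name P b)" if "a \<in> M" "b \<in> M" for a b
  proof -
    have "vset {a, b} \<in> M" using that by (simp add: vset_finite_in)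
    from elts_check[OF this] show ?thesis unfolding upn_def by (intro vset_eqI[symmetric]) auto
  qed
  have "vset {a} \<in> M" "vset {a, b} \<in> M" using assms by (simp_all add: vset_finite_in)
  then show ?thesis unfolding vpair_def opn_def using up[of a a] up[of a b] up assms by simp
qed

lemma mem_check: "x \<in> M \<Longrightarrow> forces_mem P p u (check_name P x) \<longleftrightarrow>
    dense_below p (\<lambda>r. \<exists>y\<in>elts x. forces_eq P r u (check_name P y))"
proof -
  assume x: "x \<in> M"
  have "(\<exists>c s. vpair c s \<in> elts (check_name P x) \<and> below P r s \<and> forces_eq P r u c) \<longleftrightarrow>
    (\<exists>y\<in>elts x. forces_eq P r u (check_name P y))" if "r \<in> conds P" for r
    using below_top[OF that] unfolding elts_check[OF x] by (auto simp: image_iff)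
  then show ?thesis unfolding mem_iff by blast
qed

text \<open>An element of one side is, by some extension, decided to equal a particular element of
  the other; the induction hypothesis turns this forced equality into a true one.\<close>

lemma check_eqD:
  "p \<in> conds P \<Longrightarrow> a \<in> M \<Longrightarrow> b \<in> M \<Longrightarrow> forces_eq P p (check_name P a) (check_name P b) \<Longrightarrow> a = b"
proof (induction a arbitrary: b p rule: elts_induct)
  case (1 a)
  have mem: "forces_mem P p (check_name P c) (check_name P a)" if "c \<in> elts a" "a \<in> M" for a c
    using that unfolding mem_check[OF that(2)] using eq_refl below_refl by blast
  have "elts a = elts b"
  proof (intro equalityI subsetI)
    fix c assume c: "c \<in> elts a"
    then have "forces_mem P p (check_name P c) (check_name P b)"
      using mem[OF c 1(3)] mem_eq_right[OF 1(5)] by blast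
    then obtain r d where "r \<in> conds P" "d \<in> elts b" "forces_eq P r (check_name P c) (check_name P d)"
      unfolding mem_check[OF 1(4)] using 1(2) by (auto elim: dense_belowD)
    then show "c \<in> elts b" using 1(1)[OF c, of r d] 1(3,4) c by blast
  next
    fix d assume d: "d \<in> elts b"
    then have "forces_mem P p (check_name P d) (check_name P a)"
      using mem[OF d 1(4)] mem_eq_right[OF eq_sym[OF 1(5)]] by blast
    then obtain r c where "r \<in> conds P" "c \<in> elts a" "forces_eq P r (check_name P d) (check_name P c)"
      unfolding mem_check[OF 1(3)] using 1(2) by (auto elim: dense_belowD)
    then show "d \<in> elts a" using 1(1)[of c r d] 1(3,4) d eq_sym by blast
  qed
  then show ?case by (rule elts_inject)
qed

section \<open>Names for reals and the forced relation between them\<close>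

lemma opn_check_fst:
  assumes "p \<in> conds P" "a \<in> M" "b \<in> M" "c \<in> M"
    "forces_eq P p (opn (check_name P a) y) (check_name P (vpair b c))"
  shows "a = b"
  using check_eqD[OF assms(1-3)] opn_fst assms(5) unfolding check_vpair[OF assms(3,4)] by blast

text \<open>Beyond \<open>h\<close> being a name, these three facts are all that is later used of
  \<open>name_for_real\<close>. The bits are numbers below 2 because they arise as elements of
  \<open>vnat 2\<close>.\<close>

lemma forced_real:
  assumes h: "name_for_real M P h"
  shows real_elt: "\<And>p \<tau>. p \<in> conds P \<Longrightarrow> \<tau> \<in> names M P \<Longrightarrow> forces_mem P p \<tau> h \<Longrightarrow>
      \<exists>q\<in>conds P. below P q p \<and> (\<exists>n. \<exists>b<2. forces_eq P q \<tau> (check_name P (vpair (vnat n) (vnat b))))"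
    and real_total: "\<And>p n. p \<in> conds P \<Longrightarrow>
      \<exists>q\<in>conds P. below P q p \<and> (\<exists>b<2. forces_mem P q (check_name P (vpair (vnat n) (vnat b))) h)"
    and real_unique: "\<And>p n b b'. p \<in> conds P \<Longrightarrow>
      forces_mem P p (check_name P (vpair (vnat n) (vnat b))) h \<Longrightarrow>
      forces_mem P p (check_name P (vpair (vnat n) (vnat b'))) h \<Longrightarrow> b = b'"
proof -
  let ?w = "check_name P vomega" and ?two = "check_name P (vnat 2)"
  have hn: "h \<in> names M P" using h by (simp add: name_for_real_def)
  have 1: "\<exists>r\<in>conds P. below P r q \<and> (\<exists>x\<in>names M P. forces_mem P r x ?w \<and>
       dense_below r (\<lambda>r. \<exists>y\<in>names M P. forces_mem P r y ?two \<and> forces_eq P r \<tau> (opn x y)))"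
    if "p \<in> conds P" "\<tau> \<in> names M P" "q \<in> conds P" "below P q p" "forces_mem P q \<tau> h" for p q \<tau>
  proof -
    have "forces M P p (fun_fm 0 1 2) (nth [h, ?w, ?two])"
      using h that(1) by (auto simp: name_for_real_def forced_def)
    then show ?thesis using that
      by (fastforce simp: fun_fm_def Let_def forces_simps forces_pair_fm cong: ball_cong bex_cong conj_cong)
  qed
  \<comment> \<open>\<open>D x y' q\<close> says that \<open>q\<close> forces the pair of
    \<open>x\<close> and \<open>y'\<close> into \<open>h\<close>. That \<open>h\<close> is a
    function means that, for suitable \<open>r\<close> and \<open>y\<close>, this is the same below
    \<open>r\<close> as forcing \<open>y'\<close> to equal \<open>y\<close>.\<close>
  define D where "D x y' q \<longleftrightarrow> dense_below q (\<lambda>r. \<exists>\<tau>\<in>names M P. forces_mem P r \<tau> h \<and> forces_eq P r \<tau> (opn x y'))" for x y' q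
  have 2: "\<exists>r\<in>conds P. below P r p \<and> (\<exists>y\<in>names M P. \<forall>y'\<in>names M P. \<forall>q\<in>conds P. below P q r \<longrightarrow>
      D x y' q = forces_eq P q y' y)"
    if "p \<in> conds P" "x \<in> names M P" "forces_mem P p x ?w" for p x
  proof -
    have "forces M P p (fun_fm 0 1 2) (nth [h, ?w, ?two])"
      using h that(1) by (auto simp: name_for_real_def forced_def)
    then have "\<forall>x\<in>names M P. \<forall>q\<in>conds P. below P q p \<longrightarrow> forces_mem P q x ?w \<longrightarrow>
      dense_below q (\<lambda>r. \<exists>y\<in>names M P. \<forall>y'\<in>names M P. \<forall>q\<in>conds P. below P q r \<longrightarrow> D x y' q = forces_eq P q y' y)"
      unfolding D_def
      by (simp add: fun_fm_def Let_def forces_simps forces_pair_fm cong: ball_cong bex_cong conj_cong)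
    from bspec[OF bspec[OF this that(2)] that(1)] show ?thesis using that(1,3) by auto
  qed
  show elt: "\<exists>q\<in>conds P. below P q p \<and> (\<exists>n. \<exists>b<2. forces_eq P q \<tau> (check_name P (vpair (vnat n) (vnat b))))"
    if p: "p \<in> conds P" "\<tau> \<in> names M P" "forces_mem P p \<tau> h" for p \<tau>
  proof -
    obtain q x where q: "q \<in> conds P" "below P q p" "x \<in> names M P" "forces_mem P q x ?w"
      "dense_below q (\<lambda>r. \<exists>y\<in>names M P. forces_mem P r y ?two \<and> forces_eq P r \<tau> (opn x y))"
      using 1[OF p(1,2,1) below_refl p(3)] by blast
    obtain r y where r: "r \<in> conds P" "below P r q" "y \<in> names M P" "forces_mem P r y ?two" "forces_eq P r \<tau> (opn x y)"
      using dense_belowD[OF q(5,1)] by blast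
    have "forces_mem P r x ?w" using q r mem_mono by blast
    then obtain s n where s: "s \<in> conds P" "below P s r" "forces_eq P s x (check_name P (vnat n))"
      unfolding mem_check[OF vomega_in] elts_vomega using r(1) by (auto elim: dense_belowD)
    have "forces_mem P s y ?two" using s r mem_mono by blast
    then obtain t b where t: "t \<in> conds P" "below P t s" "b < 2" "forces_eq P t y (check_name P (vnat b))"
      unfolding mem_check[OF vnat_in] vnat_elts using s(1) by (auto elim: dense_belowD)
    have "forces_eq P t (opn x y) (opn (check_name P (vnat n)) (check_name P (vnat b)))"
      using q r s t eq_mono by (intro opn_cong) auto
    then have "forces_eq P t \<tau> (check_name P (vpair (vnat n) (vnat b)))"
      using eq_mono[OF r(5)] s t eq_trans below_trans check_vpair by (metis vnat_in)
    moreover have "below P t p" using t(2) s(2) r(2) q(2) below_trans by blast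
    ultimately show ?thesis using t by blast
  qed
  have wn: "forces_mem P p (check_name P (vnat n)) ?w" for p n
    unfolding mem_check[OF vomega_in] elts_vomega using eq_refl below_refl by blast
  show "\<exists>q\<in>conds P. below P q p \<and> (\<exists>b<2. forces_mem P q (check_name P (vpair (vnat n) (vnat b))) h)"
    if p: "p \<in> conds P" for p n
  proof -
    obtain r y where r: "r \<in> conds P" "below P r p" "y \<in> names M P"
      and r4: "\<forall>y'\<in>names M P. \<forall>q\<in>conds P. below P q r \<longrightarrow> D (check_name P (vnat n)) y' q = forces_eq P q y' y"
      using 2[OF p check_name_name[OF vnat_in] wn, of n] by blast
    have "dense_below r (\<lambda>r. \<exists>\<tau>\<in>names M P. forces_mem P r \<tau> h \<and> forces_eq P r \<tau> (opn (check_name P (vnat n)) y))"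
      using r4 r(1,3) unfolding D_def by simp
    from this[rule_format, OF r(1) below_refl]
    obtain s \<tau> where s: "s \<in> conds P" "below P s r" "\<tau> \<in> names M P" "forces_mem P s \<tau> h"
      "forces_eq P s \<tau> (opn (check_name P (vnat n)) y)"
      by blast
    obtain t m b where t: "t \<in> conds P" "below P t s" "b < 2"
      "forces_eq P t \<tau> (check_name P (vpair (vnat m) (vnat b)))"
      using elt[OF s(1,3,4)] by blast
    have "forces_eq P t (opn (check_name P (vnat n)) y) (check_name P (vpair (vnat m) (vnat b)))"
      using eq_trans[OF eq_sym[OF eq_mono[OF s(5) t(2)]] t(4)] .
    then have "n = m" using opn_check_fst[OF t(1) vnat_in vnat_in vnat_in] by simp
    moreover have "forces_mem P t (check_name P (vpair (vnat m) (vnat b))) h"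
      using mem_eq_left[OF t(4) mem_mono[OF s(4) t(2)]] .
    moreover have "below P t p" using t(2) s(2) r(2) below_trans by blast
    ultimately show ?thesis using t by blast
  qed
  show "b = b'"
    if p: "p \<in> conds P" and b: "forces_mem P p (check_name P (vpair (vnat n) (vnat b))) h"
      "forces_mem P p (check_name P (vpair (vnat n) (vnat b'))) h" for p n b b'
  proof -
    obtain r y where r: "r \<in> conds P" "below P r p" "y \<in> names M P"
      and r4: "\<forall>y'\<in>names M P. \<forall>q\<in>conds P. below P q r \<longrightarrow> D (check_name P (vnat n)) y' q = forces_eq P q y' y"
      using 2[OF p check_name_name[OF vnat_in] wn, of n] by blast
    \<comment> \<open>Every bit forced to be the value at \<open>n\<close> is forced equal to the
      one name \<open>y\<close>, so any two such bits coincide.\<close>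
    have "forces_eq P r (check_name P (vnat c)) y"
      if c: "forces_mem P p (check_name P (vpair (vnat n) (vnat c))) h" for c
    proof -
      have n: "check_name P (vpair (vnat n) (vnat c)) \<in> names M P" by simp
      have "dense_below r (\<lambda>r. \<exists>\<tau>\<in>names M P. forces_mem P r \<tau> h \<and> forces_eq P r \<tau> (opn (check_name P (vnat n)) (check_name P (vnat c))))"
      proof (intro ballI impI)
        fix q assume q: "q \<in> conds P" "below P q r"
        have "forces_mem P q (check_name P (vpair (vnat n) (vnat c))) h"
          by (rule mem_mono[OF mem_mono[OF c r(2)] q(2)])
        moreover have "forces_eq P q (check_name P (vpair (vnat n) (vnat c))) (opn (check_name P (vnat n)) (check_name P (vnat c)))"
          by (simp add: check_vpair)
        ultimately show "\<exists>r\<in>conds P. below P r q \<and>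
            (\<exists>\<tau>\<in>names M P. forces_mem P r \<tau> h \<and> forces_eq P r \<tau> (opn (check_name P (vnat n)) (check_name P (vnat c))))"
          using q(1) n below_refl by blast
      qed
      then show ?thesis using r4 r(1) unfolding D_def by simp
    qed
    then have "forces_eq P r (check_name P (vnat b)) (check_name P (vnat b'))"
      using b eq_trans eq_sym by blast
    from check_eqD[OF r(1) vnat_in vnat_in this] show ?thesis by simp
  qed
qed

text \<open>All that can be decided is made explicit: the threshold becomes a number
  \<open>n\<close>, the name of the interval becomes \<open>interval k\<close>, and the position
  becomes some \<open>i\<close>. The second coordinate \<open>y\<close> stays a name, since
  \<open>agree_fm\<close> quantifies over arbitrary values. Disagreement means that one side is
  forced to contain the pair and no extension forces it into the other.\<close>

lemma forces_pitchfork: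
  assumes q: "q \<in> conds P" and c: "c \<in> names M P" and h: "h \<in> names M P"
    and f: "forces M P q (pitchfork_fm 0 1 2 3) (nth [c, h, check_name P vintervals, check_name P vomega])"
  obtains r n where "r \<in> conds P" "below P r q"
    "\<And>k p. n \<le> k \<Longrightarrow> p \<in> conds P \<Longrightarrow> below P p r \<Longrightarrow>
      \<exists>s\<in>conds P. below P s p \<and> (\<exists>i\<in>interval k. \<exists>y\<in>names M P.
        let \<tau> = opn (check_name P (vnat i)) y in
        forces_mem P s \<tau> c \<and> (\<forall>t\<in>conds P. below P t s \<longrightarrow> \<not> forces_mem P t \<tau> h) \<or>
        forces_mem P s \<tau> h \<and> (\<forall>t\<in>conds P. below P t s \<longrightarrow> \<not> forces_mem P t \<tau> c))"
proof -
  \<comment> \<open>\<open>agree\<close> and \<open>differ\<close> are the forcing translations of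
    \<open>agree_fm\<close> and of the statement that \<open>c\<close> and \<open>h\<close> do not
    agree on the \<open>k\<close>-th interval; naming them keeps the unfolded formula
    readable.\<close>
  define agree where "agree p j \<longleftrightarrow> (\<forall>x\<in>names M P. \<forall>q\<in>conds P. below P q p \<longrightarrow> forces_mem P q x j \<longrightarrow>
    (\<forall>y\<in>names M P. \<forall>\<tau>\<in>names M P. \<forall>q'\<in>conds P. below P q' q \<longrightarrow> forces_eq P q' \<tau> (opn x y) \<longrightarrow>
      (\<forall>r\<in>conds P. below P r q' \<longrightarrow> forces_mem P r \<tau> c = forces_mem P r \<tau> h)))" for p j
  define differ where "differ k r \<longleftrightarrow> (\<exists>j\<in>names M P. dense_below r (\<lambda>s. \<exists>\<pi>\<in>names M P.
      forces_mem P s \<pi> (check_name P vintervals) \<and> forces_eq P s \<pi> (opn k j)) \<and>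
    (\<forall>s\<in>conds P. below P s r \<longrightarrow> \<not> agree s j))" for k r
  obtain r m where r: "r \<in> conds P" "below P r q" "m \<in> names M P" "forces_mem P r m (check_name P vomega)"
    and f': "\<And>k q. k \<in> names M P \<Longrightarrow> q \<in> conds P \<Longrightarrow> below P q r \<Longrightarrow> forces_mem P q k (check_name P vomega) \<Longrightarrow>
      (\<And>q'. q' \<in> conds P \<Longrightarrow> below P q' q \<Longrightarrow>
        (\<exists>r\<in>conds P. below P r q' \<and> (forces_mem P r m k \<or> forces_eq P r m k))) \<Longrightarrow>
      \<exists>r\<in>conds P. below P r q \<and> differ k r"
  proof -
    have "dense_below q (\<lambda>r. \<exists>m\<in>names M P. forces_mem P r m (check_name P vomega) \<and>
      (\<forall>k\<in>names M P. \<forall>q\<in>conds P. below P q r \<longrightarrow> forces_mem P q k (check_name P vomega) \<longrightarrow>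
        (\<forall>q'\<in>conds P. below P q' q \<longrightarrow> dense_below q' (\<lambda>r. forces_mem P r m k \<or> forces_eq P r m k) \<longrightarrow>
          dense_below q' (differ k))))"
      using f c h unfolding agree_def differ_def
      by (simp add: pitchfork_fm_def agree_fm_def Let_def forces_simps forces_pair_fm cong: ball_cong bex_cong conj_cong)
    from this[rule_format, OF q below_refl]
    obtain r m where r: "r \<in> conds P" "below P r q" "m \<in> names M P" "forces_mem P r m (check_name P vomega)"
      and R: "\<forall>k\<in>names M P. \<forall>q\<in>conds P. below P q r \<longrightarrow> forces_mem P q k (check_name P vomega) \<longrightarrow>
        (\<forall>q'\<in>conds P. below P q' q \<longrightarrow> dense_below q' (\<lambda>r. forces_mem P r m k \<or> forces_eq P r m k) \<longrightarrow>
          dense_below q' (differ k))"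
      by blast
    show ?thesis
    proof (rule that[OF r])
      fix k q assume k: "k \<in> names M P" "q \<in> conds P" "below P q r" "forces_mem P q k (check_name P vomega)"
        and d: "\<And>q'. q' \<in> conds P \<Longrightarrow> below P q' q \<Longrightarrow>
          (\<exists>r\<in>conds P. below P r q' \<and> (forces_mem P r m k \<or> forces_eq P r m k))"
      from R[rule_format, OF k k(2) below_refl _ k(2) below_refl] d
      show "\<exists>r\<in>conds P. below P r q \<and> differ k r"
        by simp
    qed
  qed
  \<comment> \<open>The threshold \<open>m\<close> is only a name for a natural number; a further
    extension decides its value.\<close>
  obtain r' n where r': "r' \<in> conds P" "below P r' r" "forces_eq P r' m (check_name P (vnat n))"
    using r(1,4) unfolding mem_check[OF vomega_in] elts_vomega by (auto elim: dense_belowD)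
  show ?thesis
  proof (rule that[of r' n])
    show "r' \<in> conds P" by fact
    show "below P r' q" using r r' below_trans by blast
    fix k p assume k: "n \<le> k" and p: "p \<in> conds P" "below P p r'"
    let ?k = "check_name P (vnat k)"
    have kw: "forces_mem P p ?k (check_name P vomega)"
      unfolding mem_check[OF vomega_in] elts_vomega using eq_refl below_refl by blast
    have mk: "\<exists>r\<in>conds P. below P r q' \<and> (forces_mem P r m ?k \<or> forces_eq P r m ?k)"
      if q': "q' \<in> conds P" "below P q' p" for q'
    proof -
      have eq: "forces_eq P q' m (check_name P (vnat n))"
        using r'(3) q' p below_trans eq_mono by blast
      have "forces_mem P q' m ?k \<or> forces_eq P q' m ?k"
      proof (cases "n = k")
        case False
        then have "vnat n \<in> elts (vnat k :: 'v)" using k by simp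
        then have "forces_mem P q' m ?k"
          unfolding mem_check[OF vnat_in] using eq eq_mono below_refl by blast
        then show ?thesis ..
      qed (use eq in auto)
      then show ?thesis using q'(1) below_refl by blast
    qed
    have pr: "below P p r" using p r' below_trans by blast
    from f'[OF check_name_name[OF vnat_in] p(1) pr kw mk] obtain s j where s: "s \<in> conds P" "below P s p" "j \<in> names M P"
      "dense_below s (\<lambda>s. \<exists>\<pi>\<in>names M P. forces_mem P s \<pi> (check_name P vintervals) \<and> forces_eq P s \<pi> (opn ?k j))"
      "\<forall>t\<in>conds P. below P t s \<longrightarrow> \<not> agree t j"
      unfolding differ_def by blast
    obtain t \<pi> where t: "t \<in> conds P" "below P t s" "\<pi> \<in> names M P"
      "forces_mem P t \<pi> (check_name P vintervals)" "forces_eq P t \<pi> (opn ?k j)"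
      using dense_belowD[OF s(4,1)] by blast
    show "\<exists>s\<in>conds P. below P s p \<and> (\<exists>i\<in>interval k. \<exists>y\<in>names M P.
        let \<tau> = opn (check_name P (vnat i)) y in
        forces_mem P s \<tau> c \<and> (\<forall>t\<in>conds P. below P t s \<longrightarrow> \<not> forces_mem P t \<tau> h) \<or>
        forces_mem P s \<tau> h \<and> (\<forall>t\<in>conds P. below P t s \<longrightarrow> \<not> forces_mem P t \<tau> c))"
    proof -
      define I :: 'v where "I = vset (vnat ` interval k)"
      have I: "I \<in> M" "elts I = vnat ` interval k"
        unfolding I_def by (auto simp: interval_def intro!: vset_finite_in)
      obtain u l where u: "u \<in> conds P" "below P u t"
        "forces_eq P u \<pi> (check_name P (vpair (vnat l) (vset (vnat ` interval l))))"
        using t(1,4) unfolding mem_check[OF elts_vintervals(1)] elts_vintervals(2)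
        by (auto elim: dense_belowD)
      have lM: "vset (vnat ` interval l) \<in> M" by (auto simp: interval_def intro!: vset_finite_in)
      have "forces_eq P u (opn ?k j) (opn (check_name P (vnat l)) (check_name P (vset (vnat ` interval l))))"
        using eq_trans[OF eq_sym[OF eq_mono[OF t(5) u(2)]] u(3)] by (simp only: check_vpair[OF vnat_in lM])
      from opn_fst[OF this] opn_snd[OF this] have "k = l" "forces_eq P u j (check_name P (vset (vnat ` interval l)))"
        using check_eqD[OF u(1) vnat_in vnat_in] by auto
      then have j: "forces_eq P u j (check_name P I)" by (simp add: I_def)
      have "below P u s" using u(2) t(2) below_trans by blast
      then have "\<not> agree u j" using s(5) u(1) by blast
      then obtain x q1 y \<tau> q2 q3 where x: "x \<in> names M P" "q1 \<in> conds P" "below P q1 u" "forces_mem P q1 x j"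
        and y: "y \<in> names M P" "\<tau> \<in> names M P" "q2 \<in> conds P" "below P q2 q1" "forces_eq P q2 \<tau> (opn x y)"
        and q3: "q3 \<in> conds P" "below P q3 q2" "forces_mem P q3 \<tau> c \<noteq> forces_mem P q3 \<tau> h"
        unfolding agree_def by blast
      have q3u: "below P q3 q1" "below P q3 u" using q3(2) y(4) x(3) below_trans by blast+
      \<comment> \<open>First \<open>q4\<close> rules out membership in \<open>b\<close> for all its
        extensions, then \<open>q5\<close> decides the position; in this order the refusal persists
        below \<open>q5\<close>.\<close>
      have main: "\<exists>q5\<in>conds P. below P q5 q3 \<and> (\<exists>i\<in>interval k. forces_mem P q5 (opn (check_name P (vnat i)) y) a \<and>
        (\<forall>t\<in>conds P. below P t q5 \<longrightarrow> \<not> forces_mem P t (opn (check_name P (vnat i)) y) b))"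
        if a: "forces_mem P q3 \<tau> a" and b: "\<not> forces_mem P q3 \<tau> b" for a b
      proof -
        obtain q4 where q4: "q4 \<in> conds P" "below P q4 q3"
          "\<And>r. r \<in> conds P \<Longrightarrow> below P r q4 \<Longrightarrow> \<not> forces_mem P r \<tau> b"
          using not_memD[OF b] by blast
        have "forces_mem P q4 x (check_name P I)"
          using mem_eq_right[OF eq_mono[OF j] mem_mono[OF x(4)]] q3u q4(2) below_trans by blast
        then obtain q5 i where q5: "q5 \<in> conds P" "below P q5 q4" "i \<in> interval k"
          "forces_eq P q5 x (check_name P (vnat i))"
          unfolding mem_check[OF I(1)] I(2) using q4(1) by (auto elim: dense_belowD)
        have q53: "below P q5 q3" using q5(2) q4(2) below_trans by blast
        then have "below P q5 q2" using q3(2) below_trans by blast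
        then have eq: "forces_eq P q5 \<tau> (opn (check_name P (vnat i)) y)"
          using eq_trans[OF eq_mono[OF y(5)] opn_cong[OF x(1) y(1) check_name_name[OF vnat_in] y(1) q5(4) eq_refl]]
          by blast
        have "forces_mem P q5 (opn (check_name P (vnat i)) y) a"
          using mem_eq_left[OF eq mem_mono[OF a q53]] .
        moreover have "\<not> forces_mem P t (opn (check_name P (vnat i)) y) b"
          if t: "t \<in> conds P" "below P t q5" for t
        proof
          assume "forces_mem P t (opn (check_name P (vnat i)) y) b"
          then have "forces_mem P t \<tau> b" by (rule mem_eq_left[OF eq_sym[OF eq_mono[OF eq t(2)]]])
          then show False using q4(3)[OF t(1)] t(2) q5(2) below_trans by blast
        qed
        ultimately show ?thesis using q5(1,3) q53 by blast
      qed
      have "below P q3 p" using q3u(2) \<open>below P u s\<close> s(2) below_trans by blast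
      consider "forces_mem P q3 \<tau> c" "\<not> forces_mem P q3 \<tau> h"
        | "forces_mem P q3 \<tau> h" "\<not> forces_mem P q3 \<tau> c" using q3(3) by blast
      then show ?thesis
      proof cases
        case 1
        from main[OF this] obtain q5 i where q5: "q5 \<in> conds P" "below P q5 q3" "i \<in> interval k"
          and "forces_mem P q5 (opn (check_name P (vnat i)) y) c" "\<forall>t\<in>conds P. below P t q5 \<longrightarrow> \<not> forces_mem P t (opn (check_name P (vnat i)) y) h" by blast
        then have "below P q5 p" using below_trans \<open>below P q3 p\<close> by blast
        show ?thesis unfolding Let_def
          by (rule bexI[OF _ q5(1)], rule conjI, fact, rule bexI[OF _ q5(3)], rule bexI[OF _ y(1)],
            rule disjI1, rule conjI, fact+)
      next
        case 2
        from main[OF this] obtain q5 i where q5: "q5 \<in> conds P" "below P q5 q3" "i \<in> interval k"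
          and "forces_mem P q5 (opn (check_name P (vnat i)) y) h" "\<forall>t\<in>conds P. below P t q5 \<longrightarrow> \<not> forces_mem P t (opn (check_name P (vnat i)) y) c" by blast
        then have "below P q5 p" using below_trans \<open>below P q3 p\<close> by blast
        show ?thesis unfolding Let_def
          by (rule bexI[OF _ q5(1)], rule conjI, fact, rule bexI[OF _ q5(3)], rule bexI[OF _ y(1)],
            rule disjI2, rule conjI, fact+)
      qed
    qed
  qed
qed

end

section \<open>Laver trees\<close>

text \<open>These are the Laver trees with stem \<open>s\<close>, as \<open>laver_tree_iff\<close>
  shows. Making the stem a parameter and requiring comparability with it avoids minimal branching
  nodes, and the condition passes directly to intersections and larger families.\<close>

definition ltree :: "nat set set \<Rightarrow> nat list \<Rightarrow> nat list set \<Rightarrow> bool" where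
  "ltree F s T \<longleftrightarrow> s \<in> T \<and> (\<forall>\<sigma>\<in>T. \<forall>\<tau>. prefix \<tau> \<sigma> \<longrightarrow> \<tau> \<in> T) \<and>
     (\<forall>\<tau>\<in>T. prefix \<tau> s \<or> prefix s \<tau>) \<and> (\<forall>\<sigma>\<in>T. prefix s \<sigma> \<longrightarrow> {i. \<sigma> @ [i] \<in> T} \<in> F)"

lemma infinite_two:
  assumes "infinite (X :: nat set)"
  obtains i j where "i \<in> X" "j \<in> X" "i \<noteq> j"
proof -
  obtain i where i: "i \<in> X" using infinite_imp_nonempty[OF assms] by blast
  have "infinite (X - {i})" using assms by simp
  from infinite_imp_nonempty[OF this] obtain j where "j \<in> X - {i}" by blast
  with i that show ?thesis by blast
qed

lemma ltree_branching: "ltree F s T \<Longrightarrow> \<forall>X\<in>F. infinite X \<Longrightarrow> branching T s"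
proof -
  assume "ltree F s T" "\<forall>X\<in>F. infinite X"
  then have "s \<in> T" "infinite {i. s @ [i] \<in> T}" by (auto simp: ltree_def)
  from infinite_two[OF this(2)] obtain i j where "s @ [i] \<in> T" "s @ [j] \<in> T" "i \<noteq> j" by auto
  with \<open>s \<in> T\<close> show ?thesis unfolding branching_def by blast
qed

text \<open>If \<open>t\<close> did not extend \<open>s\<close>, two different immediate successors
  of \<open>t\<close> would both be initial segments of \<open>s\<close>.\<close>

lemma ltree_branching_extends:
  assumes T: "ltree F s T" and t: "branching T t"
  shows "prefix s t"
proof (rule ccontr)
  assume np: "\<not> prefix s t"
  obtain i j where ij: "i \<noteq> j" "t @ [i] \<in> T" "t @ [j] \<in> T" "t \<in> T" using t unfolding branching_def by blast
  have *: "prefix (t @ [k]) s" if "t @ [k] \<in> T" for k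
    using T that np unfolding ltree_def by (metis prefix_order.refl prefix_snoc)
  from *[OF ij(2)] *[OF ij(3)] ij(1) show False by (auto simp: prefix_def)
qed

lemma ltree_is_stem:
  assumes "ltree F s T" "\<forall>X\<in>F. infinite X"
  shows "is_stem T s"
  unfolding is_stem_def
proof (intro conjI allI impI)
  show "branching T s" by (rule ltree_branching[OF assms])
  fix t assume "branching T t \<and> t \<noteq> s"
  then have "strict_prefix s t" using ltree_branching_extends[OF assms(1)] by (auto simp: strict_prefix_def)
  then show "length s < length t" by (rule prefix_length_less)
qed

lemma is_stem_unique: "is_stem T s \<Longrightarrow> is_stem T t \<Longrightarrow> s = t"
  unfolding is_stem_def by (metis less_asym)

lemma laver_tree_iff:
  assumes inf: "\<forall>X\<in>F. infinite X"
  shows "laver_tree F T \<longleftrightarrow> (\<exists>s. ltree F s T)"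
proof
  assume "laver_tree F T"
  then obtain s where cl: "\<forall>\<sigma>\<in>T. \<forall>\<tau>. prefix \<tau> \<sigma> \<longrightarrow> \<tau> \<in> T" and s: "is_stem T s"
    and F: "\<forall>\<sigma>\<in>T. prefix s \<sigma> \<longrightarrow> {i. \<sigma> @ [i] \<in> T} \<in> F"
    unfolding laver_tree_def by blast
  have sT: "s \<in> T" using s by (simp add: is_stem_def branching_def)
  have "prefix \<tau> s \<or> prefix s \<tau>" if \<tau>: "\<tau> \<in> T" for \<tau>
  proof (rule ccontr)
    assume "\<not> ?thesis"
    then have "\<tau> \<parallel> s" by (simp add: parallel_def)
    then obtain as b bs c cs where e: "b \<noteq> c" "\<tau> = as @ b # bs" "s = as @ c # cs"
      using parallel_decomp by blast
    \<comment> \<open>At \<open>as\<close> the incomparable node parts from \<open>s\<close>; so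
      \<open>as\<close> branches, yet it is shorter than the stem.\<close>
    have "as \<in> T" "as @ [b] \<in> T" "as @ [c] \<in> T"
      using cl \<tau> sT e by (auto simp: prefix_def)
    then have "branching T as" using e(1) unfolding branching_def by blast
    then have "length s < length as" using s e(3) unfolding is_stem_def by auto
    then show False using e(3) by simp
  qed
  then show "\<exists>s. ltree F s T" unfolding ltree_def using cl F sT by blast
next
  assume "\<exists>s. ltree F s T"
  then obtain s where s: "ltree F s T" ..
  then show "laver_tree F T"
    unfolding laver_tree_def
  proof (intro conjI exI[of _ s] ballI impI)
    show "is_stem T s" by (rule ltree_is_stem[OF s inf])
    fix \<sigma> assume "\<sigma> \<in> T" "prefix s \<sigma>"
    with s show F: "{i. \<sigma> @ [i] \<in> T} \<in> F" by (simp add: ltree_def)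
    with inf show "infinite {i. \<sigma> @ [i] \<in> T}" by blast
  qed (use s in \<open>auto simp: ltree_def\<close>)
qed

lemma ltree_Int:
  assumes "ltree F s T" "ltree F t S" "prefix s t" "t \<in> T" "\<And>X Y. X \<in> F \<Longrightarrow> Y \<in> F \<Longrightarrow> X \<inter> Y \<in> F"
  shows "ltree F t (T \<inter> S)"
  unfolding ltree_def
proof (intro conjI ballI impI)
  show "t \<in> T \<inter> S" using assms by (simp add: ltree_def)
  fix \<sigma> assume \<sigma>: "\<sigma> \<in> T \<inter> S"
  show "prefix \<sigma> t \<or> prefix t \<sigma>" using \<sigma> assms(2) by (simp add: ltree_def)
  show "\<forall>\<tau>. prefix \<tau> \<sigma> \<longrightarrow> \<tau> \<in> T \<inter> S" using \<sigma> assms(1,2) by (auto simp: ltree_def)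
  assume "prefix t \<sigma>"
  then have "{i. \<sigma> @ [i] \<in> S} \<in> F" using \<sigma> assms(2) by (simp add: ltree_def)
  moreover have "prefix s \<sigma>" using \<open>prefix t \<sigma>\<close> assms(3) by (rule prefix_order.trans[rotated])
  then have "{i. \<sigma> @ [i] \<in> T} \<in> F" using \<sigma> assms(1) by (simp add: ltree_def)
  ultimately have "{i. \<sigma> @ [i] \<in> T} \<inter> {i. \<sigma> @ [i] \<in> S} \<in> F" using assms(5) by blast
  then show "{i. \<sigma> @ [i] \<in> T \<inter> S} \<in> F" by (simp add: Collect_conj_eq)
qed

lemma ltree_mono: "ltree F s T \<Longrightarrow> F \<subseteq> F' \<Longrightarrow> ltree F' s T"
  unfolding ltree_def by blast

definition nodes :: "'v::set_universe \<Rightarrow> nat list set" where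
  "nodes x = {\<sigma>. vseq \<sigma> \<in> elts x}"

lemma nodes_vset [simp]: "elts x = vseq ` T \<Longrightarrow> nodes x = T"
  by (auto simp: nodes_def)

lemma elts_nodes: "elts x \<subseteq> range vseq \<Longrightarrow> elts x = vseq ` nodes x"
  by (auto simp: nodes_def)


section \<open>Laver forcing in a transitive model\<close>

lemma in_laver_iff:
  "x \<in> conds (laver M U) \<longleftrightarrow> x \<in> M \<and> elts x \<subseteq> range vseq \<and> laver_tree (family U) (nodes x)"
proof
  assume "x \<in> conds (laver M U)"
  then obtain T where T: "x \<in> M" "elts x = vseq ` T" "laver_tree (family U) T" by (auto simp: laver_def)
  from nodes_vset[OF T(2)] T(1,3) show "x \<in> M \<and> elts x \<subseteq> range vseq \<and> laver_tree (family U) (nodes x)"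
    unfolding T(2) by (simp add: image_mono)
next
  assume x: "x \<in> M \<and> elts x \<subseteq> range vseq \<and> laver_tree (family U) (nodes x)"
  then have "elts x = vseq ` nodes x" by (intro elts_nodes) blast
  with x have "x \<in> M \<and> (\<exists>T. elts x = vseq ` T \<and> laver_tree (family U) T)" by blast
  then show "x \<in> conds (laver M U)" by (simp add: laver_def)
qed

lemma below_laver [simp]: "below (laver M U) x y \<longleftrightarrow> elts x \<subseteq> elts y"
  by (simp add: laver_def)

locale ultrafilter_model = zfc_model M for M :: "'v::set_universe set" +
  fixes U :: 'v
  assumes U_in: "U \<in> M" and ultra: "nonprincipal_ultrafilter_in M U"
begin

lemma U_omega: "\<forall>A\<in>elts U. elts A \<subseteq> range vnat"
  using ultra by (simp add: nonprincipal_ultrafilter_in_def)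

lemma family_sets: "X \<in> family U \<Longrightarrow> X \<in> subsets_of_omega M"
  using elts_in[OF U_in] unfolding family_def subsets_of_omega_def by blast

lemma family_Int: "X \<in> family U \<Longrightarrow> Y \<in> family U \<Longrightarrow> X \<inter> Y \<in> family U"
  and family_superset: "X \<in> family U \<Longrightarrow> Y \<in> subsets_of_omega M \<Longrightarrow> X \<subseteq> Y \<Longrightarrow> Y \<in> family U"
  and family_ultra: "X \<in> subsets_of_omega M \<Longrightarrow> X \<notin> family U \<Longrightarrow> - X \<in> family U"
  and family_UNIV: "UNIV \<in> family U" and family_empty: "{} \<notin> family U"
  using ultra unfolding nonprincipal_ultrafilter_in_def by (metis, metis, metis, metis, metis)

text \<open>Removing the points of a finite member one at a time leads to a singleton member, and
  then the ultrafilter is principal.\<close>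

lemma family_infinite: "\<forall>X\<in>family U. infinite X"
proof (rule ballI, rule notI)
  fix X assume "X \<in> family U" "finite X"
  have "\<exists>n. {n} \<in> family U" if "finite X" "X \<in> family U" for X
    using that
  proof (induction X rule: finite_induct)
    case empty
    then show ?case using family_empty by blast
  next
    case (insert x X)
    have x: "{x} \<in> subsets_of_omega M"
      unfolding subsets_of_omega_def using vset_finite_in[of "{vnat x}"]
      by (intro CollectI bexI[of _ "vset {vnat x}"]) auto
    show ?case
    proof (cases "{x} \<in> family U")
      case False
      then have "insert x X \<inter> - {x} \<in> family U" using x insert.prems family_Int family_ultra by blast
      also have "insert x X \<inter> - {x} = X" using insert.hyps by blast
      finally show ?thesis by (rule insert.IH)
    qed blast
  qed
  then obtain n where n: "{n} \<in> family U" using \<open>X \<in> family U\<close> \<open>finite X\<close> by blast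
  have "family U = {X \<in> subsets_of_omega M. n \<in> X}"
  proof (intro equalityI subsetI CollectI conjI)
    fix X assume X: "X \<in> family U"
    show "X \<in> subsets_of_omega M" by (rule family_sets[OF X])
    have "{n} \<inter> X \<noteq> {}" using family_Int[OF n X] family_empty by metis
    then show "n \<in> X" by blast
  next
    fix X assume "X \<in> {X \<in> subsets_of_omega M. n \<in> X}"
    then show "X \<in> family U" using family_superset[OF n] by blast
  qed
  moreover have "\<nexists>n. family U = {X \<in> subsets_of_omega M. n \<in> X}"
    using ultra by (simp add: nonprincipal_ultrafilter_in_def)
  ultimately show False by blast
qed

abbreviation LU :: "'v poset" where
  "LU \<equiv> laver M U"

lemma in_LU_iff: "x \<in> conds LU \<longleftrightarrow> x \<in> M \<and> elts x \<subseteq> range vseq \<and> (\<exists>s. ltree (family U) s (nodes x))"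
  unfolding in_laver_iff laver_tree_iff[OF family_infinite] ..

lemma LU_ltree: "x \<in> conds LU \<Longrightarrow> ltree (family U) (stem x) (nodes x)"
  and stem_eq: "ltree (family U) s (nodes x) \<Longrightarrow> stem x = s"
proof -
  show *: "stem x = s" if "ltree (family U) s (nodes x)" for s
    unfolding stem_def nodes_def[symmetric]
    by (rule the_equality) (use ltree_is_stem[OF that family_infinite] is_stem_unique in blast)+
  show "ltree (family U) (stem x) (nodes x)" if "x \<in> conds LU"
    using that * unfolding in_LU_iff by metis
qed

lemma LU_condI:
  assumes "isset (vseq ` T)" "ltree (family U) s T"
  shows "vset (vseq ` T) \<in> conds LU" "elts (vset (vseq ` T)) = (vseq ` T :: 'v set)" "stem (vset (vseq ` T) :: 'v) = s"
proof -
  show e: "elts (vset (vseq ` T)) = (vseq ` T :: 'v set)" by (rule isset_vset(2)[OF assms(1)])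
  from nodes_vset[OF this] assms(2) have "ltree (family U) s (nodes (vset (vseq ` T) :: 'v))" by simp
  then show "stem (vset (vseq ` T) :: 'v) = s" by (rule stem_eq)
  show "vset (vseq ` T) \<in> conds LU"
    unfolding in_LU_iff e nodes_vset[OF e] using assms isset_vset(1) by blast
qed

lemma LU_elts: "x \<in> conds LU \<Longrightarrow> elts x = vseq ` nodes x"
  unfolding in_LU_iff by (intro elts_nodes) blast

lemma LU_Int:
  assumes "x \<in> conds LU" "y \<in> M" "elts y \<subseteq> range vseq" "ltree (family U) t (nodes y)" "prefix (stem x) t" "t \<in> nodes x"
  obtains w where "w \<in> conds LU" "elts w \<subseteq> elts x" "elts w \<subseteq> elts y" "stem w = t"
proof -
  have xy: "elts x \<inter> elts y = vseq ` (nodes x \<inter> nodes y)"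
    unfolding LU_elts[OF assms(1)] elts_nodes[OF assms(3)] by (simp add: image_Int[OF inj_vseq])
  have "isset (vseq ` (nodes x \<inter> nodes y) :: 'v set)"
    unfolding xy[symmetric] using assms(1,2) by (intro isset_Int isset_elts) (auto simp: in_LU_iff)
  from LU_condI[OF this ltree_Int[OF LU_ltree[OF assms(1)] assms(4-6) family_Int]]
  show ?thesis using that xy by blast
qed

sublocale forcing M "laver M U"
proof
  show "conds (laver M U) \<subseteq> M" by (auto simp: laver_def)
  have top: "vset (vseq ` UNIV) \<in> conds LU"
    by (rule LU_condI(1)[OF isset_seqs, of "[]"]) (simp add: ltree_def family_UNIV)
  then show "top_cond LU \<in> conds LU" by (simp add: laver_def)
  show "below LU p (top_cond LU)" if "p \<in> conds LU" for p
    using that isset_vset(2)[OF isset_seqs] by (simp add: in_LU_iff) (simp add: laver_def)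
  show "below LU p r" if "below LU p q" "below LU q r" for p q r
    using that by auto
qed simp

lemma definable_ltree [dfn]:
  assumes "dterm M (\<lambda>e. vseq (s e))" "dterm M x"
  shows "definable M (\<lambda>e. ltree (family U) (s e) (nodes (x e)))"
proof -
  have "definable M (\<lambda>e. ltree (family U) (dseq (vseq (s e) :: 'v)) (nodes (x e)))"
  proof (rule definable_comp2[where R = "\<lambda>x y. ltree (family U) (dseq x) (nodes y)", OF _ assms])
    show "definable M (\<lambda>e. ltree (family U) (dseq (e i)) (nodes (e j)))" for i j
      unfolding ltree_def nodes_def Ball_def mem_Collect_eq
      by (intro dfn U_in U_omega)
  qed
  then show ?thesis by simp
qed

lemma definable_subset [dfn]:
  "dterm M t \<Longrightarrow> dterm M u \<Longrightarrow> definable M (\<lambda>e. elts (t e) \<subseteq> elts (u e))"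
  by (rule definable_comp2[where R = "\<lambda>x y. elts x \<subseteq> elts y"]) (unfold subset_eq, intro dfn)

lemma isset_conds: "isset (conds LU)"
proof -
  have "isset {x \<in> {x \<in> M. elts x \<subseteq> range vseq}. \<exists>s. ltree (family U) s (nodes x)}"
    by (intro separation isset_Pow isset_seqs dfn)
  also have "{x \<in> {x \<in> M. elts x \<subseteq> range vseq}. \<exists>s. ltree (family U) s (nodes x)} = conds LU"
    by (auto simp: in_LU_iff)
  finally show ?thesis .
qed

lemma definable_conds [dfn]: "dterm M t \<Longrightarrow> definable M (\<lambda>e. t e \<in> conds LU)"
  by (rule definable_isset[OF isset_conds])

lemma definable_ball_conds [dfn]:
  assumes "definable M (\<lambda>e. Q (e 0) (\<lambda>n. e (Suc n)))"
  shows "definable M (\<lambda>e. \<forall>x\<in>conds LU. Q x e)"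
proof (rule definable_cong)
  show "definable M (\<lambda>e. \<forall>x\<in>M. x \<in> conds LU \<longrightarrow> Q x e)" by (intro dfn assms)
qed (use conds_in in auto)

lemma definable_bex_conds [dfn]:
  assumes "definable M (\<lambda>e. Q (e 0) (\<lambda>n. e (Suc n)))"
  shows "definable M (\<lambda>e. \<exists>x\<in>conds LU. Q x e)"
proof (rule definable_cong)
  show "definable M (\<lambda>e. \<exists>x\<in>M. x \<in> conds LU \<and> Q x e)" by (intro dfn assms)
qed (use conds_in in auto)

lemma family_definable_superset:
  "X \<in> family U \<Longrightarrow> definable M (\<lambda>e. Q (dnat (e 0))) \<Longrightarrow> (\<And>i. i \<in> X \<Longrightarrow> Q i) \<Longrightarrow> {i. Q i} \<in> family U"
  using family_superset[of X "{i. Q i}"] subset_of_omega[of Q] by blast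

end


section \<open>Ranks\<close>

text \<open>A transitive set of transitive sets; since membership is well-founded, these are the von
  Neumann ordinals.\<close>

definition ordinal :: "'v::set_universe \<Rightarrow> bool" where
  "ordinal x \<longleftrightarrow> (\<forall>y\<in>elts x. \<forall>z\<in>elts y. z \<in> elts x) \<and> (\<forall>y\<in>elts x. \<forall>z\<in>elts y. \<forall>w\<in>elts z. w \<in> elts y)"

lemma ordinal_elt: "ordinal x \<Longrightarrow> y \<in> elts x \<Longrightarrow> ordinal y"
  unfolding ordinal_def by blast

text \<open>Nested induction on \<open>x\<close> and \<open>y\<close>: if neither is an element of
  the other, the hypotheses for their elements show that they have the same elements.\<close>

lemma ordinal_linear: "ordinal x \<Longrightarrow> ordinal y \<Longrightarrow> x \<in> elts y \<or> x = y \<or> y \<in> elts x"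
proof (induction x arbitrary: y rule: elts_induct)
  case IHx: (1 x)
  show ?case
    using IHx(3)
  proof (induction y rule: elts_induct)
    case IHy: (1 y)
    show ?case
    proof (rule ccontr)
      assume n: "\<not> ?case"
      have "elts x = elts y"
      proof (intro equalityI subsetI)
        fix z assume z: "z \<in> elts x"
        from IHx(1)[OF z ordinal_elt[OF IHx(2) z] IHy(2)] n z IHx(2) show "z \<in> elts y"
          unfolding ordinal_def by blast
      next
        fix z assume z: "z \<in> elts y"
        from IHy(1)[OF z ordinal_elt[OF IHy(2) z]] n z IHy(2) show "z \<in> elts x"
          unfolding ordinal_def by blast
      qed
      with n show False using elts_inject by blast
    qed
  qed
qed

context ultrafilter_model
begin

definition rank_step :: "'v set \<Rightarrow> nat list set \<Rightarrow> nat list set" where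
  "rank_step D S = {\<sigma>. (\<exists>d\<in>D. ltree (family U) \<sigma> (nodes d)) \<or> {i. \<sigma> @ [i] \<in> S} \<in> family U}"

text \<open>The set of sequences of rank at most \<open>x\<close>, coded as an element of
  \<open>M\<close> so that the recursion can be carried out there. It is defined for all sets
  \<open>x\<close>; \<open>ranked\<close> restricts attention to ordinals.\<close>

definition rank_code :: "'v set \<Rightarrow> 'v \<Rightarrow> 'v" where
  "rank_code D = vrec (\<lambda>x s. vset (vseq ` rank_step D (\<Union>(nodes ` elts s))))"

definition rank_le :: "'v set \<Rightarrow> 'v \<Rightarrow> nat list set" where
  "rank_le D x = nodes (rank_code D x)"

lemma rank_properties:
  assumes D: "isset D"
  shows rank_le_rec: "\<And>x. x \<in> M \<Longrightarrow> rank_le D x = rank_step D (\<Union>(rank_le D ` elts x))"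
    and dterm_rank_code: "\<And>t. dterm M t \<Longrightarrow> dterm M (\<lambda>e. rank_code D (t e))"
proof -
  let ?G = "\<lambda>(x::'v) s. vset (vseq ` rank_step D (\<Union>(nodes ` elts s))) :: 'v"
  obtain d where d: "d \<in> M" "elts d = D" using D by (auto simp: isset_def)
  have df: "definable M (\<lambda>e. dseq (e i) \<in> rank_step D (\<Union>(nodes ` elts (e j))))" for i j
    unfolding rank_step_def mem_Collect_eq d(2)[symmetric] UN_iff nodes_def
    by (intro dfn U_in U_omega d definable_ltree[unfolded nodes_def])
  have iss: "isset (vseq ` rank_step D (\<Union>(nodes ` elts s)))" if "s \<in> M" for s
  proof -
    have "definable M (\<lambda>e. dseq (e 0) \<in> rank_step D (\<Union>(nodes ` elts s)))"
      unfolding rank_step_def mem_Collect_eq d(2)[symmetric] UN_iff nodes_def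
      by (intro dfn U_in U_omega d that definable_ltree[unfolded nodes_def])
    from isset_seq_set[OF this] show ?thesis by simp
  qed
  have dt: "dterm M (\<lambda>e. ?G (e j) (e k))" for j k
  proof (rule dterm_vset)
    show "isset (vseq ` rank_step D (\<Union>(nodes ` elts (e k))))" if "range e \<subseteq> M" for e
      using that by (intro iss) auto
    show "definable M (\<lambda>e. e 0 \<in> vseq ` rank_step D (\<Union>(nodes ` elts (e (Suc k)))))"
    proof (rule definable_cong)
      show "definable M (\<lambda>e. \<exists>\<sigma>. e 0 = vseq \<sigma> \<and> \<sigma> \<in> rank_step D (\<Union>(nodes ` elts (e (Suc k)))))"
        by (intro dfn df)
    qed auto
  qed
  have G1: "?G x s \<in> M" if "x \<in> M" "s \<in> M" for x s using isset_vset(1)[OF iss[OF that(2)]] .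
  have G2: "definable M (\<lambda>e. e i = ?G (e j) (e k))" for i j k by (intro dfn dt)
  show "dterm M (\<lambda>e. rank_code D (t e))" if "dterm M t" for t
    unfolding rank_code_def by (rule vrec_in(3)[where G = ?G]) (use G1 G2 that in blast)+
  show "rank_le D x = rank_step D (\<Union>(rank_le D ` elts x))" if x: "x \<in> M" for x
  proof -
    have s: "isset (rank_code D ` elts x)" unfolding rank_code_def by (rule vrec_in(2)[where G = ?G]) (use G1 G2 x in blast)+
    have "rank_code D x = vset (vseq ` rank_step D (\<Union>(nodes ` elts (vset (rank_code D ` elts x)))))"
      unfolding rank_code_def vrec.simps[of _ x] ..
    then have "elts (rank_code D x) = vseq ` rank_step D (\<Union>(nodes ` rank_code D ` elts x))"
      using isset_vset(2)[OF iss[OF isset_vset(1)[OF s]]] by (simp add: isset_vset(2)[OF s])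
    then have "nodes (rank_code D x) = rank_step D (\<Union>(nodes ` rank_code D ` elts x))" by (rule nodes_vset)
    then show ?thesis by (simp add: rank_le_def image_image)
  qed
qed

lemma definable_rank_le:
  "isset D \<Longrightarrow> dterm M (\<lambda>e. vseq (s e)) \<Longrightarrow> dterm M t \<Longrightarrow> definable M (\<lambda>e. s e \<in> rank_le D (t e))"
  unfolding rank_le_def nodes_def mem_Collect_eq by (intro dfn dterm_rank_code)

lemma definable_ordinal: "dterm M t \<Longrightarrow> definable M (\<lambda>e. ordinal (t e))"
  by (rule definable_comp1[where R = ordinal]) (unfold ordinal_def, intro dfn)

text \<open>Taking only ordinals as ranks gives each ranked sequence a unique least rank, to which
  Replacement can be applied.\<close>

definition ranked :: "'v set \<Rightarrow> nat list set" where
  "ranked D = {\<sigma>. \<exists>\<alpha>\<in>M. ordinal \<alpha> \<and> \<sigma> \<in> rank_le D \<alpha>}"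

lemma definable_ranked:
  "isset D \<Longrightarrow> dterm M (\<lambda>e. vseq (s e)) \<Longrightarrow> definable M (\<lambda>e. s e \<in> ranked D)"
proof -
  assume D: "isset D" and s: "dterm M (\<lambda>e. vseq (s e))"
  have "definable M (\<lambda>e. dseq (vseq (s e) :: 'v) \<in> ranked D)"
  proof (rule definable_comp1[where R = "\<lambda>x. dseq x \<in> ranked D", OF _ s])
    show "definable M (\<lambda>e. dseq (e i) \<in> ranked D)" for i
      unfolding ranked_def mem_Collect_eq by (intro dfn definable_ordinal definable_rank_le D)
  qed
  then show ?thesis by simp
qed

text \<open>Replacement collects the least ranks of the ranked successors of
  \<open>\<sigma>\<close>; an ordinal of \<open>M\<close> above all of them is a bound for the rank
  of \<open>\<sigma>\<close>. This is why the unranked sequences form a tree with large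
  branching.\<close>

lemma ranked_closed:
  assumes D: "isset D" and \<sigma>: "{i. \<sigma> @ [i] \<in> ranked D} \<in> family U"
  shows "\<sigma> \<in> ranked D"
proof -
  define least where "least x \<alpha> \<longleftrightarrow> ordinal \<alpha> \<and> \<sigma> @ [dnat x] \<in> rank_le D \<alpha> \<and>
    (\<forall>\<beta>\<in>elts \<alpha>. \<sigma> @ [dnat x] \<notin> rank_le D \<beta>)" for x \<alpha> :: 'v
  define X :: "'v set" where "X = vnat ` {i. \<sigma> @ [i] \<in> ranked D}"
  have dl: "definable M (\<lambda>e. least (e i) (e j))" for i j
    unfolding least_def by (intro dfn definable_ordinal definable_rank_le D vseq_in)
  have X: "isset X" using family_sets[OF \<sigma>] unfolding X_def subsets_of_omega_def by (auto intro: issetI)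
  have ex: "\<exists>\<alpha>\<in>M. \<forall>\<alpha>'\<in>M. least x \<alpha>' \<longleftrightarrow> \<alpha>' = \<alpha>" if x: "x \<in> X" for x
  proof -
    obtain \<alpha> where "\<alpha> \<in> M" "ordinal \<alpha>" "\<sigma> @ [dnat x] \<in> rank_le D \<alpha>"
      using x unfolding X_def ranked_def by auto
    then have "\<exists>\<alpha>\<in>M. least x \<alpha>"
    proof (induction \<alpha> rule: elts_induct)
      case (1 \<alpha>)
      show ?case
      proof (cases "\<exists>\<beta>\<in>elts \<alpha>. \<sigma> @ [dnat x] \<in> rank_le D \<beta>")
        case True
        then show ?thesis using 1 ordinal_elt elts_in by blast
      next
        case False
        then show ?thesis using 1 unfolding least_def by blast
      qed
    qed
    then obtain \<alpha> where \<alpha>: "\<alpha> \<in> M" "least x \<alpha>" by blast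
    have "\<alpha>' = \<alpha>" if "least x \<alpha>'" for \<alpha>'
      using that \<alpha>(2) ordinal_linear[of \<alpha> \<alpha>'] unfolding least_def by blast
    with \<alpha> show ?thesis by blast
  qed
  define Z where "Z = {\<alpha> \<in> M. \<exists>x\<in>X. least x \<alpha>}"
  have Z: "isset Z" unfolding Z_def
  proof (rule replacement_env[where R = "\<lambda>x y e. least x y" and e = "\<lambda>_. U"])
    show "definable M (\<lambda>e. least (e 0) (e 1))" by (rule dl)
  qed (use X ex U_in in auto)
  \<comment> \<open>The collected ranks must themselves be elements of \<open>\<delta>\<close>,
    since \<open>rank_step\<close> uses strictly smaller ranks; adding the union of \<open>Z\<close>
    makes \<open>\<delta>\<close> transitive.\<close>
  obtain \<delta> where \<delta>: "\<delta> \<in> M" "elts \<delta> = \<Union>(elts ` Z) \<union> Z"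
    using isset_Un[OF isset_Union[OF Z] Z] by (auto simp: isset_def)
  have "ordinal \<alpha>" if "\<alpha> \<in> Z" for \<alpha> using that by (auto simp: Z_def least_def)
  then have "ordinal \<delta>" unfolding ordinal_def \<delta>(2) by blast
  have cov: "\<sigma> @ [i] \<in> \<Union>(rank_le D ` elts \<delta>)" if i: "i \<in> {i. \<sigma> @ [i] \<in> ranked D}" for i
  proof -
    have "vnat i \<in> X" using i by (simp add: X_def)
    then obtain \<alpha> where \<alpha>: "\<alpha> \<in> M" "least (vnat i) \<alpha>" using ex by blast
    then have "\<alpha> \<in> Z" using \<open>vnat i \<in> X\<close> unfolding Z_def by blast
    then have "\<alpha> \<in> elts \<delta>" unfolding \<delta>(2) by blast
    moreover have "\<sigma> @ [i] \<in> rank_le D \<alpha>" using \<alpha>(2) by (simp add: least_def)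
    ultimately show ?thesis by blast
  qed
  have "{i. \<sigma> @ [i] \<in> \<Union>(rank_le D ` elts \<delta>)} \<in> family U"
  proof (rule family_definable_superset[OF \<sigma> _ cov])
    show "definable M (\<lambda>e. \<sigma> @ [dnat (e 0)] \<in> \<Union>(rank_le D ` elts \<delta>))"
      unfolding UN_iff by (intro dfn definable_rank_le D vseq_in \<delta>)
  qed
  then have "\<sigma> \<in> rank_le D \<delta>" unfolding rank_le_rec[OF D \<delta>(1)] rank_step_def by blast
  then show ?thesis unfolding ranked_def using \<delta>(1) \<open>ordinal \<delta>\<close> by blast
qed

lemma stem_ranked:
  assumes D: "isset D" and d: "d \<in> D" "ltree (family U) \<sigma> (nodes d)"
  shows "\<sigma> \<in> ranked D"
proof -
  have "ordinal (vset {} :: 'v)" by (simp add: ordinal_def)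
  moreover have "vset {} \<in> M" by (simp add: vset_finite_in)
  moreover have "\<sigma> \<in> rank_le D (vset {})"
    unfolding rank_le_rec[OF D \<open>vset {} \<in> M\<close>] rank_step_def using d by blast
  ultimately show ?thesis unfolding ranked_def by blast
qed

text \<open>The stem of \<open>S\<close> also branches in \<open>T\<close>. The two families may
  differ, so this compares a tree of \<open>N\<close> with one of \<open>M\<close>.\<close>

lemma ltree_below_stem:
  assumes "ltree (family U) s S" "ltree F t T" "S \<subseteq> T"
  shows "prefix t s"
proof (rule ltree_branching_extends[OF assms(2)])
  show "branching T s"
    using ltree_branching[OF assms(1) family_infinite] assms(3) unfolding branching_def by blast
qed

lemma unranked:
  assumes D: "isset D" "D \<subseteq> conds LU" and s: "s \<notin> ranked D"
  obtains T where "T \<in> conds LU" "stem T = s" "\<And>d. d \<in> D \<Longrightarrow> \<not> elts d \<subseteq> elts T"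
proof -
  \<comment> \<open>Nothing ranked may occur between \<open>s\<close> and a node of the tree, which
    makes it closed under initial segments beyond \<open>s\<close>; those of \<open>s\<close> itself
    are added by hand.\<close>
  define T where "T = {\<tau>. prefix \<tau> s \<or> prefix s \<tau> \<and> (\<forall>\<rho>. prefix s \<rho> \<longrightarrow> prefix \<rho> \<tau> \<longrightarrow> \<rho> \<notin> ranked D)}"
  have sub: "definable M (\<lambda>e. \<sigma> @ [dnat (e 0)] \<in> T)" for \<sigma>
    unfolding T_def mem_Collect_eq by (intro dfn definable_ranked D vseq_in)
  have T: "ltree (family U) s T"
    unfolding ltree_def
  proof (intro conjI ballI allI impI)
    show "s \<in> T" by (simp add: T_def)
    fix \<sigma> assume \<sigma>: "\<sigma> \<in> T"
    show "prefix \<sigma> s \<or> prefix s \<sigma>" using \<sigma> by (auto simp: T_def)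
    show "\<tau> \<in> T" if "prefix \<tau> \<sigma>" for \<tau>
    proof (cases "prefix \<tau> s")
      case False
      then have "prefix s \<tau>" using \<sigma> that unfolding T_def
        by (metis (mono_tags, lifting) mem_Collect_eq prefix_order.trans prefix_same_cases)
      moreover have "\<not> prefix \<sigma> s" using False that prefix_order.trans by blast
      ultimately show ?thesis using \<sigma> that prefix_order.trans unfolding T_def by blast
    qed (simp add: T_def)
    assume p: "prefix s \<sigma>"
    have nr: "\<rho> \<notin> ranked D" if "prefix s \<rho>" "prefix \<rho> \<sigma>" for \<rho>
    proof (cases "prefix \<sigma> s")
      case True
      then have "\<rho> = s" using that by (meson prefix_order.antisym prefix_order.trans)
      then show ?thesis using s by simp
    next
      case False
      then show ?thesis using \<sigma> that unfolding T_def by blast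
    qed
    then have "\<sigma> \<notin> ranked D" using p by blast
    then have "{i. \<sigma> @ [i] \<in> ranked D} \<notin> family U" using ranked_closed[OF D(1)] by blast
    moreover have "{i. \<sigma> @ [i] \<in> ranked D} \<in> subsets_of_omega M"
      by (intro subset_of_omega definable_ranked D dfn vseq_in)
    ultimately have "- {i. \<sigma> @ [i] \<in> ranked D} \<in> family U" by (intro family_ultra)
    then show "{i. \<sigma> @ [i] \<in> T} \<in> family U"
    proof (rule family_definable_superset[OF _ sub])
      fix i assume "i \<in> - {i. \<sigma> @ [i] \<in> ranked D}"
      then show "\<sigma> @ [i] \<in> T" unfolding T_def using nr p by (auto simp: prefix_snoc)
    qed
  qed
  have "isset (vseq ` T)"
    unfolding T_def by (intro isset_seq_set dfn definable_ranked D vseq_in)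
  note c = LU_condI[OF this T]
  show ?thesis
  proof (rule that[OF c(1,3)])
    fix d assume d: "d \<in> D"
    show "\<not> elts d \<subseteq> elts (vset (vseq ` T))"
    proof
      assume "elts d \<subseteq> elts (vset (vseq ` T))"
      then have "nodes d \<subseteq> T" unfolding c(2) by (auto simp: nodes_def)
      have l: "ltree (family U) (stem d) (nodes d)" using LU_ltree D d by blast
      \<comment> \<open>A member of \<open>D\<close> inside the tree would have its stem there, at
        or beyond \<open>s\<close>, although stems of members of \<open>D\<close> are
        ranked.\<close>
      have "prefix s (stem d)" by (rule ltree_below_stem[OF l T \<open>nodes d \<subseteq> T\<close>])
      moreover have "stem d \<in> T" using l \<open>nodes d \<subseteq> T\<close> by (auto simp: ltree_def)
      moreover have "stem d \<in> ranked D" by (rule stem_ranked[OF D(1) d l])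
      ultimately show False using s unfolding T_def
        by (metis (mono_tags, lifting) mem_Collect_eq prefix_order.antisym prefix_order.refl)
    qed
  qed
qed

end

section \<open>Laver forcing in two models\<close>

locale laver_pair = M: ultrafilter_model M U + N: ultrafilter_model N V
  for M N :: "'v::set_universe set" and U V :: 'v +
  assumes MN: "M \<subseteq> N" and UV: "elts U \<subseteq> elts V"
begin

abbreviation P :: "'v poset" where "P \<equiv> laver M U"
abbreviation Q :: "'v poset" where "Q \<equiv> laver N V"

lemma family_mono: "family U \<subseteq> family V"
  using UV by (auto simp: family_def)

lemma conds_mono: "p \<in> conds P \<Longrightarrow> p \<in> conds Q"
  unfolding M.in_LU_iff N.in_LU_iff using MN ltree_mono[OF _ family_mono] by blast

lemma common_extension:
  assumes D: "M.isset D" "D \<subseteq> conds P"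
    and dense: "\<And>T. T \<in> conds P \<Longrightarrow> stem T = s \<Longrightarrow> \<exists>d\<in>D. elts d \<subseteq> elts T"
    and T: "T \<in> conds Q" "stem T = s"
  obtains d T' where "d \<in> D" "T' \<in> conds Q" "elts T' \<subseteq> elts T" "elts T' \<subseteq> elts d"
proof -
  have "s \<in> M.ranked D"
  proof (rule ccontr)
    assume "s \<notin> M.ranked D"
    from M.unranked[OF D this] obtain T where "T \<in> conds P" "stem T = s" "\<And>d. d \<in> D \<Longrightarrow> \<not> elts d \<subseteq> elts T"
      by blast
    then show False using dense by blast
  qed
  then obtain \<alpha> where \<alpha>: "\<alpha> \<in> M" "s \<in> M.rank_le D \<alpha>" unfolding M.ranked_def by blast
  \<comment> \<open>The claim is generalized from the stem to all nodes of \<open>T\<close> beyond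
    it, because the induction moves to a successor.\<close>
  have "\<exists>d\<in>D. \<exists>T'\<in>conds Q. elts T' \<subseteq> elts T \<and> elts T' \<subseteq> elts d"
    if "\<alpha> \<in> M" "\<sigma> \<in> M.rank_le D \<alpha>" "prefix (stem T) \<sigma>" "\<sigma> \<in> nodes T" for \<alpha> \<sigma>
    using that
  proof (induction \<alpha> arbitrary: \<sigma> rule: elts_induct)
    case (1 \<alpha>)
    from 1(3) consider d where "d \<in> D" "ltree (family U) \<sigma> (nodes d)"
      | "{i. \<sigma> @ [i] \<in> \<Union>(M.rank_le D ` elts \<alpha>)} \<in> family U"
      unfolding M.rank_le_rec[OF D(1) 1(2)] M.rank_step_def by blast
    then show ?case
    proof cases
      case (1 d)
      have dP: "d \<in> conds P" using 1(1) D(2) by blast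
      then have d: "d \<in> N" "elts d \<subseteq> range vseq" using MN M.in_LU_iff by auto
      obtain w where "w \<in> conds Q" "elts w \<subseteq> elts T" "elts w \<subseteq> elts d"
        by (rule N.LU_Int[OF T(1) d ltree_mono[OF 1(2) family_mono] \<open>prefix (stem T) \<sigma>\<close> \<open>\<sigma> \<in> nodes T\<close>])
      then show ?thesis using 1(1) by blast
    next
      case 2
      have "{i. \<sigma> @ [i] \<in> nodes T} \<in> family V"
        using N.LU_ltree[OF T(1)] 1(4,5) unfolding ltree_def by blast
      \<comment> \<open>The successors of smaller rank form a set in \<open>U\<close>, hence in
        \<open>V\<close>, so they meet the successors of \<open>\<sigma>\<close> in
        \<open>T\<close>, which also form a set in \<open>V\<close>.\<close>
      then have "{i. \<sigma> @ [i] \<in> \<Union>(M.rank_le D ` elts \<alpha>)} \<inter> {i. \<sigma> @ [i] \<in> nodes T} \<noteq> {}"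
        using 2 family_mono N.family_Int N.family_empty by (metis subsetD)
      then obtain i \<beta> where i: "\<beta> \<in> elts \<alpha>" "\<sigma> @ [i] \<in> M.rank_le D \<beta>" "\<sigma> @ [i] \<in> nodes T" by blast
      have "\<beta> \<in> M" using i(1) 1(2) by blast
      moreover have "prefix (stem T) (\<sigma> @ [i])" using 1(4) by simp
      ultimately show ?thesis using 1(1)[OF i(1)] i by blast
    qed
  qed
  moreover have "stem T \<in> nodes T" using N.LU_ltree[OF T(1)] by (simp add: ltree_def)
  ultimately show ?thesis using \<alpha> T(2) that by blast
qed

text \<open>Compatibility in \<open>Q\<close> reflects to \<open>P\<close>: the stem of a common
  extension extends both stems, so these are comparable and the longer one is a node of both trees.
  The intersection of \<open>p\<close> and \<open>q\<close> is then a condition of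
  \<open>P\<close>.\<close>

lemma compatible:
  assumes p: "p \<in> conds P" "q \<in> conds P" and T: "T \<in> conds Q" "elts T \<subseteq> elts p" "elts T \<subseteq> elts q"
  shows "\<exists>r\<in>conds P. elts r \<subseteq> elts p \<and> elts r \<subseteq> elts q"
proof -
  have *: "prefix (stem p) (stem T) \<and> stem T \<in> nodes p" if "p \<in> conds P" "elts T \<subseteq> elts p" for p
  proof -
    have "nodes T \<subseteq> nodes p" using that(2) by (auto simp: nodes_def)
    then show ?thesis
      using N.ltree_below_stem[OF N.LU_ltree[OF T(1)] M.LU_ltree[OF that(1)]] N.LU_ltree[OF T(1)]
      by (auto simp: ltree_def)
  qed
  have **: "\<exists>r\<in>conds P. elts r \<subseteq> elts p \<and> elts r \<subseteq> elts q"
    if p: "p \<in> conds P" "q \<in> conds P" and T: "elts T \<subseteq> elts p" "elts T \<subseteq> elts q" and pq: "prefix (stem p) (stem q)" for p q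
  proof -
    have "stem q \<in> nodes p"
      using *[OF p(1) T(1)] *[OF p(2) T(2)] M.LU_ltree[OF p(1)] unfolding ltree_def by blast
    moreover have "q \<in> M" "elts q \<subseteq> range vseq" using p(2) M.in_LU_iff by auto
    ultimately obtain w where "w \<in> conds P" "elts w \<subseteq> elts p" "elts w \<subseteq> elts q"
      using M.LU_Int[OF p(1) _ _ M.LU_ltree[OF p(2)] pq] by blast
    then show ?thesis by blast
  qed
  have "prefix (stem p) (stem q) \<or> prefix (stem q) (stem p)"
    using *[OF p(1) T(2)] *[OF p(2) T(3)] prefix_same_cases by blast
  then show ?thesis using **[OF p T(2,3)] **[OF p(2,1) T(3,2)] by blast
qed

text \<open>A version below \<open>r\<close> of \<open>common_extension\<close>. Adding to
  \<open>D\<close> the conditions incompatible with \<open>r\<close> makes it dense everywhere, and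
  by \<open>compatible\<close> the member found above an extension of \<open>T\<close> is not one of
  these.\<close>

lemma dense_common_extension:
  assumes R: "definable M (\<lambda>e. R (e 0))" and r: "r \<in> conds P"
    and dense: "\<And>p. p \<in> conds P \<Longrightarrow> elts p \<subseteq> elts r \<Longrightarrow> \<exists>d\<in>conds P. elts d \<subseteq> elts p \<and> R d"
    and T: "T \<in> conds Q" "elts T \<subseteq> elts r"
  obtains d T' where "d \<in> conds P" "elts d \<subseteq> elts r" "R d"
    "T' \<in> conds Q" "elts T' \<subseteq> elts T" "elts T' \<subseteq> elts d"
proof -
  define D where "D = {p \<in> conds P. \<not> (\<exists>w\<in>conds P. elts w \<subseteq> elts p \<and> elts w \<subseteq> elts r) \<or> elts p \<subseteq> elts r \<and> R p}"
  have D: "M.isset D" "D \<subseteq> conds P"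
    unfolding D_def by (intro M.separation M.isset_conds dfn R M.conds_in[OF r]) blast
  have "\<exists>d\<in>D. elts d \<subseteq> elts p" if p: "p \<in> conds P" for p
  proof (cases "\<exists>w\<in>conds P. elts w \<subseteq> elts p \<and> elts w \<subseteq> elts r")
    case True
    then obtain w where w: "w \<in> conds P" "elts w \<subseteq> elts p" "elts w \<subseteq> elts r" by blast
    from dense[OF w(1,3)] obtain d where "d \<in> conds P" "elts d \<subseteq> elts w" "R d" by blast
    then have "d \<in> D" "elts d \<subseteq> elts p" using w(2,3) unfolding D_def by blast+
    then show ?thesis by blast
  qed (use p in \<open>auto simp: D_def\<close>)
  then obtain d T' where T': "d \<in> D" "T' \<in> conds Q" "elts T' \<subseteq> elts T" "elts T' \<subseteq> elts d"
    using common_extension[OF D _ T(1) refl] by blast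
  have dP: "d \<in> conds P" using T'(1) D(2) by blast
  have "elts T' \<subseteq> elts r" using T'(3) T(2) by blast
  from compatible[OF dP r T'(2,4) this] have "elts d \<subseteq> elts r" "R d" using T'(1) unfolding D_def by blast+
  with that dP T' show ?thesis by blast
qed

end

section \<open>Definability and absoluteness of the forcing relation for equality\<close>

context ultrafilter_model
begin

text \<open>\<open>eq_step Y\<close> is one unfolding of the recursive definition of forced equality, with \<open>Y\<close> used for
  the recursive calls. In both halves the names from the domain of \<open>a\<close> come first, so that
  induction on \<open>a\<close> alone applies.\<close>

definition mem_step :: "('v \<Rightarrow> 'v \<Rightarrow> 'v) \<Rightarrow> 'v \<Rightarrow> 'v \<Rightarrow> 'v \<Rightarrow> 'v \<Rightarrow> bool" where
  "mem_step pr Y q c b \<longleftrightarrow> (\<forall>q'\<in>conds LU. elts q' \<subseteq> elts q \<longrightarrow> (\<exists>r\<in>conds LU. elts r \<subseteq> elts q' \<and>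
     (\<exists>d\<in>M. \<exists>u\<in>M. vpair d u \<in> elts b \<and> elts r \<subseteq> elts u \<and> vpair r (pr c d) \<in> elts Y)))"

definition eq_step :: "'v \<Rightarrow> 'v \<Rightarrow> 'v \<Rightarrow> 'v \<Rightarrow> bool" where
  "eq_step Y r a b \<longleftrightarrow>
     (\<forall>c\<in>M. \<forall>s\<in>M. vpair c s \<in> elts a \<longrightarrow>
        (\<forall>q\<in>conds LU. elts q \<subseteq> elts r \<and> elts q \<subseteq> elts s \<longrightarrow> mem_step vpair Y q c b)) \<and>
     (\<forall>c\<in>M. \<forall>s\<in>M. vpair c s \<in> elts b \<longrightarrow>
        (\<forall>q\<in>conds LU. elts q \<subseteq> elts r \<and> elts q \<subseteq> elts s \<longrightarrow> mem_step (\<lambda>c d. vpair d c) Y q c a))"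

text \<open>\<open>X\<close> codes a ternary relation on conditions and elements of
  \<open>t\<close>. For transitive \<open>t\<close> it can only be forced equality, as shown in
  \<open>eq_fixpoint_forces_eq\<close>.\<close>

definition eq_fixpoint :: "'v \<Rightarrow> 'v \<Rightarrow> bool" where
  "eq_fixpoint t X \<longleftrightarrow> (\<forall>r\<in>conds LU. \<forall>a\<in>elts t. \<forall>b\<in>elts t. vpair r (vpair a b) \<in> elts X \<longleftrightarrow> eq_step X r a b)"

lemma mem_step_mono: "elts Y \<subseteq> elts Y' \<Longrightarrow> mem_step pr Y q c b \<Longrightarrow> mem_step pr Y' q c b"
  unfolding mem_step_def by (meson subsetD)

lemma eq_step_mono: "elts Y \<subseteq> elts Y' \<Longrightarrow> eq_step Y r a b \<Longrightarrow> eq_step Y' r a b"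
  unfolding eq_step_def using mem_step_mono by blast

lemma definable_eq_step: "definable M (\<lambda>e. eq_step (e i) (e j) (e k) (e l))"
  unfolding eq_step_def mem_step_def by (intro dfn)

text \<open>The Knaster-Tarski construction inside \<open>M\<close>: \<open>eq_step\<close> is
  monotone, and \<open>X\<close> is the intersection of all sets in \<open>M\<close> closed under
  it, cut out of a set of triples.\<close>

lemma ex_eq_fixpoint:
  assumes t: "t \<in> M"
  shows "\<exists>X\<in>M. eq_fixpoint t X"
proof -
  define W where "W = case_prod vpair ` (conds LU \<times> case_prod vpair ` (elts t \<times> elts t))"
  have W: "isset W" unfolding W_def by (intro isset_times isset_conds isset_elts t)
  have inW: "vpair r (vpair a b) \<in> W \<longleftrightarrow> r \<in> conds LU \<and> a \<in> elts t \<and> b \<in> elts t" for r a b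
    unfolding W_def by (auto simp: image_iff)
  define closed where "closed Y \<longleftrightarrow> (\<forall>r\<in>conds LU. \<forall>a\<in>elts t. \<forall>b\<in>elts t.
    eq_step Y r a b \<longrightarrow> vpair r (vpair a b) \<in> elts Y)" for Y
  have "isset {p \<in> W. \<forall>Y\<in>M. closed Y \<longrightarrow> p \<in> elts Y}"
    unfolding closed_def by (intro separation W dfn t definable_eq_step)
  then obtain X where X: "X \<in> M" "elts X = {p \<in> W. \<forall>Y\<in>M. closed Y \<longrightarrow> p \<in> elts Y}"
    by (auto simp: isset_def)
  have pre: "vpair r (vpair a b) \<in> elts X"
    if r: "r \<in> conds LU" "a \<in> elts t" "b \<in> elts t" and st: "eq_step X r a b" for r a b
  proof -
    have "vpair r (vpair a b) \<in> elts Y" if Y: "Y \<in> M" "closed Y" for Y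
    proof -
      have "elts X \<subseteq> elts Y" unfolding X(2) using Y by blast
      from eq_step_mono[OF this st] show ?thesis using Y(2) r unfolding closed_def by blast
    qed
    then show ?thesis unfolding X(2) using inW r by blast
  qed
  \<comment> \<open>A triple of \<open>X\<close> without this property could be removed and the rest
    would still be closed, contradicting the minimality of \<open>X\<close>.\<close>
  have post: "eq_step X r0 a0 b0"
    if r0: "r0 \<in> conds LU" "a0 \<in> elts t" "b0 \<in> elts t" and mem: "vpair r0 (vpair a0 b0) \<in> elts X" for r0 a0 b0
  proof (rule ccontr)
    assume n: "\<not> eq_step X r0 a0 b0"
    have in_M: "vpair r0 (vpair a0 b0) \<in> M" using elts_in[OF X(1) mem] .
    have "isset {p \<in> elts X. p \<noteq> vpair r0 (vpair a0 b0)}"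
      by (intro separation dfn isset_elts X in_M)
    then obtain Y where Y: "Y \<in> M" "elts Y = {p \<in> elts X. p \<noteq> vpair r0 (vpair a0 b0)}" by (auto simp: isset_def)
    have "closed Y"
      unfolding closed_def
    proof (intro ballI impI)
      fix r a b assume r: "r \<in> conds LU" "a \<in> elts t" "b \<in> elts t" "eq_step Y r a b"
      have "elts Y \<subseteq> elts X" unfolding Y(2) by blast
      from eq_step_mono[OF this r(4)] have st: "eq_step X r a b" .
      then have "vpair r (vpair a b) \<noteq> vpair r0 (vpair a0 b0)" using n by auto
      with pre[OF r(1-3) st] show "vpair r (vpair a b) \<in> elts Y" unfolding Y(2) by blast
    qed
    then have "vpair r0 (vpair a0 b0) \<in> elts Y" using mem Y(1) unfolding X(2) by blast
    then show False unfolding Y(2) by blast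
  qed
  show ?thesis unfolding eq_fixpoint_def using X(1) pre post by blast
qed

text \<open>Induction on \<open>a\<close> shows that every fixed point agrees with forced equality.
  Transitivity of \<open>t\<close> ensures that the names occurring in \<open>a\<close> and
  \<open>b\<close> are again in \<open>t\<close>.\<close>

lemma eq_fixpoint_forces_eq:
  assumes t: "t \<in> M" "\<And>y. y \<in> elts t \<Longrightarrow> elts y \<subseteq> elts t" and X: "eq_fixpoint t X"
  shows "r \<in> conds LU \<Longrightarrow> a \<in> elts t \<Longrightarrow> b \<in> elts t \<Longrightarrow> vpair r (vpair a b) \<in> elts X \<longleftrightarrow> forces_eq LU r a b"
proof (induction a arbitrary: r b rule: name_induct)
  case (1 a)
  have dom: "c \<in> elts t \<and> c \<in> M \<and> s \<in> M" if "vpair c s \<in> elts a" "a \<in> elts t" for a c s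
  proof -
    have "vpair c s \<in> elts t" using t(2) that by blast
    then have "vset {c} \<in> elts t" using t(2)[of "vpair c s"] by (auto simp: elts_vpair)
    then have "c \<in> elts t" using t(2)[of "vset {c}"] by auto
    moreover have "vpair c s \<in> M" using t(1) \<open>vpair c s \<in> elts t\<close> by blast
    ultimately show ?thesis by simp
  qed
  have m1: "mem_step vpair X q c b \<longleftrightarrow> forces_mem LU q c b"
    if c: "vpair c s \<in> elts a" for q c s
  proof -
    have "(\<exists>d\<in>M. \<exists>u\<in>M. vpair d u \<in> elts b \<and> elts r \<subseteq> elts u \<and> vpair r (vpair c d) \<in> elts X) \<longleftrightarrow>
      (\<exists>d u. vpair d u \<in> elts b \<and> below LU r u \<and> forces_eq LU r c d)" if r: "r \<in> conds LU" for r
      using 1(1)[OF c r] dom[OF c 1(3)] dom[OF _ 1(4)] by (metis below_laver)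
    then show ?thesis unfolding mem_step_def mem_iff by simp
  qed
  have m2: "mem_step (\<lambda>c d. vpair d c) X q c a \<longleftrightarrow> forces_mem LU q c a"
    if c: "vpair c s \<in> elts b" for q c s
  proof -
    have "(\<exists>d\<in>M. \<exists>u\<in>M. vpair d u \<in> elts a \<and> elts r \<subseteq> elts u \<and> vpair r (vpair d c) \<in> elts X) \<longleftrightarrow>
      (\<exists>d u. vpair d u \<in> elts a \<and> below LU r u \<and> forces_eq LU r c d)" if r: "r \<in> conds LU" for r
      using 1(1)[OF _ r] dom[OF c 1(4)] dom[OF _ 1(3)] eq_sym by (metis below_laver)
    then show ?thesis unfolding mem_step_def mem_iff by simp
  qed
  have "eq_step X r a b \<longleftrightarrow> forces_eq LU r a b"
    unfolding eq_step_def eq_iff[of r a b] below_laver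
  proof (rule arg_cong2[where f = "(\<and>)"])
    show "(\<forall>c\<in>M. \<forall>s\<in>M. vpair c s \<in> elts a \<longrightarrow> (\<forall>q\<in>conds LU. elts q \<subseteq> elts r \<and> elts q \<subseteq> elts s \<longrightarrow> mem_step vpair X q c b)) \<longleftrightarrow>
      (\<forall>c s. vpair c s \<in> elts a \<longrightarrow> (\<forall>q\<in>conds LU. elts q \<subseteq> elts r \<and> elts q \<subseteq> elts s \<longrightarrow> forces_mem LU q c b))"
      using m1 dom[OF _ 1(3)] by meson
    show "(\<forall>c\<in>M. \<forall>s\<in>M. vpair c s \<in> elts b \<longrightarrow> (\<forall>q\<in>conds LU. elts q \<subseteq> elts r \<and> elts q \<subseteq> elts s \<longrightarrow> mem_step (\<lambda>c d. vpair d c) X q c a)) \<longleftrightarrow>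
      (\<forall>c s. vpair c s \<in> elts b \<longrightarrow> (\<forall>q\<in>conds LU. elts q \<subseteq> elts r \<and> elts q \<subseteq> elts s \<longrightarrow> forces_mem LU q c a))"
      using m2 dom[OF _ 1(4)] by meson
  qed
  then show ?case using X 1(2-4) unfolding eq_fixpoint_def by blast
qed

text \<open>The defining formula says that some fixed point over some transitive set contains the
  triple. Fixed points are constrained only at conditions, which explains the first conjunct and its
  repetition wherever this lemma is used.\<close>

lemma definable_forces_eq:
  assumes "dterm M x" "dterm M y" "dterm M z"
  shows "definable M (\<lambda>e. x e \<in> conds LU \<and> forces_eq LU (x e) (y e) (z e))"
proof (rule definable_comp3[where R = "\<lambda>x y z. x \<in> conds LU \<and> forces_eq LU x y z", OF _ assms])
  show "definable M (\<lambda>e. e i \<in> conds LU \<and> forces_eq LU (e i) (e j) (e k))" for i j k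
  proof -
    have "definable M (\<lambda>e. e i \<in> conds LU \<and> (\<exists>t\<in>M. (\<forall>y\<in>elts t. elts y \<subseteq> elts t) \<and> e j \<in> elts t \<and> e k \<in> elts t \<and>
      (\<exists>X\<in>M. eq_fixpoint t X \<and> vpair (e i) (vpair (e j) (e k)) \<in> elts X)))"
      (is "definable M ?Q") unfolding eq_fixpoint_def by (intro dfn definable_eq_step)
    then show ?thesis
    proof (rule definable_cong)
      fix e :: "nat \<Rightarrow> 'v" assume e: "range e \<subseteq> M"
      have "\<exists>t\<in>M. (\<forall>y\<in>elts t. elts y \<subseteq> elts t) \<and> e j \<in> elts t \<and> e k \<in> elts t"
      proof -
        have "vset {e j, e k} \<in> M" using e by (intro vset_finite_in) auto
        then obtain t where t: "t \<in> M" "vset {e j, e k} \<in> elts t" "\<And>y. y \<in> elts t \<Longrightarrow> elts y \<subseteq> elts t"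
          by (rule ex_transitive_superset) blast
        with t(3)[OF t(2)] show ?thesis by (intro bexI[of _ t]) auto
      qed
      then show "?Q e = (e i \<in> conds LU \<and> forces_eq LU (e i) (e j) (e k))"
        (is "?L \<longleftrightarrow> ?R")
      proof (elim bexE conjE, intro iffI)
        assume ?L
        then show ?R using eq_fixpoint_forces_eq by blast
      next
        fix t assume R: ?R and t: "t \<in> M" "\<forall>y\<in>elts t. elts y \<subseteq> elts t" "e j \<in> elts t" "e k \<in> elts t"
        obtain X where X: "X \<in> M" "eq_fixpoint t X" using ex_eq_fixpoint[OF t(1)] by blast
        then have "vpair (e i) (vpair (e j) (e k)) \<in> elts X"
          using eq_fixpoint_forces_eq[OF t(1) _ X(2) _ t(3,4)] t(2) R by blast
        with R t X show ?L by blast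
      qed
    qed
  qed
qed

lemma definable_forces_mem:
  assumes "dterm M x" "dterm M y" "dterm M z"
  shows "definable M (\<lambda>e. x e \<in> conds LU \<and> forces_mem LU (x e) (y e) (z e))"
proof (rule definable_comp3[where R = "\<lambda>x y z. x \<in> conds LU \<and> forces_mem LU x y z", OF _ assms])
  show "definable M (\<lambda>e. e i \<in> conds LU \<and> forces_mem LU (e i) (e j) (e k))" for i j k
  proof -
    have "definable M (\<lambda>e. e i \<in> conds LU \<and> (\<forall>q\<in>conds LU. elts q \<subseteq> elts (e i) \<longrightarrow> (\<exists>r\<in>conds LU. elts r \<subseteq> elts q \<and>
      (\<exists>d\<in>M. \<exists>u\<in>M. vpair d u \<in> elts (e k) \<and> elts r \<subseteq> elts u \<and> (r \<in> conds LU \<and> forces_eq LU r (e j) d)))))"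
      (is "definable M ?Q") by (intro dfn definable_forces_eq)
    then show ?thesis
    proof (rule definable_cong)
      fix e :: "nat \<Rightarrow> 'v" assume "range e \<subseteq> M"
      then have "e k \<in> M" by auto
      then have *: "d \<in> M \<and> u \<in> M" if "vpair d u \<in> elts (e k)" for d u
        using elts_in[OF _ that] by simp
      have "(\<exists>d\<in>M. \<exists>u\<in>M. vpair d u \<in> elts (e k) \<and> elts r \<subseteq> elts u \<and> r \<in> conds LU \<and> forces_eq LU r (e j) d) \<longleftrightarrow>
        (\<exists>d u. vpair d u \<in> elts (e k) \<and> below LU r u \<and> forces_eq LU r (e j) d)" if "r \<in> conds LU" for r
        using that * by (metis below_laver)
      then show "?Q e = (e i \<in> conds LU \<and> forces_mem LU (e i) (e j) (e k))"
        unfolding mem_iff by simp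
    qed
  qed
qed

lemma dterm_check [dfn]: "dterm M t \<Longrightarrow> dterm M (\<lambda>e. check_name LU (t e))"
  by (rule check_name_in(3)) (use conds_in[OF top_in] in auto)

end

section \<open>Transfer of forced equality and membership to the larger forcing\<close>

context laver_pair
begin

lemma check_name_eq: "check_name P x = check_name Q x"
  by (rule check_name_cong) (simp add: laver_def)

lemma names_mono: "x \<in> names M P \<Longrightarrow> x \<in> names N Q"
proof (induction rule: names.induct)
  case (1 x)
  then show ?case using MN conds_mono by (intro names.intros) blast+
qed

text \<open>Absoluteness of equality is the hypothesis \<open>IH\<close>, restricted to the names
  occurring in \<open>b\<close>, so that the lemma serves both inside the induction on equality and
  after it. Conditions of \<open>P\<close> that decide which element of \<open>b\<close> equals
  \<open>c\<close> are dense below \<open>r\<close>, and every \<open>q\<close> in \<open>Q\<close>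
  below \<open>r\<close> has an extension below one of them.\<close>

lemma forces_mem_absolute_aux:
  assumes r: "r \<in> conds P" "forces_mem P r c b" and c: "c \<in> M" and b: "b \<in> names M P"
    and IH: "\<And>d u p. vpair d u \<in> elts b \<Longrightarrow> p \<in> conds P \<Longrightarrow> forces_eq P p c d \<Longrightarrow> forces_eq Q p c d"
  shows "forces_mem Q r c b"
  unfolding N.mem_iff
proof (intro ballI impI)
  fix q assume q: "q \<in> conds Q" "below Q q r"
  define R where "R p \<longleftrightarrow>
    (\<exists>d\<in>M. \<exists>u\<in>M. vpair d u \<in> elts b \<and> elts p \<subseteq> elts u \<and> (p \<in> conds P \<and> forces_eq P p c d))" for p
  have dR: "definable M (\<lambda>e. R (e 0))"
    unfolding R_def by (intro dfn M.definable_forces_eq c M.names_in[OF b])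
  have dense: "\<exists>p\<in>conds P. elts p \<subseteq> elts w \<and> R p" if w: "w \<in> conds P" "elts w \<subseteq> elts r" for w
  proof -
    have "below P w r" using w(2) by simp
    from r(2)[unfolded M.mem_iff, rule_format, OF w(1) this]
    obtain p d u where p: "p \<in> conds P" "below P p w" "vpair d u \<in> elts b" "below P p u" "forces_eq P p c d"
      by blast
    have "vpair d u \<in> M" using M.elts_in[OF M.names_in[OF b] p(3)] .
    then have "R p" using p unfolding R_def by auto
    then show ?thesis using p(1,2) by auto
  qed
  have qr: "elts q \<subseteq> elts r" using q(2) by simp
  obtain d T where "d \<in> conds P" "elts d \<subseteq> elts r" "R d"
    "T \<in> conds Q" "elts T \<subseteq> elts q" "elts T \<subseteq> elts d"
    by (rule dense_common_extension[where R = R, OF dR r(1) dense q(1) qr])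
  note T = this(1,3-6)
  from T(2) obtain c' u where cu: "vpair c' u \<in> elts b" "elts d \<subseteq> elts u" "forces_eq P d c c'"
    unfolding R_def by blast
  have "forces_eq Q d c c'" by (rule IH[OF cu(1) T(1) cu(3)])
  then have "forces_eq Q T c c'" by (rule N.eq_mono) (use T(5) in simp)
  with T cu show "\<exists>r\<in>conds Q. below Q r q \<and> (\<exists>c' s. vpair c' s \<in> elts b \<and> below Q r s \<and> forces_eq Q r c c')"
    by (intro bexI[of _ T] conjI exI[of _ c'] exI[of _ u]) auto
qed

lemma forces_eq_absolute:
  "a \<in> names M P \<Longrightarrow> b \<in> names M P \<Longrightarrow> r \<in> conds P \<Longrightarrow> forces_eq P r a b \<Longrightarrow> forces_eq Q r a b"
proof (induction a arbitrary: b r rule: name_induct)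
  case (1 a)
  have main: "forces_mem Q q c b"
    if ab: "a \<in> names M P" "b \<in> names M P" "forces_eq P r a b"
      and IH: "\<And>c s d u p. vpair c s \<in> elts a \<Longrightarrow> vpair d u \<in> elts b \<Longrightarrow> p \<in> conds P \<Longrightarrow>
        forces_eq P p c d \<Longrightarrow> forces_eq Q p c d"
      and c: "vpair c s \<in> elts a" and q: "q \<in> conds Q" "below Q q r" "below Q q s" for a b c s q
  proof (rule N.mem_dense, intro ballI impI)
    fix q' assume q': "q' \<in> conds Q" "below Q q' q"
    have cs: "c \<in> names M P" "s \<in> conds P" using M.names_vpair[OF ab(1) c] by auto
    \<comment> \<open>The forced equality in \<open>P\<close> can be used only at conditions of
      \<open>P\<close> below both \<open>r\<close> and \<open>s\<close>. Conditions below
      \<open>s\<close> or incompatible with \<open>s\<close> are dense, and since \<open>q'\<close>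
      lies below \<open>s\<close>, the one found is below \<open>s\<close>.\<close>
    define R where "R p \<longleftrightarrow> \<not> (\<exists>w\<in>conds P. elts w \<subseteq> elts p \<and> elts w \<subseteq> elts s) \<or> elts p \<subseteq> elts s" for p
    have dR: "definable M (\<lambda>e. R (e 0))"
      unfolding R_def by (intro dfn M.conds_in[OF cs(2)])
    have dense: "\<exists>d\<in>conds P. elts d \<subseteq> elts p \<and> R d" if "p \<in> conds P" for p
      using that unfolding R_def by blast
    have qr: "elts q' \<subseteq> elts r" using q'(2) q(2) by simp
    obtain d T where "d \<in> conds P" and d: "elts d \<subseteq> elts r" "R d"
      and "T \<in> conds Q" "elts T \<subseteq> elts q'" "elts T \<subseteq> elts d"
      by (rule dense_common_extension[where R = R, OF dR 1(4) dense q'(1) qr])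
    note T = this(1,4-6)
    have "elts T \<subseteq> elts s" using T(3) q'(2) q(3) by simp
    from compatible[OF T(1) cs(2) T(2,4) this] d(2) have "elts d \<subseteq> elts s" unfolding R_def by blast
    then have "forces_mem P d c b" using M.eq_memD[OF ab(3) c T(1)] d(1) by simp
    then have "forces_mem Q d c b"
      using forces_mem_absolute_aux[OF T(1) _ M.names_in[OF cs(1)] ab(2)] IH[OF c] by blast
    then have "forces_mem Q T c b" by (rule N.mem_mono) (use T(4) in simp)
    then show "\<exists>r\<in>conds Q. below Q r q' \<and> forces_mem Q r c b" using T(2,3) by auto
  qed
  have IH: "forces_eq Q p c d" if "vpair c s \<in> elts a" "vpair d u \<in> elts b" "p \<in> conds P" "forces_eq P p c d" for c s d u p
    using 1(1)[OF that(1) _ _ that(3,4)] M.names_vpair[OF 1(2) that(1)] M.names_vpair[OF 1(3) that(2)] by blast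
  have IH': "forces_eq Q p c d" if "vpair c s \<in> elts b" "vpair d u \<in> elts a" "p \<in> conds P" "forces_eq P p c d" for c s d u p
    using N.eq_sym[OF IH[OF that(2,1,3) M.eq_sym[OF that(4)]]] .
  have "forces_mem Q q c b" if "vpair c s \<in> elts a" "q \<in> conds Q" "below Q q r" "below Q q s" for c s q
    by (rule main[OF 1(2,3,5) _ that]) (rule IH)
  moreover have "forces_mem Q q c a" if "vpair c s \<in> elts b" "q \<in> conds Q" "below Q q r" "below Q q s" for c s q
    by (rule main[OF 1(3,2) M.eq_sym[OF 1(5)] _ that]) (rule IH')
  ultimately show ?case unfolding N.eq_iff[of r a b] by blast
qed

lemma forces_mem_absolute:
  "r \<in> conds P \<Longrightarrow> a \<in> names M P \<Longrightarrow> b \<in> names M P \<Longrightarrow> forces_mem P r a b \<Longrightarrow> forces_mem Q r a b"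
  by (rule forces_mem_absolute_aux) (use forces_eq_absolute M.names_vpair M.names_in in blast)+

end

section \<open>Reading off a real from a name\<close>

lemma interval_disjoint: "i \<in> interval k \<Longrightarrow> i \<in> interval l \<Longrightarrow> k = l"
proof (induction k l rule: linorder_wlog)
  case (le k l)
  show ?case
  proof (rule ccontr)
    assume "k \<noteq> l"
    then have "(2::nat) ^ (k + 2) \<le> 2 ^ (l + 1)" using le(1) by (intro power_increasing) auto
    then show False using le(2,3) by (auto simp: interval_def)
  qed
qed auto

lemma finite_interval [simp]: "finite (interval k)"
  by (simp add: interval_def)

definition vbit :: "bool \<Rightarrow> 'v::set_universe" where
  "vbit b = vnat (if b then 1 else 0)"

lemma real_graph_vbit: "real_graph f = range (\<lambda>n. vpair (vnat n) (vbit (f n)))"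
  by (simp add: real_graph_def vbit_def)

lemma vbit_inject [simp]: "vbit b = vbit c \<longleftrightarrow> b = c"
  by (auto simp: vbit_def)

definition block :: "nat \<Rightarrow> (nat \<Rightarrow> bool) \<Rightarrow> 'v::set_universe" where
  "block k f = vset ((\<lambda>i. vpair (vnat i) (vbit (f i))) ` interval k)"

lemma elts_block: "elts (block k f) = (\<lambda>i. vpair (vnat i) (vbit (f i))) ` interval k"
  by (simp add: block_def)

context ultrafilter_model
begin

lemma vbit_in [simp]: "vbit b \<in> M"
  by (simp add: vbit_def)

lemma block_in: "block k f \<in> M"
  unfolding block_def by (intro vset_finite_in) auto

section \<open>Blocks of the real that cannot be excluded\<close>

lemma decide_finitely_many:
  assumes h: "name_for_real M LU h" and T: "T \<in> conds LU"
  shows "finite J \<Longrightarrow> \<exists>T'\<in>conds LU. elts T' \<subseteq> elts T \<and>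
    (\<exists>f. \<forall>i\<in>J. forces_mem LU T' (check_name LU (vpair (vnat i) (vbit (f i)))) h)"
proof (induction J rule: finite_induct)
  case empty
  then show ?case using T by blast
next
  case (insert j J)
  then obtain T' f where T': "T' \<in> conds LU" "elts T' \<subseteq> elts T"
    "\<forall>i\<in>J. forces_mem LU T' (check_name LU (vpair (vnat i) (vbit (f i)))) h"
    by blast
  obtain S b where S: "S \<in> conds LU" "below LU S T'" "b < 2"
    "forces_mem LU S (check_name LU (vpair (vnat j) (vnat b))) h"
    using real_total[OF h T'(1), of j] by blast
  have b: "vnat b = (vbit (b = 1) :: 'v)" using S(3) by (auto simp: vbit_def)
  have "forces_mem LU S (check_name LU (vpair (vnat i) (vbit ((f(j := (b = 1))) i)))) h" if "i \<in> insert j J" for i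
    using that S(4) b mem_mono[OF _ S(2)] T'(3) by auto
  moreover have "elts S \<subseteq> elts T" using S(2) T'(2) by simp
  ultimately show ?case using S(1) by blast
qed

text \<open>Intersecting two conditions with stem \<open>s\<close> does not lengthen the stem, so
  finitely many downward closed properties, each attained by such a condition, are attained
  simultaneously.\<close>

lemma stem_Int_finite:
  assumes "finite I" "I \<noteq> {}" "\<And>A. A \<in> I \<Longrightarrow> \<exists>T\<in>conds LU. stem T = s \<and> R A T"
    and R: "\<And>A T T'. R A T \<Longrightarrow> elts T' \<subseteq> elts T \<Longrightarrow> R A T'"
  shows "\<exists>T\<in>conds LU. stem T = s \<and> (\<forall>A\<in>I. R A T)"
  using assms(1-3)
proof (induction I rule: finite_ne_induct)
  case (singleton A)
  then show ?case by auto
next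
  case (insert A I)
  then obtain T S where T: "T \<in> conds LU" "stem T = s" "\<forall>A\<in>I. R A T"
    and S: "S \<in> conds LU" "stem S = s" "R A S"
    by (metis insertCI)
  have "S \<in> M" "elts S \<subseteq> range vseq" "ltree (family U) s (nodes S)" "s \<in> nodes T"
    using S in_LU_iff LU_ltree[OF S(1)] LU_ltree[OF T(1)] T(2) by (auto simp: ltree_def)
  with LU_Int[OF T(1) this(1-3)] T(2)
  obtain W where "W \<in> conds LU" "elts W \<subseteq> elts T" "elts W \<subseteq> elts S" "stem W = s" by blast
  then show ?case using T(3) S(3) R by blast
qed

lemma ex_good_block:
  assumes h: "name_for_real M LU h"
  obtains f where "\<And>T. T \<in> conds LU \<Longrightarrow> stem T = s \<Longrightarrow>
    \<exists>T'\<in>conds LU. elts T' \<subseteq> elts T \<and> (\<forall>p\<in>elts (block k f). forces_mem LU T' (check_name LU p) h)"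
proof -
  \<comment> \<open>Indexing blocks by the subset of the interval where they are true makes it
    evident that there are finitely many.\<close>
  define bl :: "nat set \<Rightarrow> 'v" where "bl A = block k (\<lambda>i. i \<in> A)" for A
  define R where "R A T \<longleftrightarrow> (\<forall>T'\<in>conds LU. elts T' \<subseteq> elts T \<longrightarrow> \<not> (\<forall>p\<in>elts (bl A). forces_mem LU T' (check_name LU p) h))" for A T
  have "\<exists>A\<in>Pow (interval k). \<forall>T\<in>conds LU. stem T = s \<longrightarrow> \<not> R A T"
  proof (rule ccontr)
    assume n: "\<not> ?thesis"
    have "\<exists>T\<in>conds LU. stem T = s \<and> (\<forall>A\<in>Pow (interval k). R A T)"
    proof (rule stem_Int_finite)
      show "\<exists>T\<in>conds LU. stem T = s \<and> R A T" if "A \<in> Pow (interval k)" for A using n that by blast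
      show "R A T'" if "R A T" "elts T' \<subseteq> elts T" for A T T' using that unfolding R_def by blast
    qed auto
    then obtain T where T: "T \<in> conds LU" "\<forall>A\<in>Pow (interval k). R A T" by blast
    obtain T' f where T': "T' \<in> conds LU" "elts T' \<subseteq> elts T"
      "\<forall>i\<in>interval k. forces_mem LU T' (check_name LU (vpair (vnat i) (vbit (f i)))) h"
      using decide_finitely_many[OF h T(1) finite_interval] by blast
    define A where "A = {i \<in> interval k. f i}"
    have "\<forall>p\<in>elts (bl A). forces_mem LU T' (check_name LU p) h"
      using T'(3) unfolding bl_def elts_block A_def by auto
    moreover have "A \<in> Pow (interval k)" by (auto simp: A_def)
    ultimately show False using T(2) T'(1,2) unfolding R_def by blast
  qed
  then obtain A where "\<forall>T\<in>conds LU. stem T = s \<longrightarrow> \<not> R A T" by blast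
  then show ?thesis using that[of "\<lambda>i. i \<in> A"] unfolding R_def bl_def by blast
qed

text \<open>The choice is made in \<open>M\<close> from the sets \<open>Y (I k)\<close> of blocks on
  \<open>interval k\<close> that cannot be excluded. These sets are disjoint for different intervals
  because a block determines its domain, so the transversal form of Choice applies; the union of the
  chosen blocks is the graph of \<open>g\<close>.\<close>

lemma ex_real:
  assumes h: "name_for_real M LU h"
  obtains g where "g \<in> reals_of M" "\<And>T k. T \<in> conds LU \<Longrightarrow> stem T = s \<Longrightarrow>
    \<exists>T'\<in>conds LU. elts T' \<subseteq> elts T \<and> (\<forall>p\<in>elts (block k g). forces_mem LU T' (check_name LU p) h)"
proof -
  have hM: "h \<in> M" using h names_in by (auto simp: name_for_real_def)
  \<comment> \<open>This says that \<open>z\<close> is a function from \<open>j\<close> to 2; the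
    negated equivalence is an exclusive disjunction of the two bits.\<close>
  define isf where "isf j z \<longleftrightarrow> (\<forall>p\<in>elts z. \<exists>i\<in>elts j. p = vpair i (vbit False) \<or> p = vpair i (vbit True)) \<and>
    (\<forall>i\<in>elts j. \<not> (vpair i (vbit False) \<in> elts z \<longleftrightarrow> vpair i (vbit True) \<in> elts z))" for j z :: 'v
  \<comment> \<open>The stem is fixed through \<open>ltree\<close>, which is definable, and
    \<open>T' \<in> conds LU\<close> is repeated to match
    \<open>definable_forces_mem\<close>.\<close>
  define good where "good z \<longleftrightarrow> (\<forall>T\<in>conds LU. ltree (family U) s (nodes T) \<longrightarrow>
    (\<exists>T'\<in>conds LU. elts T' \<subseteq> elts T \<and> (\<forall>p\<in>elts z. T' \<in> conds LU \<and> forces_mem LU T' (check_name LU p) h)))" for z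
  define B where "B = {x \<in> M. elts x \<subseteq> case_prod vpair ` (range vnat \<times> range vnat)}"
  have B: "isset B" unfolding B_def by (intro isset_Pow isset_times isset_omega)
  define Y where "Y j = vset {z \<in> B. isf j z \<and> good z}" for j
  have dY: "definable M (\<lambda>e. isf (e j) (e i) \<and> good (e i))" for i j
    unfolding isf_def good_def by (intro dfn definable_forces_mem hM vseq_in vbit_in)
  have elts_Y: "elts (Y j) = {z \<in> B. isf j z \<and> good z}" if "j \<in> M" for j
  proof -
    have "isset {z \<in> B. isf j z \<and> good z}"
    proof (rule separation[OF B])
      show "definable M (\<lambda>e. isf j (e 0) \<and> good (e 0))"
        unfolding isf_def good_def by (intro dfn definable_forces_mem hM vseq_in vbit_in that)
    qed
    then show ?thesis unfolding Y_def by (rule isset_vset(2))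
  qed
  have dterm_Y: "dterm M (\<lambda>e. Y (e 0))"
    unfolding Y_def
  proof (rule dterm_vset)
    fix e :: "nat \<Rightarrow> 'v" assume "range e \<subseteq> M"
    then have "e 0 \<in> M" by auto
    show "isset {z \<in> B. isf (e 0) z \<and> good z}"
    proof (rule separation[OF B])
      show "definable M (\<lambda>e'. isf (e 0) (e' 0) \<and> good (e' 0))"
        unfolding isf_def good_def by (intro dfn definable_forces_mem hM vseq_in vbit_in \<open>e 0 \<in> M\<close>)
    qed
  next
    show "definable M (\<lambda>e. e 0 \<in> {z \<in> B. isf (e (Suc 0)) z \<and> good z})"
      unfolding mem_Collect_eq by (intro definable_conj dY definable_isset[OF B] dterm_var)
  qed
  define I :: "nat \<Rightarrow> 'v" where "I k = vset (vnat ` interval k)" for k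
  have I: "I k \<in> M" "elts (I k) = vnat ` interval k" for k
    unfolding I_def by (auto intro!: vset_finite_in)
  have isset_I: "isset (range I)"
  proof (rule separation_subset)
    show "isset {x \<in> M. elts x \<subseteq> range vnat}" by (intro isset_Pow isset_omega)
    show "range I \<subseteq> {x \<in> M. elts x \<subseteq> range vnat}" using I by auto
    show "definable M (\<lambda>e. e 0 \<in> range I)"
    proof (rule definable_cong)
      show "definable M (\<lambda>e. \<exists>k. vpair (vnat k) (e 0) \<in> elts vintervals)"
        by (intro dfn elts_vintervals)
      show "(\<exists>k. vpair (vnat k) (e 0) \<in> elts vintervals) = (e 0 \<in> range I)" for e
        unfolding elts_vintervals(2) I_def image_iff by auto
    qed
  qed
  have isf_block: "isf (I k) (block k f)" for k f
    unfolding isf_def elts_block I(2) by (auto simp: image_iff)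
  have nonempty: "elts (Y (I k)) \<noteq> {}" for k
  proof -
    obtain f where f: "\<And>T. T \<in> conds LU \<Longrightarrow> stem T = s \<Longrightarrow>
      \<exists>T'\<in>conds LU. elts T' \<subseteq> elts T \<and> (\<forall>p\<in>elts (block k f). forces_mem LU T' (check_name LU p) h)"
      using ex_good_block[OF h] by blast
    have "good (block k f)" unfolding good_def using f stem_eq by blast
    moreover have "block k f \<in> B" unfolding B_def using block_in by (auto simp: elts_block vbit_def)
    ultimately show ?thesis unfolding elts_Y[OF I(1)] using isf_block by blast
  qed
  have isf_elts: "i \<in> elts j \<longleftrightarrow> (\<exists>b. vpair i (vbit b) \<in> elts z)" if "isf j z" for i j z
    using that unfolding isf_def by (metis vpair_inject)
  have "isset (Y ` range I)" by (intro replacement_image dterm_Y isset_I)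
  then obtain C where C: "C \<in> M" "\<And>y. y \<in> Y ` range I \<Longrightarrow> \<exists>z. elts y \<inter> elts C = {z}"
  proof (rule choice)
    show "elts y \<noteq> {}" if "y \<in> Y ` range I" for y using that nonempty by blast
    fix x y assume xy: "x \<in> Y ` range I" "y \<in> Y ` range I" "x \<noteq> y"
    show "elts x \<inter> elts y = {}"
    proof (rule ccontr)
      assume "elts x \<inter> elts y \<noteq> {}"
      then obtain z where z: "z \<in> elts x" "z \<in> elts y" by blast
      obtain k l where kl: "x = Y (I k)" "y = Y (I l)" using xy by blast
      have "isf (I k) z" "isf (I l) z" using z unfolding kl elts_Y[OF I(1)] by auto
      then have "elts (I k) = elts (I l)" using isf_elts by blast
      then have "I k = I l" by (rule elts_inject)
      with kl xy(3) show False by simp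
    qed
  qed blast
  have "\<exists>z. elts (Y (I k)) \<inter> elts C = {z}" for k using C(2) by blast
  then obtain z where z: "\<And>k. elts (Y (I k)) \<inter> elts C = {z k}" by metis
  have zk: "isf (I k) (z k)" "good (z k)" "z k \<in> B" for k
    using z[of k] unfolding elts_Y[OF I(1)] by blast+
  define W where "W = {p \<in> case_prod vpair ` (range vnat \<times> range vnat).
    \<exists>y\<in>Y ` range I. \<exists>z\<in>elts y. z \<in> elts C \<and> p \<in> elts z}"
  obtain F where F: "F \<in> M" "elts F = Y ` range I" using \<open>isset (Y ` range I)\<close> by (auto simp: isset_def)
  have "isset W"
    unfolding W_def F(2)[symmetric] by (intro separation isset_times isset_omega dfn F C(1))
  have W: "p \<in> W \<longleftrightarrow> (\<exists>k. p \<in> elts (z k))" for p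
  proof
    assume "p \<in> W"
    then obtain k z' where "z' \<in> elts (Y (I k))" "z' \<in> elts C" "p \<in> elts z'" unfolding W_def by blast
    then have "z' \<in> elts (Y (I k)) \<inter> elts C" by blast
    then have "z' = z k" unfolding z by simp
    with \<open>p \<in> elts z'\<close> show "\<exists>k. p \<in> elts (z k)" by blast
  next
    assume "\<exists>k. p \<in> elts (z k)"
    then obtain k where k: "p \<in> elts (z k)" ..
    then have "p \<in> case_prod vpair ` (range vnat \<times> range vnat)" using zk(3)[of k] unfolding B_def by blast
    then show "p \<in> W" unfolding W_def using z[of k] k by blast
  qed
  \<comment> \<open>The intervals are disjoint, so the bit at \<open>i\<close> comes from the block
    of the one interval containing \<open>i\<close>.\<close>
  have Wk: "vpair (vnat i) (vbit b) \<in> W \<longleftrightarrow> vpair (vnat i) (vbit b) \<in> elts (z k)" if i: "i \<in> interval k" for i k b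
  proof
    assume "vpair (vnat i) (vbit b) \<in> W"
    then obtain l where l: "vpair (vnat i) (vbit b) \<in> elts (z l)" using W by blast
    then have "vnat i \<in> elts (I l)" using isf_elts[OF zk(1)] by blast
    then have "l = k" using i interval_disjoint unfolding I(2) by auto
    with l show "vpair (vnat i) (vbit b) \<in> elts (z k)" by simp
  qed (use W in blast)
  define g where "g i \<longleftrightarrow> vpair (vnat i) (vbit True) \<in> W" for i
  have g: "vpair (vnat i) (vbit (g i)) \<in> elts (z k)" if i: "i \<in> interval k" for i k
  proof -
    have "vnat i \<in> elts (I k)" using i I(2) by blast
    then have "\<not> (vpair (vnat i) (vbit False) \<in> elts (z k) \<longleftrightarrow> vpair (vnat i) (vbit True) \<in> elts (z k))"
      using zk(1)[of k] unfolding isf_def by blast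
    then show ?thesis using Wk[OF i] unfolding g_def by (cases "vpair (vnat i) (vbit True) \<in> W") auto
  qed
  have zg: "elts (z k) = elts (block k g)" for k
    unfolding elts_block
  proof (intro equalityI subsetI)
    fix p assume p: "p \<in> elts (z k)"
    then obtain i b where ib: "i \<in> interval k" "p = vpair (vnat i) (vbit b)"
      using zk(1)[of k] unfolding isf_def I(2) by blast
    have "\<not> (vpair (vnat i) (vbit False) \<in> elts (z k) \<longleftrightarrow> vpair (vnat i) (vbit True) \<in> elts (z k))"
      using zk(1)[of k] ib(1) unfolding isf_def I(2) by blast
    then have "b = g i" using p g[OF ib(1)] unfolding ib(2) by (cases b; cases "g i") auto
    then show "p \<in> (\<lambda>i. vpair (vnat i) (vbit (g i))) ` interval k" using ib by blast
  qed (use g in blast)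
  have "real_graph g = W"
  proof (intro equalityI subsetI)
    fix p :: 'v assume "p \<in> real_graph g"
    then obtain i where i: "p = vpair (vnat i) (vbit (g i))" unfolding real_graph_vbit by blast
    obtain k where "i \<in> interval k" using interval_cover by blast
    from g[OF this] show "p \<in> W" unfolding W i by blast
  next
    fix p assume "p \<in> W"
    then show "p \<in> real_graph g" unfolding W zg elts_block real_graph_vbit by blast
  qed
  then have "g \<in> reals_of M" using \<open>isset W\<close> by (auto simp: reals_of_def isset_def)
  moreover have "\<exists>T'\<in>conds LU. elts T' \<subseteq> elts T \<and> (\<forall>p\<in>elts (block k g). forces_mem LU T' (check_name LU p) h)"
    if T: "T \<in> conds LU" "stem T = s" for T k
    using zk(2)[of k] T LU_ltree[OF T(1)] unfolding good_def zg by blast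
  ultimately show ?thesis by (rule that)
qed

end


section \<open>Unbounded reals are preserved\<close>

context laver_pair
begin

text \<open>A condition that does not force \<open>x\<close> to differ from \<open>z\<close> has an
  extension forcing equality. So the hypothesis says that such conditions occur below every
  condition with stem \<open>s\<close>, which is what \<open>common_extension\<close> asks
  for.\<close>

lemma not_forces_neq:
  assumes x: "x \<in> names M P" and z: "z \<in> M"
    and P: "\<And>T. T \<in> conds P \<Longrightarrow> stem T = s \<Longrightarrow> \<not> forces_neq M P T x z"
    and T: "T \<in> conds Q" "stem T = s"
  shows "\<not> forces_neq N Q T x z"
proof
  assume neq: "forces_neq N Q T x z"
  define D where "D = {p \<in> conds P. p \<in> conds P \<and> forces_eq P p x (check_name P z)}"
  have D: "M.isset D" "D \<subseteq> conds P"
    unfolding D_def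
    by (intro M.separation M.isset_conds M.definable_forces_eq dfn M.names_in[OF x] M.check_in_M z) blast
  have dense: "\<exists>d\<in>D. elts d \<subseteq> elts T" if "T \<in> conds P" "stem T = s" for T
    using P[OF that] unfolding forces_neq_def D_def by auto
  obtain d T' where T': "d \<in> D" "T' \<in> conds Q" "elts T' \<subseteq> elts T" "elts T' \<subseteq> elts d"
    by (rule common_extension[OF D dense T])
  then have "forces_eq Q d x (check_name P z)"
    using forces_eq_absolute[OF x M.check_name_name[OF z]] unfolding D_def by blast
  then have "forces_eq Q T' x (check_name Q z)"
    unfolding check_name_eq by (rule N.eq_mono) (use T'(4) in simp)
  then show False using neq T'(2,3) unfolding forces_neq_def by simp
qed

text \<open>The name \<open>\<tau>\<close> is arbitrary in \<open>N\<close>, so absoluteness says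
  nothing about it directly. Being forced into \<open>h\<close>, it is equal below some condition to
  a name \<open>\<rho>\<close> occurring in \<open>h\<close>, which lies in \<open>M\<close> and
  whose value conditions of \<open>P\<close> can decide. The condition \<open>r\<close> is kept in
  order to apply uniqueness of values in \<open>P\<close>.\<close>

lemma real_elt_Q:
  assumes h: "name_for_real M P h" and T: "T \<in> conds Q" "forces_mem Q T \<tau> h"
  obtains T' r n b where "T' \<in> conds Q" "elts T' \<subseteq> elts T" "r \<in> conds P" "elts T' \<subseteq> elts r"
    "forces_eq Q T' \<tau> (check_name Q (vpair (vnat n) (vnat b)))"
    "forces_mem P r (check_name P (vpair (vnat n) (vnat b))) h"
proof -
  have hn: "h \<in> names M P" using h by (simp add: name_for_real_def)
  obtain S \<rho> u where S: "S \<in> conds Q" "below Q S T" "vpair \<rho> u \<in> elts h" "below Q S u" "forces_eq Q S \<tau> \<rho>"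
    using T(2)[unfolded N.mem_iff, rule_format, OF T(1) N.below_refl] by blast
  have \<rho>: "\<rho> \<in> names M P" "u \<in> conds P" using M.names_vpair[OF hn S(3)] by auto
  define R where "R p \<longleftrightarrow>
    (\<exists>n b. (p \<in> conds P \<and> forces_eq P p \<rho> (check_name P (vpair (vnat n) (vnat b)))) \<and>
      (p \<in> conds P \<and> forces_mem P p (check_name P (vpair (vnat n) (vnat b))) h))" for p
  have dR: "definable M (\<lambda>e. R (e 0))"
    unfolding R_def
    by (intro M.definable_forces_eq M.definable_forces_mem dfn M.names_in[OF \<rho>(1)] M.names_in[OF hn])
  have dense: "\<exists>d\<in>conds P. elts d \<subseteq> elts w \<and> R d" if w: "w \<in> conds P" "elts w \<subseteq> elts u" for w
  proof -
    have wh: "forces_mem P w \<rho> h" using M.mem_of_elt[OF S(3)] w(2) by simp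
    then obtain q n b where q: "q \<in> conds P" "below P q w" "forces_eq P q \<rho> (check_name P (vpair (vnat n) (vnat b)))"
      using M.real_elt[OF h w(1) \<rho>(1)] by blast
    have "forces_mem P q (check_name P (vpair (vnat n) (vnat b))) h"
      using M.mem_eq_left[OF q(3) M.mem_mono[OF wh q(2)]] .
    then show ?thesis using q unfolding R_def by auto
  qed
  have Su: "elts S \<subseteq> elts u" using S(4) by simp
  obtain d T' where dP: "d \<in> conds P" "elts d \<subseteq> elts u"
    and T': "R d" "T' \<in> conds Q" "elts T' \<subseteq> elts S" "elts T' \<subseteq> elts d"
    by (rule dense_common_extension[where R = R, OF dR \<rho>(2) dense S(1) Su])
  from T'(1) obtain n b where nb: "forces_eq P d \<rho> (check_name P (vpair (vnat n) (vnat b)))"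
      "forces_mem P d (check_name P (vpair (vnat n) (vnat b))) h"
    unfolding R_def by blast
  have "forces_eq Q d \<rho> (check_name Q (vpair (vnat n) (vnat b)))"
    using forces_eq_absolute[OF \<rho>(1) _ dP(1) nb(1)] unfolding check_name_eq[symmetric] by simp
  then have "forces_eq Q T' \<rho> (check_name Q (vpair (vnat n) (vnat b)))"
    by (rule N.eq_mono) (use T'(4) in simp)
  then have "forces_eq Q T' \<tau> (check_name Q (vpair (vnat n) (vnat b)))"
    using N.eq_trans[OF N.eq_mono[OF S(5)]] T'(3) by simp
  moreover have "elts T' \<subseteq> elts T" using T'(3) S(2) by simp
  ultimately show ?thesis using that T'(2,4) dP nb(2) by blast
qed

text \<open>Although \<open>c\<close> need not be in \<open>M\<close>, its restriction to a late
  interval coincides with that of a real \<open>g\<close> in \<open>M\<close>. A condition of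
  \<open>P\<close> forcing this block into \<open>h\<close> contradicts a forced disagreement,
  whichever of \<open>c\<close> and \<open>h\<close> is said to contain the pair.\<close>

lemma star_laver:
  assumes c: "c \<in> reals_of N" and unb: "pitchfork_unbounded_over M c"
  shows "star P Q M N c"
  unfolding star_def forced_def forces.simps
proof (intro allI impI ballI notI)
  fix h p q
  assume h: "name_for_real M P h" and "p \<in> conds Q" and q: "q \<in> conds Q" "below Q q p"
    and f: "forces N Q q (pitchfork_fm 0 1 2 3)
      (nth [check_name Q (vset (real_graph c)), h, check_name Q vintervals, check_name Q vomega])"
  have hn: "h \<in> names M P" using h by (simp add: name_for_real_def)
  obtain cc where cc: "cc \<in> N" "elts cc = real_graph c" using c by (auto simp: reals_of_def)
  then have vc: "vset (real_graph c) = cc" by (intro vset_eqI)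
  let ?c = "check_name Q cc"
  obtain r n where r: "r \<in> conds Q" "below Q r q"
    and R: "\<And>k p. n \<le> k \<Longrightarrow> p \<in> conds Q \<Longrightarrow> below Q p r \<Longrightarrow>
      \<exists>s\<in>conds Q. below Q s p \<and> (\<exists>i\<in>interval k. \<exists>y\<in>names N Q.
        let \<tau> = N.opn (check_name Q (vnat i)) y in
        forces_mem Q s \<tau> ?c \<and> (\<forall>t\<in>conds Q. below Q t s \<longrightarrow> \<not> forces_mem Q t \<tau> h) \<or>
        forces_mem Q s \<tau> h \<and> (\<forall>t\<in>conds Q. below Q t s \<longrightarrow> \<not> forces_mem Q t \<tau> ?c))"
    using N.forces_pitchfork[OF q(1) N.check_name_name[OF cc(1)] names_mono[OF hn] f[unfolded vc]] by blast
  obtain g where g: "g \<in> reals_of M" and G: "\<And>T k. T \<in> conds P \<Longrightarrow> stem T = stem r \<Longrightarrow>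
    \<exists>T'\<in>conds P. elts T' \<subseteq> elts T \<and> (\<forall>p\<in>elts (block k g). forces_mem P T' (check_name P p) h)"
    using M.ex_real[OF h] by blast
  have "\<not> c \<pitchfork> g" using unb g by (simp add: pitchfork_unbounded_over_def)
  then have "\<exists>\<^sub>\<infinity>k. restrict c (interval k) = restrict g (interval k)"
    unfolding pitchfork_def by (simp add: not_eventually)
  then obtain k where k: "n \<le> k" "restrict c (interval k) = restrict g (interval k)"
    unfolding INFM_nat_le by blast
  have cg: "c i = g i" if "i \<in> interval k" for i
    using fun_cong[OF k(2), of i] that by simp
  \<comment> \<open>The block of \<open>g\<close> is used instead of the equal block of
    \<open>c\<close>; it is plainly an element of \<open>M\<close>, and \<open>G\<close> provides
    members of \<open>D\<close> below every condition of \<open>P\<close> with the stem of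
    \<open>r\<close>.\<close>
  define D where "D = {p \<in> conds P. \<forall>e\<in>elts (block k g). p \<in> conds P \<and> forces_mem P p (check_name P e) h}"
  have D: "M.isset D" "D \<subseteq> conds P"
    unfolding D_def
    by (intro M.separation M.isset_conds M.definable_forces_mem dfn M.names_in[OF hn] M.block_in) blast
  have dense: "\<exists>d\<in>D. elts d \<subseteq> elts T" if "T \<in> conds P" "stem T = stem r" for T
    using G[OF that, of k] unfolding D_def by blast
  obtain d T where T: "d \<in> D" "T \<in> conds Q" "elts T \<subseteq> elts r" "elts T \<subseteq> elts d"
    by (rule common_extension[OF D dense r(1) refl])
  have dP: "d \<in> conds P" using T(1) D(2) by blast
  have "below Q T r" using T(3) by simp
  from R[OF k(1) T(2) this] obtain S i y where S: "S \<in> conds Q" "below Q S T" "i \<in> interval k" "y \<in> names N Q"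
    and cases: "forces_mem Q S (N.opn (check_name Q (vnat i)) y) ?c \<and>
        (\<forall>t\<in>conds Q. below Q t S \<longrightarrow> \<not> forces_mem Q t (N.opn (check_name Q (vnat i)) y) h) \<or>
      forces_mem Q S (N.opn (check_name Q (vnat i)) y) h \<and>
        (\<forall>t\<in>conds Q. below Q t S \<longrightarrow> \<not> forces_mem Q t (N.opn (check_name Q (vnat i)) y) ?c)"
    unfolding Let_def by blast
  let ?\<tau> = "N.opn (check_name Q (vnat i)) y" and ?e = "vpair (vnat i) (vbit (c i)) :: 'v"
  have e_block: "?e \<in> elts (block k g)" using S(3) cg by (simp add: elts_block)
  have eM: "?e \<in> M" by simp
  have d_e: "forces_mem P d (check_name P ?e) h" using T(1) e_block unfolding D_def by blast
  have Sd: "elts S \<subseteq> elts d" using S(2) T(4) by simp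
  show False
    using cases
  proof (elim disjE conjE)
    \<comment> \<open>Being in \<open>c\<close> with first coordinate \<open>i\<close>, the pair is
      \<open>(i, c i)\<close>, which \<open>d\<close> forces into \<open>h\<close>.\<close>
    assume mem: "forces_mem Q S ?\<tau> ?c" and no: "\<forall>t\<in>conds Q. below Q t S \<longrightarrow> \<not> forces_mem Q t ?\<tau> h"
    obtain t e where t: "t \<in> conds Q" "below Q t S" "e \<in> elts cc" "forces_eq Q t ?\<tau> (check_name Q e)"
      using mem[unfolded N.mem_check[OF cc(1)], rule_format, OF S(1) N.below_refl] by blast
    obtain j where j: "e = vpair (vnat j) (vbit (c j))" using t(3) unfolding cc(2) real_graph_vbit by blast
    have "vnat i = (vnat j :: 'v)"
      using N.opn_check_fst[OF t(1) N.vnat_in N.vnat_in N.vbit_in t(4)[unfolded j]] .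
    then have "e = ?e" using j by simp
    have "forces_mem Q d (check_name Q ?e) h"
      using forces_mem_absolute[OF dP M.check_name_name[OF eM] hn d_e] unfolding check_name_eq .
    then have "forces_mem Q t (check_name Q ?e) h"
      by (rule N.mem_mono) (use t(2) Sd in simp)
    then have "forces_mem Q t ?\<tau> h"
      using N.mem_eq_left[OF N.eq_sym[OF t(4)]] \<open>e = ?e\<close> by simp
    then show False using no t(1,2) by blast
  next
    \<comment> \<open>A condition \<open>u\<close> of \<open>P\<close> puts the decided pair
      \<open>(i, b)\<close> into \<open>h\<close>, while \<open>d\<close> puts
      \<open>(i, c i)\<close> there; \<open>d\<close> and \<open>u\<close> are compatible in
      \<open>P\<close>, so uniqueness of values makes \<open>b\<close> the bit of
      \<open>c\<close>.\<close>
    assume mem: "forces_mem Q S ?\<tau> h" and no: "\<forall>t\<in>conds Q. below Q t S \<longrightarrow> \<not> forces_mem Q t ?\<tau> ?c"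
    obtain t u m b where t: "t \<in> conds Q" "elts t \<subseteq> elts S" "u \<in> conds P" "elts t \<subseteq> elts u"
      "forces_eq Q t ?\<tau> (check_name Q (vpair (vnat m) (vnat b)))"
      "forces_mem P u (check_name P (vpair (vnat m) (vnat b))) h"
      by (rule real_elt_Q[OF h S(1) mem])
    have "vnat i = (vnat m :: 'v)"
      using N.opn_check_fst[OF t(1) N.vnat_in N.vnat_in N.vnat_in t(5)] .
    then have m: "m = i" by simp
    have "elts t \<subseteq> elts d" using t(2) Sd by blast
    from compatible[OF dP t(3,1) this t(4)] obtain w where
      w: "w \<in> conds P" "below P w d" "below P w u" by auto
    have "forces_mem P w (check_name P (vpair (vnat i) (vnat (if c i then 1 else 0)))) h"
      using M.mem_mono[OF d_e w(2)] by (simp add: vbit_def)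
    moreover have "forces_mem P w (check_name P (vpair (vnat i) (vnat b))) h"
      using M.mem_mono[OF t(6) w(3)] m by simp
    ultimately have "(if c i then 1 else 0) = b" by (rule M.real_unique[OF h w(1)])
    then have "forces_eq Q t ?\<tau> (check_name Q ?e)" using t(5) m by (simp add: vbit_def)
    moreover have "?e \<in> elts cc" unfolding cc(2) real_graph_vbit by blast
    ultimately have "forces_mem Q t ?\<tau> ?c"
      unfolding N.mem_check[OF cc(1)] using N.eq_mono N.below_refl by blast
    then show False using no t(1,2) by simp
  qed
qed

end

theorem lemma2p25:
  fixes M N :: "'v::set_universe set" and U V :: 'v
  assumes "transitive_model_ZFC M" and "transitive_model_ZFC N" and "M \<subseteq> N"
    and "U \<in> M" and "nonprincipal_ultrafilter_in M U"
    and "V \<in> N" and "nonprincipal_ultrafilter_in N V"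
    and "elts U \<subseteq> elts V"
  shows
    "(\<forall>F x (z :: nat list \<Rightarrow> 'v).
        F \<subseteq> M \<longrightarrow> finite F \<longrightarrow> name_for_member M (laver M U) F x \<longrightarrow>
        (\<forall>s. z s \<in> F \<and>
          (\<forall>T\<in>conds (laver M U). stem T = s \<longrightarrow> \<not> forces_neq M (laver M U) T x (z s))) \<longrightarrow>
        (\<forall>s. \<forall>T\<in>conds (laver N V). stem T = s \<longrightarrow> \<not> forces_neq N (laver N V) T x (z s)))
     \<and> (\<forall>c\<in>reals_of N. pitchfork_unbounded_over M c \<longrightarrow> star (laver M U) (laver N V) M N c)"
proof -
  interpret laver_pair M N U V
    by unfold_locales (fact assms)+
  show ?thesis
  proof (intro conjI allI impI ballI)
    fix F x s T and z :: "nat list \<Rightarrow> 'v"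
    assume F: "F \<subseteq> M" "name_for_member M P F x"
      and z: "\<forall>s. z s \<in> F \<and> (\<forall>T\<in>conds P. stem T = s \<longrightarrow> \<not> forces_neq M P T x (z s))"
      and T: "T \<in> conds Q" "stem T = s"
    have "x \<in> names M P" using F(2) by (simp add: name_for_member_def)
    moreover have "z s \<in> M" using z F(1) by blast
    ultimately show "\<not> forces_neq N Q T x (z s)"
      using z T by (intro not_forces_neq[where s = s]) blast+
  next
    fix c assume "c \<in> reals_of N" "pitchfork_unbounded_over M c"
    then show "star P Q M N c" by (rule star_laver)
  qed
qed

end
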